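(* There exists a nonquasireflexive Banach space $X$ such that $X\notin TNNS$ (that is, $X^{*}$ contains no total nowhere norming subspace) and such that there exists a strictly singular operator $T:X\to c_{0}$ which is not weakly compact.
   Context: "Subspace" means closed linear subspace and "operator" means bounded linear operator. Let $X$ be a Banach space with dual $X^{*}$. A subspace $M\subset X^{*}$ is total if for every $0\neq x\in X$ there is $f\in M$ with $f(x)\neq 0$. A subspace $M\subset X^{*}$ is norming over a subspace $L\subset X$ if there is $c>0$ such that $\sup_{f\in S(M)}|f(x)|\ge c\|x\|$ for all $x\in L$, where $S(M)$ is the unit sphere of $M$. A subspace $M\subset X^{*}$ is nowhere norming if there is no infinite-dimensional subspace $L\subset X$ over which $M$ is norming. One writes $X\in TNNS$ if $X^{*}$ contains a total nowhere norming subspace. A Banach space is quasireflexive if its canonical image has finite codimension in its bidual; nonquasireflexive means not quasireflexive. An operator $T:X\to Y$ between Banach spaces is strictly singular if its restriction to any infinite-dimensional subspace of $X$ is not an isomorphism onto its image. *)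

theory Defs
  imports "HOL-Analysis.Analysis" "HOL-Library.Function_Algebras"
begin

text \<open>
  Function spaces as real vector spaces under pointwise operations, so that sequence spaces,
  duals and biduals all live in ambient types of class \<^class>\<open>real_vector\<close>.
\<close>

instantiation "fun" :: (type, real_vector) real_vector
begin

definition scaleR_fun :: "real \<Rightarrow> ('a \<Rightarrow> 'b) \<Rightarrow> 'a \<Rightarrow> 'b"
  where "scaleR_fun c f = (\<lambda>x. c *\<^sub>R f x)"

instance
  by standard (simp_all add: scaleR_fun_def plus_fun_def scaleR_add_right scaleR_add_left)

end

text \<open>
  A normed space is a linear subspace of an ambient real vector space together with its own norm.
  The ambient type carries no topology that matters here, and the values of
  the norm outside the space are irrelevant.
\<close>

record 'a nspace =
  vecs :: "'a set"
  vnorm :: "'a \<Rightarrow> real"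

definition normed_space :: "'a::real_vector nspace \<Rightarrow> bool" where
  "normed_space X \<longleftrightarrow> subspace (vecs X) \<and>
     (\<forall>x\<in>vecs X. 0 \<le> vnorm X x \<and> (vnorm X x = 0 \<longleftrightarrow> x = 0)) \<and>
     (\<forall>x\<in>vecs X. \<forall>y\<in>vecs X. vnorm X (x + y) \<le> vnorm X x + vnorm X y) \<and>
     (\<forall>x\<in>vecs X. \<forall>c. vnorm X (c *\<^sub>R x) = \<bar>c\<bar> * vnorm X x)"

text \<open>
  The locale \<^locale>\<open>Metric_space\<close> requires nonnegativity and symmetry on the
  whole type, hence the value 0 outside the space.
\<close>

definition vdist :: "'a::real_vector nspace \<Rightarrow> 'a \<Rightarrow> 'a \<Rightarrow> real" where
  "vdist X x y = (if x \<in> vecs X \<and> y \<in> vecs X then vnorm X (x - y) else 0)"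

lemma Metric_space_vdist:
  assumes "normed_space X"
  shows "Metric_space (vecs X) (vdist X)"
proof
  have sub: "subspace (vecs X)"
    and pos: "\<And>x. x \<in> vecs X \<Longrightarrow> 0 \<le> vnorm X x"
    and zero: "\<And>x. x \<in> vecs X \<Longrightarrow> vnorm X x = 0 \<longleftrightarrow> x = 0"
    and tri: "\<And>x y. x \<in> vecs X \<Longrightarrow> y \<in> vecs X \<Longrightarrow> vnorm X (x + y) \<le> vnorm X x + vnorm X y"
    and hom: "\<And>x c. x \<in> vecs X \<Longrightarrow> vnorm X (c *\<^sub>R x) = \<bar>c\<bar> * vnorm X x"
    using assms unfolding normed_space_def by blast+
  note diff = subspace_diff[OF sub]
  show "0 \<le> vdist X x y" for x y
    by (simp add: vdist_def pos diff)
  show "vdist X x y = vdist X y x" for x y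
    using hom[OF diff, of x y "-1"] by (auto simp: vdist_def)
  show "vdist X x y = 0 \<longleftrightarrow> x = y" if "x \<in> vecs X" "y \<in> vecs X" for x y
    using that zero[OF diff, of x y] by (simp add: vdist_def)
  show "vdist X x z \<le> vdist X x y + vdist X y z"
    if "x \<in> vecs X" "y \<in> vecs X" "z \<in> vecs X" for x y z
    using that tri[OF diff diff, of x y y z] by (simp add: vdist_def)
qed

definition banach_space :: "'a::real_vector nspace \<Rightarrow> bool" where
  "banach_space X \<longleftrightarrow> normed_space X \<and> Metric_space.mcomplete (vecs X) (vdist X)"

definition closed_subspace :: "'a::real_vector nspace \<Rightarrow> 'a set \<Rightarrow> bool" where
  "closed_subspace X L \<longleftrightarrow> subspace L \<and>
     closedin (Metric_space.mtopology (vecs X) (vdist X)) L"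

definition infinite_dimensional :: "'a::real_vector set \<Rightarrow> bool" where
  "infinite_dimensional L \<longleftrightarrow> (\<nexists>B. finite B \<and> L \<subseteq> span B)"

definition bounded_operator ::
    "'a::real_vector nspace \<Rightarrow> 'b::real_vector nspace \<Rightarrow> ('a \<Rightarrow> 'b) \<Rightarrow> bool" where
  "bounded_operator X Y T \<longleftrightarrow> T ` vecs X \<subseteq> vecs Y \<and>
     (\<forall>x\<in>vecs X. \<forall>y\<in>vecs X. T (x + y) = T x + T y) \<and>
     (\<forall>x\<in>vecs X. \<forall>c. T (c *\<^sub>R x) = c *\<^sub>R T x) \<and>
     (\<exists>C. \<forall>x\<in>vecs X. vnorm Y (T x) \<le> C * vnorm X x)"

definition scalars :: "real nspace" where
  "scalars = \<lparr>vecs = UNIV, vnorm = abs\<rparr>"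

text \<open>
  Functionals are taken to vanish outside the space, so that equality of functions in the
  ambient type is equality of functionals.
\<close>

definition dual :: "'a::real_vector nspace \<Rightarrow> ('a \<Rightarrow> real) nspace" where
  "dual X = \<lparr>vecs = {f. bounded_operator X scalars f \<and> (\<forall>x. x \<notin> vecs X \<longrightarrow> f x = 0)},
     vnorm = (\<lambda>f. SUP x\<in>{x \<in> vecs X. vnorm X x \<le> 1}. \<bar>f x\<bar>)\<rparr>"

definition canonical_image :: "'a::real_vector nspace \<Rightarrow> (('a \<Rightarrow> real) \<Rightarrow> real) set" where
  "canonical_image X = (\<lambda>x f. if f \<in> vecs (dual X) then f x else 0) ` vecs X"

text \<open>Finite codimension: the bidual is spanned by the canonical image and finitely many vectors.\<close>

definition quasireflexive :: "'a::real_vector nspace \<Rightarrow> bool" where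
  "quasireflexive X \<longleftrightarrow>
     (\<exists>F. finite F \<and> F \<subseteq> vecs (dual (dual X)) \<and>
          vecs (dual (dual X)) = span (canonical_image X \<union> F))"

definition total_for :: "'a::real_vector nspace \<Rightarrow> ('a \<Rightarrow> real) set \<Rightarrow> bool" where
  "total_for X M \<longleftrightarrow> (\<forall>x\<in>vecs X. x \<noteq> 0 \<longrightarrow> (\<exists>f\<in>M. f x \<noteq> 0))"

text \<open>The supremum is taken in \<^typ>\<open>ennreal\<close> so that it is 0 when the unit sphere is empty.\<close>

definition norming_over :: "'a::real_vector nspace \<Rightarrow> ('a \<Rightarrow> real) set \<Rightarrow> 'a set \<Rightarrow> bool" where
  "norming_over X M L \<longleftrightarrow>
     (\<exists>c>0. \<forall>x\<in>L. (SUP f\<in>{f \<in> M. vnorm (dual X) f = 1}. ennreal \<bar>f x\<bar>) \<ge> ennreal (c * vnorm X x))"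

definition nowhere_norming :: "'a::real_vector nspace \<Rightarrow> ('a \<Rightarrow> real) set \<Rightarrow> bool" where
  "nowhere_norming X M \<longleftrightarrow>
     (\<nexists>L. closed_subspace X L \<and> infinite_dimensional L \<and> norming_over X M L)"

definition TNNS :: "'a::real_vector nspace \<Rightarrow> bool" where
  "TNNS X \<longleftrightarrow> (\<exists>M. closed_subspace (dual X) M \<and> total_for X M \<and> nowhere_norming X M)"

definition isomorphism_onto_image ::
    "'a::real_vector nspace \<Rightarrow> 'b::real_vector nspace \<Rightarrow> ('a \<Rightarrow> 'b) \<Rightarrow> bool" where
  "isomorphism_onto_image X Y T \<longleftrightarrow> bounded_operator X Y T \<and> inj_on T (vecs X) \<and>
     bounded_operator (Y\<lparr>vecs := T ` vecs X\<rparr>) X (inv_into (vecs X) T)"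

definition strictly_singular ::
    "'a::real_vector nspace \<Rightarrow> 'b::real_vector nspace \<Rightarrow> ('a \<Rightarrow> 'b) \<Rightarrow> bool" where
  "strictly_singular X Y T \<longleftrightarrow> bounded_operator X Y T \<and>
     (\<forall>L. closed_subspace X L \<and> infinite_dimensional L
        \<longrightarrow> \<not> isomorphism_onto_image (X\<lparr>vecs := L\<rparr>) Y T)"

definition weak_topology :: "'a::real_vector nspace \<Rightarrow> 'a topology" where
  "weak_topology X = topology_generated_by
     {{x \<in> vecs X. f x \<in> U} |f U. f \<in> vecs (dual X) \<and> open U}"

definition weakly_compact ::
    "'a::real_vector nspace \<Rightarrow> 'b::real_vector nspace \<Rightarrow> ('a \<Rightarrow> 'b) \<Rightarrow> bool" where
  "weakly_compact X Y T \<longleftrightarrow> bounded_operator X Y T \<and>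
     compactin (weak_topology Y)
       (weak_topology Y closure_of (T ` {x \<in> vecs X. vnorm X x \<le> 1}))"

definition c0 :: "(nat \<Rightarrow> real) nspace" where
  "c0 = \<lparr>vecs = {x. x \<longlonglongrightarrow> 0}, vnorm = (\<lambda>x. SUP n. \<bar>x n\<bar>)\<rparr>"

end

theory Submission
  imports Defs
begin

text \<open>
  The example is the direct sum of the James space and the space \<open>c\<^sub>0\<close> of null sequences, stored in
  the even and the odd coordinates of one sequence, and the operator is the projection to the first
  summand followed by the inclusion of the James space in \<open>c\<^sub>0\<close>.

  The James space consists of the null sequences of finite square variation. Its norm is normalized
  so that successive blocks \<open>u\<close>, \<open>v\<close> satisfy \<open>\<parallel>u + v\<parallel>\<^sup>2 \<le> \<parallel>u\<parallel>\<^sup>2 + \<parallel>v\<parallel>\<^sup>2\<close> (lemma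
  \<open>james_bounded_blocks\<close>). This upper estimate makes the unit vectors shrinking
  (\<open>James_shrinking\<close>), so that elements of the bidual are sequences of bounded square variation
  (\<open>James_bidual\<close>). Such sequences converge, and those with limit 0 belong to the James
  space: its bidual exceeds it by at most one dimension.

  The operator is strictly singular because sums of far apart humps have bounded supremum norm but
  growing square variation. It is not weakly compact because initial segments of the constant
  sequence 1 are bounded in the James space. The direct sum is not quasireflexive because the bounded
  sequences are infinite-dimensional modulo the null sequences.

  The main point is that a total subspace \<open>M\<close> of the dual is norming over some infinite-dimensional
  subspace. Functionals on \<open>c\<^sub>0\<close> have absolutely summable coefficients. Suppose first that, however
  many coefficients are prescribed to vanish, \<open>M\<close> contains a functional whose coefficients on the
  second summand carry more than half of its norm. Then a gliding hump produces a copy of \<open>c\<^sub>0\<close> inside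
  the second summand over which \<open>M\<close> is norming (\<open>norming_over_sign_blocks\<close>). Otherwise, on a subspace
  \<open>S\<close> of finite codimension in \<open>M\<close>, the norm is controlled by the restriction to the James space.
  There each coefficient is, by the Hahn--Banach theorem, the restriction of an element of
  the bidual of the James space. Since this bidual is at most one dimension larger than the James space,
  some nontrivial combination of any two coefficients is evaluation at a vector of the James space,
  and the difference is a nonzero vector killed by \<open>S\<close> (\<open>annihilated_vector\<close>). This gives an
  infinite-dimensional space of vectors killed by \<open>S\<close>, and the finitely many remaining functionals
  of \<open>M\<close> cannot separate all of them from 0. So \<open>M\<close> would not be total.
\<close>

section \<open>Linear functionals, dimension, and the Hahn--Banach theorem\<close>

lemma scaleR_fun_apply [simp]: "(c *\<^sub>R f) x = c *\<^sub>R f x"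
  by (simp add: scaleR_fun_def)

lemma sum_fun_apply: "(\<Sum>i\<in>I. f i) x = (\<Sum>i\<in>I. f i x)"
  by (induction I rule: infinite_finite_induct) auto

definition linear_functional_on :: "'a::real_vector set \<Rightarrow> ('a \<Rightarrow> real) \<Rightarrow> bool" where
  "linear_functional_on S f \<longleftrightarrow>
     (\<forall>x\<in>S. \<forall>y\<in>S. f (x + y) = f x + f y) \<and> (\<forall>x\<in>S. \<forall>c. f (c *\<^sub>R x) = c * f x)"

lemma linear_functional_on_add:
  "linear_functional_on S f \<Longrightarrow> x \<in> S \<Longrightarrow> y \<in> S \<Longrightarrow> f (x + y) = f x + f y"
  by (simp add: linear_functional_on_def)

lemma linear_functional_on_scale:
  "linear_functional_on S f \<Longrightarrow> x \<in> S \<Longrightarrow> f (c *\<^sub>R x) = c * f x"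
  by (simp add: linear_functional_on_def)

lemma linear_functional_on_zero:
  assumes "subspace S" "linear_functional_on S f"
  shows "f 0 = 0"
  using linear_functional_on_scale[OF assms(2) subspace_0[OF assms(1)], of 0] by simp

lemma linear_functional_on_diff:
  assumes "subspace S" "linear_functional_on S f" "x \<in> S" "y \<in> S"
  shows "f (x - y) = f x - f y"
  using linear_functional_on_add[OF assms(2) assms(3) subspace_scale[OF assms(1) assms(4)], of "-1"]
    linear_functional_on_scale[OF assms(2) assms(4), of "-1"] by simp

lemma linear_functional_on_sum:
  assumes "subspace S" "linear_functional_on S f" "\<And>i. i \<in> I \<Longrightarrow> g i \<in> S"
  shows "f (\<Sum>i\<in>I. c i *\<^sub>R g i) = (\<Sum>i\<in>I. c i * f (g i))"
  using assms(3)
proof (induction I rule: infinite_finite_induct)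
  case (insert i I)
  then have "(\<Sum>i\<in>I. c i *\<^sub>R g i) \<in> S" "c i *\<^sub>R g i \<in> S"
    using assms(1) by (auto intro!: subspace_sum subspace_scale)
  with insert show ?case
    using assms(2) by (simp add: linear_functional_on_add linear_functional_on_scale)
qed (use assms(1,2) in \<open>auto simp: linear_functional_on_zero\<close>)

lemma linear_functional_on_subset:
  "linear_functional_on S f \<Longrightarrow> R \<subseteq> S \<Longrightarrow> linear_functional_on R f"
  unfolding linear_functional_on_def by blast

text \<open>
  The relation is stated for a sequence of vectors, which need not be distinct, so that coefficients
  can be compared index by index.
\<close>

lemma nontrivial_relation_in_span:
  fixes g :: "nat \<Rightarrow> 'a::real_vector"
  assumes "finite F" and g: "\<And>k. g k \<in> span F"
  obtains n c where "\<exists>k<n. c k \<noteq> 0" "(\<Sum>k<n. c k *\<^sub>R g k) = (0::'a)"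
proof -
  let ?n = "Suc (card F)"
  show ?thesis
  proof (cases "inj_on g {..<?n}")
    case True
    have "\<not> independent (g ` {..<?n})"
    proof
      assume "independent (g ` {..<?n})"
      then have "card (g ` {..<?n}) \<le> card F"
        using independent_span_bound[OF \<open>finite F\<close>, of "g ` {..<?n}"] g by blast
      then show False using True by (simp add: card_image)
    qed
    then obtain u v where u: "v \<in> g ` {..<?n}" "u v \<noteq> 0" "(\<Sum>v\<in>g ` {..<?n}. u v *\<^sub>R v) = 0"
      using dependent_finite[of "g ` {..<?n}"] by auto
    have "(\<Sum>k<?n. u (g k) *\<^sub>R g k) = 0"
      using u(3) by (simp add: sum.reindex[OF True] del: sum.lessThan_Suc)
    then show ?thesis using u that[of ?n "u \<circ> g"] by auto
  next
    case False
    then obtain i j where ij: "i < ?n" "j < ?n" "i \<noteq> j" "g i = g j"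
      by (auto simp: inj_on_def)
    define c where "c k = (if k = i then 1 else if k = j then -1 else 0::real)" for k
    have "(\<Sum>k<?n. c k *\<^sub>R g k) = (\<Sum>k\<in>{i, j}. c k *\<^sub>R g k)"
      using ij by (intro sum.mono_neutral_right) (auto simp: c_def)
    also have "\<dots> = 0" using ij by (simp add: c_def)
    finally have "(\<Sum>k<?n. c k *\<^sub>R g k) = 0" .
    moreover have "\<exists>k<?n. c k \<noteq> 0" using ij(1) by (intro exI[of _ i]) (simp add: c_def)
    ultimately show ?thesis using that[of ?n c] by blast
  qed
qed

lemma infinite_dimensional_kernel:
  assumes S: "subspace S" "infinite_dimensional S" and f: "linear_functional_on S f"
  shows "subspace {x \<in> S. f x = 0}" "infinite_dimensional {x \<in> S. f x = 0}"
proof -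
  show "subspace {x \<in> S. f x = 0}"
    using S(1) f linear_functional_on_zero[OF S(1) f]
    by (auto simp: subspace_def linear_functional_on_def)
  show "infinite_dimensional {x \<in> S. f x = 0}"
  proof (cases "\<exists>v\<in>S. f v \<noteq> 0")
    case True
    then obtain v where v: "v \<in> S" "f v \<noteq> 0" by blast
    show ?thesis
      unfolding infinite_dimensional_def
    proof
      assume "\<exists>B. finite B \<and> {x \<in> S. f x = 0} \<subseteq> span B"
      then obtain B where B: "finite B" "{x \<in> S. f x = 0} \<subseteq> span B" by blast
      have "S \<subseteq> span (insert v B)"
      proof
        fix x assume x: "x \<in> S"
        let ?y = "x - (f x / f v) *\<^sub>R v"
        have vs: "(f x / f v) *\<^sub>R v \<in> S" using v S(1) by (simp add: subspace_scale)
        have "?y \<in> S" using x vs S(1) by (simp add: subspace_diff)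
        moreover have "f ?y = 0"
          using linear_functional_on_diff[OF S(1) f x vs] linear_functional_on_scale[OF f v(1)] v(2)
          by simp
        ultimately have "?y \<in> span B" using B by blast
        then show "x \<in> span (insert v B)" unfolding span_insert by blast
      qed
      then show False using S(2) B(1) unfolding infinite_dimensional_def by blast
    qed
  next
    case False
    then have "{x \<in> S. f x = 0} = S" by blast
    then show ?thesis using S(2) by simp
  qed
qed

lemma infinite_dimensional_nonzero:
  assumes "infinite_dimensional S"
  obtains x where "x \<in> S" "x \<noteq> 0"
proof -
  have "\<not> S \<subseteq> span {}" using assms unfolding infinite_dimensional_def by blast
  then show ?thesis using that by auto
qed

lemma infinite_dimensionalI:
  fixes w :: "nat \<Rightarrow> 'a::real_vector"
  assumes "\<And>k. w k \<in> S"
    and "\<And>n c k. (\<Sum>k<n. c k *\<^sub>R w k) = 0 \<Longrightarrow> k < n \<Longrightarrow> c k = 0"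
  shows "infinite_dimensional S"
  unfolding infinite_dimensional_def
proof
  assume "\<exists>B. finite B \<and> S \<subseteq> span B"
  then obtain B where B: "finite B" "S \<subseteq> span B" by blast
  have "w k \<in> span B" for k using assms(1) B(2) by blast
  then obtain n c where "\<exists>k<n. c k \<noteq> 0" "(\<Sum>k<n. c k *\<^sub>R w k) = 0"
    using nontrivial_relation_in_span[OF B(1), of w] by blast
  then show False using assms(2) by blast
qed

lemma infinite_dimensional_mono: "infinite_dimensional S \<Longrightarrow> S \<subseteq> T \<Longrightarrow> infinite_dimensional T"
  unfolding infinite_dimensional_def by blast

lemma infinite_dimensional_common_zero:
  assumes S: "subspace S" "infinite_dimensional S" and f: "\<And>i::nat. linear_functional_on S (f i)"
  shows "\<exists>x\<in>S. x \<noteq> 0 \<and> (\<forall>i<N. f i x = 0)"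
proof -
  have "subspace {x \<in> S. \<forall>i<N. f i x = 0} \<and> infinite_dimensional {x \<in> S. \<forall>i<N. f i x = 0}"
  proof (induction N)
    case 0
    show ?case using S by simp
  next
    case (Suc N)
    have eq: "{x \<in> S. \<forall>i<Suc N. f i x = 0} = {x \<in> {x \<in> S. \<forall>i<N. f i x = 0}. f N x = 0}"
      by (auto simp: less_Suc_eq)
    have "linear_functional_on {x \<in> S. \<forall>i<N. f i x = 0} (f N)"
      by (rule linear_functional_on_subset[OF f]) blast
    then show ?case using Suc infinite_dimensional_kernel unfolding eq by blast
  qed
  then obtain x where "x \<in> {x \<in> S. \<forall>i<N. f i x = 0}" "x \<noteq> 0"
    by (elim conjE infinite_dimensional_nonzero)
  then show ?thesis by (intro bexI[of _ x]) simp_all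
qed

text \<open>
  The one-step extension of the Hahn--Banach argument, for functionals given by their graphs: the
  value at \<open>v\<close> has to lie between the lower bounds \<open>a - p (x - v)\<close> and the upper bounds
  \<open>p (y + v) - b\<close>, and subadditivity puts the former below the latter.
\<close>

lemma Hahn_Banach_step:
  fixes G :: "('a::real_vector \<times> real) set" and p :: "'a \<Rightarrow> real"
  assumes V: "subspace V" and G: "subspace G" "G \<subseteq> V \<times> UNIV" and v: "v \<in> V"
    and add: "\<And>x y. x \<in> V \<Longrightarrow> y \<in> V \<Longrightarrow> p (x + y) \<le> p x + p y"
    and scale: "\<And>x c. x \<in> V \<Longrightarrow> p (c *\<^sub>R x) = \<bar>c\<bar> * p x"
    and le: "\<And>x a. (x, a) \<in> G \<Longrightarrow> a \<le> p x"
  obtains c where "\<And>x a t. (x, a) \<in> G \<Longrightarrow> a + t * c \<le> p (x + t *\<^sub>R v)"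
proof -
  have sep: "a - p (x - v) \<le> p (y + v) - b" if "(x, a) \<in> G" "(y, b) \<in> G" for x a y b
  proof -
    have "(x + y, a + b) \<in> G" using subspace_add[OF G(1) that] by simp
    then have "a + b \<le> p ((x - v) + (y + v))" using le by (simp add: algebra_simps)
    also have "\<dots> \<le> p (x - v) + p (y + v)"
      using that G(2) v V by (intro add) (auto intro: subspace_diff subspace_add)
    finally show ?thesis by simp
  qed
  have G0: "(0, 0) \<in> G" using subspace_0[OF G(1)] by (simp add: zero_prod_def)
  define c where "c = (SUP (x, a)\<in>G. a - p (x - v))"
  have bdd: "bdd_above ((\<lambda>(x, a). a - p (x - v)) ` G)"
    by (rule bdd_aboveI[of _ "p (0 + v) - 0"]) (use sep[OF _ G0] in fastforce)
  have lower: "a - p (x - v) \<le> c" if "(x, a) \<in> G" for x a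
    unfolding c_def by (rule cSUP_upper2[OF bdd that]) simp
  have upper: "c \<le> p (y + v) - b" if "(y, b) \<in> G" for y b
    unfolding c_def by (rule cSUP_least) (use G0 sep[OF _ that] in auto)
  show ?thesis
  proof (rule that)
    fix x a and t :: real assume xa: "(x, a) \<in> G"
    consider "t = 0" | "t > 0" | "t < 0" by linarith
    then show "a + t * c \<le> p (x + t *\<^sub>R v)"
    proof cases
      case 1 then show ?thesis using le[OF xa] by simp
    next
      case 2
      have "((1/t) *\<^sub>R x, a / t) \<in> G" using subspace_scale[OF G(1) xa, of "1/t"] by simp
      then have "t * c \<le> t * (p ((1/t) *\<^sub>R x + v) - a / t)"
        using upper 2 by (intro mult_left_mono) auto
      also have "\<dots> = p (t *\<^sub>R ((1/t) *\<^sub>R x + v)) - a"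
        using 2 xa G(2) v V
        by (subst scale) (auto intro!: subspace_add subspace_scale simp: algebra_simps)
      also have "t *\<^sub>R ((1/t) *\<^sub>R x + v) = x + t *\<^sub>R v" using 2 by (simp add: algebra_simps)
      finally show ?thesis by simp
    next
      case 3
      have "((- 1/t) *\<^sub>R x, - a / t) \<in> G" using subspace_scale[OF G(1) xa, of "-1/t"] by simp
      then have "(- t) * (- a / t - p ((-1/t) *\<^sub>R x - v)) \<le> (- t) * c"
        using lower 3 by (intro mult_left_mono) auto
      moreover have "(- t) * (- a / t - p ((-1/t) *\<^sub>R x - v)) = a - p ((- t) *\<^sub>R ((-1/t) *\<^sub>R x - v))"
        using 3 xa G(2) v V
        by (subst scale) (auto intro!: subspace_diff subspace_scale subspace_neg simp: algebra_simps)
      moreover have "(- t) *\<^sub>R ((-1/t) *\<^sub>R x - v) = x + t *\<^sub>R v" using 3 by (simp add: algebra_simps)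
      ultimately show ?thesis by simp
    qed
  qed
qed

text \<open>
  Graphs of dominated functionals are exactly the linear subspaces of \<open>V \<times> \<real>\<close> lying below the
  graph of \<open>p\<close>: such a subspace contains no \<open>(0, a)\<close> with \<open>a \<noteq> 0\<close>, so it is single-valued by
  itself. Zorn's lemma therefore only has to deal with subspaces ordered by inclusion.
\<close>

lemma Hahn_Banach:
  fixes V :: "'a::real_vector set" and p :: "'a \<Rightarrow> real"
  assumes V: "subspace V" and U: "subspace U" "U \<subseteq> V"
    and add: "\<And>x y. x \<in> V \<Longrightarrow> y \<in> V \<Longrightarrow> p (x + y) \<le> p x + p y"
    and scale: "\<And>x c. x \<in> V \<Longrightarrow> p (c *\<^sub>R x) = \<bar>c\<bar> * p x"
    and f: "linear_functional_on U f" "\<And>x. x \<in> U \<Longrightarrow> f x \<le> p x"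
  obtains g where "linear_functional_on V g" "\<And>x. x \<in> U \<Longrightarrow> g x = f x" "\<And>x. x \<in> V \<Longrightarrow> \<bar>g x\<bar> \<le> p x"
proof -
  define G0 where "G0 = (\<lambda>x. (x, f x)) ` U"
  define \<A> where "\<A> = {G. subspace G \<and> G0 \<subseteq> G \<and> G \<subseteq> V \<times> UNIV \<and> (\<forall>(x, a)\<in>G. a \<le> p x)}"
  have "subspace G0"
    unfolding subspace_def
  proof (intro conjI ballI allI)
    show "0 \<in> G0"
      unfolding G0_def using subspace_0[OF U(1)] linear_functional_on_zero[OF U(1) f(1)]
      by (auto simp: zero_prod_def intro!: rev_image_eqI[of 0])
    show "z + w \<in> G0" if "z \<in> G0" "w \<in> G0" for z w
      using that f(1) subspace_add[OF U(1)]
      unfolding G0_def linear_functional_on_def by (force simp: image_iff)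
    show "c *\<^sub>R z \<in> G0" if "z \<in> G0" for c z
      using that f(1) subspace_scale[OF U(1)]
      unfolding G0_def linear_functional_on_def by (force simp: image_iff)
  qed
  then have "G0 \<in> \<A>" using U(2) f(2) by (auto simp: \<A>_def G0_def)
  moreover have "\<Union>\<C> \<in> \<A>" if "\<C> \<noteq> {}" and ch: "subset.chain \<A> \<C>" for \<C>
  proof -
    have C: "\<C> \<subseteq> \<A>" and tot: "\<And>A B. A \<in> \<C> \<Longrightarrow> B \<in> \<C> \<Longrightarrow> A \<subseteq> B \<or> B \<subseteq> A"
      using ch by (auto simp: subset_chain_def)
    have sub: "subspace A" if "A \<in> \<C>" for A using that C by (auto simp: \<A>_def)
    have "subspace (\<Union>\<C>)"
      unfolding subspace_def
    proof (intro conjI ballI allI)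
      show "0 \<in> \<Union>\<C>" using \<open>\<C> \<noteq> {}\<close> sub subspace_0 by blast
      show "x + y \<in> \<Union>\<C>" if "x \<in> \<Union>\<C>" "y \<in> \<Union>\<C>" for x y
      proof -
        obtain A B where "A \<in> \<C>" "B \<in> \<C>" "x \<in> A" "y \<in> B"
          using \<open>x \<in> \<Union>\<C>\<close> \<open>y \<in> \<Union>\<C>\<close> by blast
        then show ?thesis using tot[of A B] sub subspace_add by blast
      qed
      show "c *\<^sub>R x \<in> \<Union>\<C>" if "x \<in> \<Union>\<C>" for c x using that sub subspace_scale by blast
    qed
    moreover have "G0 \<subseteq> \<Union>\<C>"
    proof -
      obtain A where "A \<in> \<C>" using \<open>\<C> \<noteq> {}\<close> by blast
      moreover have "G0 \<subseteq> A" using \<open>A \<in> \<C>\<close> C by (auto simp: \<A>_def)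
      ultimately show ?thesis by blast
    qed
    moreover have "\<Union>\<C> \<subseteq> V \<times> UNIV" using C by (auto simp: \<A>_def)
    moreover have "\<forall>(x, a)\<in>\<Union>\<C>. a \<le> p x" using C by (force simp: \<A>_def)
    ultimately show ?thesis by (simp add: \<A>_def)
  qed
  ultimately have "\<exists>G\<in>\<A>. \<forall>H\<in>\<A>. G \<subseteq> H \<longrightarrow> H = G"
    by (intro subset_Zorn_nonempty) auto
  then obtain G where G: "G \<in> \<A>" and max: "\<And>H. H \<in> \<A> \<Longrightarrow> G \<subseteq> H \<Longrightarrow> H = G"
    by blast
  have sub: "subspace G" and G0: "G0 \<subseteq> G" and GV: "G \<subseteq> V \<times> UNIV"
    and le: "\<And>x a. (x, a) \<in> G \<Longrightarrow> a \<le> p x"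
    using G by (auto simp: \<A>_def)
  have p0: "p 0 = 0" using scale[OF subspace_0[OF V], of 0] by simp
  have unique: "a = b" if "(x, a) \<in> G" "(x, b) \<in> G" for x a b
    using le[of 0 "a - b"] le[of 0 "b - a"] subspace_diff[OF sub that]
      subspace_diff[OF sub that(2,1)] p0 by simp
  have total: "\<exists>a. (v, a) \<in> G" if v: "v \<in> V" for v
  proof -
    obtain c where c: "\<And>x a t. (x, a) \<in> G \<Longrightarrow> a + t * c \<le> p (x + t *\<^sub>R v)"
      using Hahn_Banach_step[OF V sub GV v add scale le] by blast
    let ?H = "span (insert (v, c) G)"
    have H: "\<exists>t y b. (y, b) \<in> G \<and> x = y + t *\<^sub>R v \<and> a = b + t * c" if xa: "(x, a) \<in> ?H" for x a
    proof -
      have "span G = G" using sub by simp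
      moreover obtain t where "(x, a) - t *\<^sub>R (v, c) \<in> span G" using xa unfolding span_insert by blast
      ultimately have "(x, a) - t *\<^sub>R (v, c) \<in> G" by argo
      then show ?thesis
        by (intro exI[of _ t] exI[of _ "x - t *\<^sub>R v"] exI[of _ "a - t * c"]) simp
    qed
    have "?H \<in> \<A>"
      unfolding \<A>_def
    proof (intro CollectI conjI)
      show "subspace ?H" by (rule subspace_span)
      show "G0 \<subseteq> ?H" using G0 span_superset by blast
      show "?H \<subseteq> V \<times> UNIV"
        using H GV V v by (fastforce intro: subspace_add subspace_scale)
      show "\<forall>(x, a)\<in>?H. a \<le> p x" using H c by blast
    qed
    moreover have "G \<subseteq> ?H" using span_superset by blast
    ultimately have "?H = G" using max by blast
    then show ?thesis using span_superset[of "insert (v, c) G"] by blast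
  qed
  define g where "g v = (THE a. (v, a) \<in> G)" for v
  have g_eq: "g x = a" if "(x, a) \<in> G" for x a
    unfolding g_def using that unique by blast
  have g_in: "(x, g x) \<in> G" if "x \<in> V" for x
    using total[OF that] g_eq by blast
  show ?thesis
  proof (rule that[of g])
    show "linear_functional_on V g"
      unfolding linear_functional_on_def
      using subspace_add[OF sub g_in g_in] subspace_scale[OF sub g_in] by (auto intro!: g_eq)
    show "g x = f x" if "x \<in> U" for x using that G0 by (auto simp: G0_def intro!: g_eq)
    show "\<bar>g x\<bar> \<le> p x" if "x \<in> V" for x
      using le[OF g_in[OF that]] le[OF subspace_scale[OF sub g_in[OF that], of "-1", simplified]]
        scale[OF that, of "-1"] by (simp add: abs_le_iff)
  qed
qed

text \<open>
  A functional that is dominated through a linear map \<open>R\<close> depends only on the image under \<open>R\<close>,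
  because it vanishes wherever the dominating seminorm does.
\<close>

lemma Hahn_Banach_through_map:
  fixes V :: "'a::real_vector set" and S :: "'b::real_vector set"
  assumes V: "subspace V" and S: "subspace S" and R: "\<And>s. s \<in> S \<Longrightarrow> R s \<in> V"
    and R_add: "\<And>s t. s \<in> S \<Longrightarrow> t \<in> S \<Longrightarrow> R (s + t) = R s + R t"
    and R_scale: "\<And>s c. s \<in> S \<Longrightarrow> R (c *\<^sub>R s) = c *\<^sub>R R s"
    and add: "\<And>x y. x \<in> V \<Longrightarrow> y \<in> V \<Longrightarrow> p (x + y) \<le> p x + p y"
    and scale: "\<And>x c. x \<in> V \<Longrightarrow> p (c *\<^sub>R x) = \<bar>c\<bar> * p x"
    and f: "linear_functional_on S f" and le: "\<And>s. s \<in> S \<Longrightarrow> \<bar>f s\<bar> \<le> p (R s)"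
  obtains g where "linear_functional_on V g" "\<And>s. s \<in> S \<Longrightarrow> g (R s) = f s"
    "\<And>x. x \<in> V \<Longrightarrow> \<bar>g x\<bar> \<le> p x"
proof -
  define f' where "f' x = f (SOME s. s \<in> S \<and> R s = x)" for x
  have p0: "p 0 = 0" using scale[OF subspace_0[OF V], of 0] by simp
  have f': "f' (R s) = f s" if s: "s \<in> S" for s
  proof -
    define t where "t = (SOME t. t \<in> S \<and> R t = R s)"
    have t: "t \<in> S" "R t = R s"
      using someI[of "\<lambda>t. t \<in> S \<and> R t = R s" s] s by (auto simp: t_def)
    have "R (t + (-1) *\<^sub>R s) = 0"
      using R_add[OF t(1) subspace_scale[OF S s, of "-1"]] R_scale[OF s, of "-1"] t(2) by simp
    moreover have "t + (-1) *\<^sub>R s \<in> S" using S s t(1) by (intro subspace_add subspace_scale)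
    ultimately have "f (t + (-1) *\<^sub>R s) = 0" using le[of "t + (-1) *\<^sub>R s"] p0 by simp
    then have "f t = f s"
      using linear_functional_on_add[OF f t(1) subspace_scale[OF S s, of "-1"]]
        linear_functional_on_scale[OF f s, of "-1"] by simp
    then show ?thesis by (simp add: f'_def t_def)
  qed
  have "subspace (R ` S)"
    unfolding subspace_def
  proof (intro conjI ballI allI)
    have "R 0 = 0" using R_scale[OF subspace_0[OF S], of 0] by simp
    then show "0 \<in> R ` S" using subspace_0[OF S] by (metis imageI)
    show "x + y \<in> R ` S" if "x \<in> R ` S" "y \<in> R ` S" for x y
      using that R_add subspace_add[OF S] by (metis (no_types, lifting) image_iff)
    show "c *\<^sub>R x \<in> R ` S" if "x \<in> R ` S" for c x
      using that R_scale subspace_scale[OF S] by (metis (no_types, lifting) image_iff)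
  qed
  moreover have "R ` S \<subseteq> V" using R by blast
  moreover have "linear_functional_on (R ` S) f'"
    using f S by (auto simp: linear_functional_on_def f' subspace_add subspace_scale
        simp flip: R_add R_scale)
  moreover have "f' x \<le> p x" if "x \<in> R ` S" for x using that le f' by force
  ultimately obtain g where "linear_functional_on V g" "\<And>x. x \<in> R ` S \<Longrightarrow> g x = f' x"
    "\<And>x. x \<in> V \<Longrightarrow> \<bar>g x\<bar> \<le> p x"
    using Hahn_Banach[OF V, of "R ` S" p f'] add scale by blast
  then show ?thesis using f' by (intro that[of g]) auto
qed

section \<open>Normed spaces and their duals\<close>

text \<open>Completeness in terms of norms of differences, without the metric-space vocabulary.\<close>

definition cauchy_complete :: "'a::real_vector nspace \<Rightarrow> bool" where
  "cauchy_complete X \<longleftrightarrow> (\<forall>\<sigma> :: nat \<Rightarrow> 'a. range \<sigma> \<subseteq> vecs X \<longrightarrow>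
     (\<forall>e>0. \<exists>N. \<forall>m\<ge>N. \<forall>n\<ge>N. vnorm X (\<sigma> m - \<sigma> n) \<le> e) \<longrightarrow>
     (\<exists>x\<in>vecs X. \<forall>e>0. \<exists>N. \<forall>n\<ge>N. vnorm X (\<sigma> n - x) \<le> e))"

lemma cauchy_completeD:
  fixes \<sigma> :: "nat \<Rightarrow> 'a::real_vector"
  assumes "cauchy_complete X" "\<And>n. \<sigma> n \<in> vecs X"
    and "\<forall>e>0. \<exists>N. \<forall>m\<ge>N. \<forall>n\<ge>N. vnorm X (\<sigma> m - \<sigma> n) \<le> e"
  shows "\<exists>x\<in>vecs X. \<forall>e>0. \<exists>N. \<forall>n\<ge>N. vnorm X (\<sigma> n - x) \<le> e"
proof -
  have "range \<sigma> \<subseteq> vecs X" using assms(2) by blast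
  then show ?thesis
    using assms(1,3) unfolding cauchy_complete_def by blast
qed

lemma banach_spaceI:
  assumes X: "normed_space X" and c: "cauchy_complete X"
  shows "banach_space X"
proof -
  interpret Metric_space "vecs X" "vdist X" by (rule Metric_space_vdist[OF X])
  have "mcomplete"
    unfolding mcomplete_def
  proof (intro allI impI)
    fix \<sigma> :: "nat \<Rightarrow> 'a" assume \<sigma>: "MCauchy \<sigma>"
    then have r: "range \<sigma> \<subseteq> vecs X" by (simp add: MCauchy_def)
    have "\<forall>e>0. \<exists>N. \<forall>m\<ge>N. \<forall>n\<ge>N. vnorm X (\<sigma> m - \<sigma> n) \<le> e"
    proof (intro allI impI)
      fix e :: real assume "e > 0"
      then obtain N where "\<forall>m n. N \<le> m \<longrightarrow> N \<le> n \<longrightarrow> vdist X (\<sigma> m) (\<sigma> n) < e"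
        using \<sigma> unfolding MCauchy_def by blast
      then show "\<exists>N. \<forall>m\<ge>N. \<forall>n\<ge>N. vnorm X (\<sigma> m - \<sigma> n) \<le> e"
        using r unfolding vdist_def image_subset_iff by (metis UNIV_I less_imp_le)
    qed
    then have "\<exists>x\<in>vecs X. \<forall>e>0. \<exists>N. \<forall>n\<ge>N. vnorm X (\<sigma> n - x) \<le> e"
      using c[unfolded cauchy_complete_def, rule_format, OF r] by simp
    then obtain x where x: "x \<in> vecs X" "\<forall>e>0. \<exists>N. \<forall>n\<ge>N. vnorm X (\<sigma> n - x) \<le> e"
      by blast
    have "\<exists>N. \<forall>n\<ge>N. \<sigma> n \<in> vecs X \<and> vdist X (\<sigma> n) x < e" if e: "e > 0" for e
    proof -
      obtain N where "\<forall>n\<ge>N. vnorm X (\<sigma> n - x) \<le> e / 2" using x(2) half_gt_zero[OF e] by blast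
      then have "\<forall>n\<ge>N. vnorm X (\<sigma> n - x) < e" using e by fastforce
      then show ?thesis using r x(1) unfolding vdist_def by (intro exI[of _ N]) auto
    qed
    then show "\<exists>x. limitin mtopology \<sigma> x sequentially"
      using x(1) unfolding limit_metric_sequentially by blast
  qed
  then show ?thesis using X by (simp add: banach_space_def)
qed

lemma normed_space_subspace: "normed_space X \<Longrightarrow> subspace (vecs X)"
  by (simp add: normed_space_def)

lemma vnorm_nonneg: "normed_space X \<Longrightarrow> x \<in> vecs X \<Longrightarrow> 0 \<le> vnorm X x"
  by (simp add: normed_space_def)

lemma vnorm_eq_0: "normed_space X \<Longrightarrow> x \<in> vecs X \<Longrightarrow> vnorm X x = 0 \<longleftrightarrow> x = 0"
  by (simp add: normed_space_def)

lemma vnorm_scale: "normed_space X \<Longrightarrow> x \<in> vecs X \<Longrightarrow> vnorm X (c *\<^sub>R x) = \<bar>c\<bar> * vnorm X x"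
  by (simp add: normed_space_def)

lemma vnorm_triangle:
  "normed_space X \<Longrightarrow> x \<in> vecs X \<Longrightarrow> y \<in> vecs X \<Longrightarrow> vnorm X (x + y) \<le> vnorm X x + vnorm X y"
  by (simp add: normed_space_def)

lemma vnorm_zero: "normed_space X \<Longrightarrow> vnorm X 0 = 0"
  by (simp add: vnorm_eq_0 subspace_0 normed_space_subspace)

lemma dual_iff:
  "f \<in> vecs (dual X) \<longleftrightarrow> linear_functional_on (vecs X) f \<and>
     (\<exists>C. \<forall>x\<in>vecs X. \<bar>f x\<bar> \<le> C * vnorm X x) \<and> (\<forall>x. x \<notin> vecs X \<longrightarrow> f x = 0)"
  by (auto simp: dual_def bounded_operator_def scalars_def linear_functional_on_def)

lemma dual_linear: "f \<in> vecs (dual X) \<Longrightarrow> linear_functional_on (vecs X) f"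
  by (simp add: dual_iff)

lemma vnorm_dual: "vnorm (dual X) f = (SUP x\<in>{x \<in> vecs X. vnorm X x \<le> 1}. \<bar>f x\<bar>)"
  by (simp add: dual_def)

lemma subspace_dual:
  assumes "normed_space X"
  shows "subspace (vecs (dual X))"
  unfolding subspace_def
proof (intro conjI ballI allI)
  show "0 \<in> vecs (dual X)"
    by (auto simp: dual_iff linear_functional_on_def intro!: exI[of _ 0])
  show "f + g \<in> vecs (dual X)" if fg: "f \<in> vecs (dual X)" "g \<in> vecs (dual X)" for f g
  proof -
    obtain C D where "\<forall>x\<in>vecs X. \<bar>f x\<bar> \<le> C * vnorm X x" "\<forall>x\<in>vecs X. \<bar>g x\<bar> \<le> D * vnorm X x"
      using fg by (auto simp: dual_iff)
    then have "\<forall>x\<in>vecs X. \<bar>(f + g) x\<bar> \<le> (C + D) * vnorm X x"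
      by (auto simp: distrib_right intro!: order.trans[OF abs_triangle_ineq] add_mono)
    then have "\<exists>C. \<forall>x\<in>vecs X. \<bar>(f + g) x\<bar> \<le> C * vnorm X x" ..
    moreover have "linear_functional_on (vecs X) (f + g)"
      using that by (simp add: dual_iff linear_functional_on_def algebra_simps)
    ultimately show ?thesis using fg by (simp add: dual_iff)
  qed
  show "c *\<^sub>R f \<in> vecs (dual X)" if f: "f \<in> vecs (dual X)" for c f
  proof -
    obtain C where "\<forall>x\<in>vecs X. \<bar>f x\<bar> \<le> C * vnorm X x"
      using f by (auto simp: dual_iff)
    then have "\<forall>x\<in>vecs X. \<bar>(c *\<^sub>R f) x\<bar> \<le> (\<bar>c\<bar> * C) * vnorm X x"
      by (auto simp: abs_mult mult.assoc intro!: mult_left_mono)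
    then have "\<exists>C. \<forall>x\<in>vecs X. \<bar>(c *\<^sub>R f) x\<bar> \<le> C * vnorm X x" ..
    moreover have "linear_functional_on (vecs X) (c *\<^sub>R f)"
      using that by (simp add: dual_iff linear_functional_on_def algebra_simps)
    ultimately show ?thesis using that by (simp add: dual_iff)
  qed
qed

lemma dual_bdd:
  assumes "normed_space X" "f \<in> vecs (dual X)"
  shows "bdd_above ((\<lambda>x. \<bar>f x\<bar>) ` {x \<in> vecs X. vnorm X x \<le> 1})"
proof -
  obtain C where C: "\<And>x. x \<in> vecs X \<Longrightarrow> \<bar>f x\<bar> \<le> C * vnorm X x" using assms(2) by (auto simp: dual_iff)
  have "\<bar>f x\<bar> \<le> \<bar>C\<bar>" if "x \<in> vecs X" "vnorm X x \<le> 1" for x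
  proof -
    have "C * vnorm X x \<le> \<bar>C\<bar> * 1"
      using that vnorm_nonneg[OF assms(1) that(1)] by (intro mult_mono) auto
    then show ?thesis using C[OF that(1)] by simp
  qed
  then show ?thesis by (auto intro!: bdd_aboveI[of _ "\<bar>C\<bar>"])
qed

lemma vnorm_dual_nonneg:
  assumes "normed_space X" "f \<in> vecs (dual X)"
  shows "0 \<le> vnorm (dual X) f"
proof -
  have "0 \<in> {x \<in> vecs X. vnorm X x \<le> 1}"
    using assms(1) by (simp add: vnorm_zero subspace_0 normed_space_subspace)
  then have "\<bar>f 0\<bar> \<le> vnorm (dual X) f"
    unfolding vnorm_dual using dual_bdd[OF assms] by (rule cSUP_upper)
  then show ?thesis by simp
qed

lemma dual_apply_le:
  assumes X: "normed_space X" and f: "f \<in> vecs (dual X)" and x: "x \<in> vecs X"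
  shows "\<bar>f x\<bar> \<le> vnorm (dual X) f * vnorm X x"
proof (cases "x = 0")
  case True
  then show ?thesis
    using linear_functional_on_zero[OF normed_space_subspace[OF X] dual_linear[OF f]] vnorm_zero[OF X]
    by simp
next
  case False
  let ?r = "vnorm X x"
  have r: "?r > 0" using vnorm_nonneg[OF X x] vnorm_eq_0[OF X x] False by linarith
  have "(1/?r) *\<^sub>R x \<in> {x \<in> vecs X. vnorm X x \<le> 1}"
    using r x X by (simp add: vnorm_scale subspace_scale normed_space_subspace)
  then have "\<bar>f ((1/?r) *\<^sub>R x)\<bar> \<le> vnorm (dual X) f"
    unfolding vnorm_dual using dual_bdd[OF X f] by (rule cSUP_upper)
  then show ?thesis
    using r linear_functional_on_scale[OF dual_linear[OF f] x, of "1/?r"]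
    by (simp add: abs_mult field_simps)
qed

lemma vnorm_dual_le:
  assumes X: "normed_space X" and "0 \<le> C" and le: "\<And>x. x \<in> vecs X \<Longrightarrow> \<bar>f x\<bar> \<le> C * vnorm X x"
  shows "vnorm (dual X) f \<le> C"
  unfolding vnorm_dual
proof (rule cSUP_least)
  show "{x \<in> vecs X. vnorm X x \<le> 1} \<noteq> {}"
    using vnorm_zero[OF X] subspace_0[OF normed_space_subspace[OF X]] by fastforce
  show "\<bar>f x\<bar> \<le> C" if "x \<in> {x \<in> vecs X. vnorm X x \<le> 1}" for x
    using le[of x] mult_left_mono[of "vnorm X x" 1 C] that \<open>0 \<le> C\<close> by simp
qed

lemma vnorm_dual_triangle:
  assumes X: "normed_space X" and fg: "f \<in> vecs (dual X)" "g \<in> vecs (dual X)"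
  shows "vnorm (dual X) (f + g) \<le> vnorm (dual X) f + vnorm (dual X) g"
proof (rule vnorm_dual_le[OF X])
  show "\<bar>(f + g) x\<bar> \<le> (vnorm (dual X) f + vnorm (dual X) g) * vnorm X x" if "x \<in> vecs X" for x
    using dual_apply_le[OF X fg(1) that] dual_apply_le[OF X fg(2) that] by (simp add: algebra_simps)
qed (use vnorm_dual_nonneg[OF X] fg in auto)

lemma vnorm_dual_scale:
  assumes X: "normed_space X" and f: "f \<in> vecs (dual X)"
  shows "vnorm (dual X) (c *\<^sub>R f) = \<bar>c\<bar> * vnorm (dual X) f"
proof -
  have le: "vnorm (dual X) (c *\<^sub>R f) \<le> \<bar>c\<bar> * vnorm (dual X) f" if f: "f \<in> vecs (dual X)" for c f
  proof (rule vnorm_dual_le[OF X])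
    show "\<bar>(c *\<^sub>R f) x\<bar> \<le> \<bar>c\<bar> * vnorm (dual X) f * vnorm X x" if "x \<in> vecs X" for x
      using dual_apply_le[OF X f that]
      by (simp add: abs_mult mult.assoc mult_left_mono)
  qed (use vnorm_dual_nonneg[OF X f] in auto)
  show ?thesis
  proof (cases "c = 0")
    case True
    have "0 \<le> vnorm (dual X) (c *\<^sub>R f)"
      using vnorm_dual_nonneg[OF X subspace_scale[OF subspace_dual[OF X] f]] .
    then show ?thesis using le[OF f, of c] True by simp
  next
    case False
    have "vnorm (dual X) ((1/c) *\<^sub>R (c *\<^sub>R f)) \<le> \<bar>1/c\<bar> * vnorm (dual X) (c *\<^sub>R f)"
      by (rule le[OF subspace_scale[OF subspace_dual[OF X] f]])
    then have "\<bar>c\<bar> * vnorm (dual X) f \<le> vnorm (dual X) (c *\<^sub>R f)"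
      using False by (simp add: field_simps)
    then show ?thesis using le[OF f, of c] by simp
  qed
qed

lemma normed_space_dual:
  assumes X: "normed_space X"
  shows "normed_space (dual X)"
  unfolding normed_space_def
proof (intro conjI ballI allI)
  show "vnorm (dual X) f = 0 \<longleftrightarrow> f = 0" if f: "f \<in> vecs (dual X)" for f
  proof
    assume 0: "vnorm (dual X) f = 0"
    have "f x = 0" for x
      using dual_apply_le[OF X f, of x] f 0 by (cases "x \<in> vecs X") (auto simp: dual_iff)
    then show "f = 0" by auto
  next
    assume "f = 0"
    then show "vnorm (dual X) f = 0" using vnorm_dual_scale[OF X f, of 0] by simp
  qed
qed (use assms in \<open>simp_all add: subspace_dual vnorm_dual_nonneg vnorm_dual_triangle vnorm_dual_scale\<close>)

lemma closed_subspace_subset: "normed_space X \<Longrightarrow> closed_subspace X L \<Longrightarrow> L \<subseteq> vecs X"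
  unfolding closed_subspace_def
  using closedin_subset Metric_space.topspace_mtopology Metric_space_vdist by metis

lemma closed_subspace_common_kernel:
  assumes X: "normed_space X" and \<Phi>: "\<Phi> \<subseteq> vecs (dual X)"
  shows "closed_subspace X {x \<in> vecs X. \<forall>f\<in>\<Phi>. f x = 0}" (is "closed_subspace X ?L")
proof -
  interpret Metric_space "vecs X" "vdist X" by (rule Metric_space_vdist[OF X])
  note sub = normed_space_subspace[OF X]
  have lin: "linear_functional_on (vecs X) f" if "f \<in> \<Phi>" for f using that \<Phi> dual_linear by blast
  have "subspace ?L"
    unfolding subspace_def
  proof (intro conjI ballI allI)
    show "0 \<in> ?L" using subspace_0[OF sub] linear_functional_on_zero[OF sub lin] by simp
    show "x + y \<in> ?L" if xy: "x \<in> ?L" "y \<in> ?L" for x y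
    proof -
      have "f (x + y) = 0" if f: "f \<in> \<Phi>" for f
      proof -
        have "f x = 0" "f y = 0" "x \<in> vecs X" "y \<in> vecs X" using xy f by blast+
        then show ?thesis using linear_functional_on_add[OF lin[OF f], of x y] by simp
      qed
      then show ?thesis using xy subspace_add[OF sub] by blast
    qed
    show "c *\<^sub>R x \<in> ?L" if x: "x \<in> ?L" for c x
    proof -
      have "f (c *\<^sub>R x) = 0" if f: "f \<in> \<Phi>" for f
      proof -
        have "f x = 0" "x \<in> vecs X" using x f by blast+
        then show ?thesis using linear_functional_on_scale[OF lin[OF f], of x c] by simp
      qed
      then show ?thesis using x subspace_scale[OF sub] by blast
    qed
  qed
  moreover have "closedin mtopology ?L"
    unfolding closedin_def
  proof
    show "?L \<subseteq> topspace mtopology" by auto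
    show "openin mtopology (topspace mtopology - ?L)"
      unfolding openin_mtopology
    proof (intro conjI allI impI)
      fix x assume x: "x \<in> topspace mtopology - ?L"
      then obtain f where f: "f \<in> \<Phi>" "f x \<noteq> 0" and xX: "x \<in> vecs X" by auto
      have fd: "f \<in> vecs (dual X)" using f(1) \<Phi> by blast
      let ?C = "vnorm (dual X) f"
      have C: "?C \<ge> 0" by (rule vnorm_dual_nonneg[OF X fd])
      define r where "r = \<bar>f x\<bar> / (?C + 1)"
      have r: "r > 0" using f(2) C by (simp add: r_def)
      have rC: "r * (?C + 1) = \<bar>f x\<bar>"
        by (rule iffD1[OF nonzero_eq_divide_eq]) (use C r_def in linarith)+
      have "mball x r \<subseteq> topspace mtopology - ?L"
      proof
        fix y assume "y \<in> mball x r"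
        then have y: "y \<in> vecs X" and d: "vnorm X (x - y) < r" by (auto simp: vdist_def)
        have xy: "x - y \<in> vecs X" using sub xX y by (simp add: subspace_diff)
        have "f y \<noteq> 0"
        proof
          assume "f y = 0"
          then have "\<bar>f x\<bar> \<le> ?C * vnorm X (x - y)"
            using dual_apply_le[OF X fd xy] linear_functional_on_diff[OF sub dual_linear[OF fd] xX y] by simp
          also have "\<dots> \<le> ?C * r" using C d by (intro mult_left_mono) auto
          also have "\<dots> < \<bar>f x\<bar>" using rC r by (simp add: algebra_simps)
          finally show False by simp
        qed
        then show "y \<in> topspace mtopology - ?L" using y f(1) by auto
      qed
      then show "\<exists>r>0. mball x r \<subseteq> topspace mtopology - ?L" using r by blast
    qed auto
  qed
  ultimately show ?thesis by (simp add: closed_subspace_def)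
qed

text \<open>The value 0 outside the space is the one that members of the dual have there.\<close>

definition coord :: "(nat \<Rightarrow> real) nspace \<Rightarrow> nat \<Rightarrow> (nat \<Rightarrow> real) \<Rightarrow> real" where
  "coord X n = (\<lambda>x. if x \<in> vecs X then x n else 0)"

lemma coord_in_dual:
  assumes X: "normed_space X" and le: "\<And>x. x \<in> vecs X \<Longrightarrow> \<bar>x n\<bar> \<le> C * vnorm X x"
  shows "coord X n \<in> vecs (dual X)"
  using le normed_space_subspace[OF X]
  by (auto simp: dual_iff linear_functional_on_def coord_def subspace_add subspace_scale)

section \<open>The James space\<close>

fun var_form :: "(nat \<Rightarrow> real) \<Rightarrow> (nat \<Rightarrow> real) \<Rightarrow> nat list \<Rightarrow> real" where
  "var_form x y [] = 0"
| "var_form x y [p] = 0"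
| "var_form x y (p # q # ps) = (x p - x q) * (y p - y q) / 2 + var_form x y (q # ps)"

text \<open>
  The weights, 1 for the end points and 1/2 for the differences, are chosen because
  \<open>(a - b)\<^sup>2 / 2 \<le> a\<^sup>2 + b\<^sup>2\<close>: the forms of two pieces of a list of indices add up to at least the
  form of the list. This makes the norm of the James space, an equivalent version of the usual one
  by square variation, satisfy an upper 2-estimate with constant 1.
\<close>

definition james_form :: "(nat \<Rightarrow> real) \<Rightarrow> (nat \<Rightarrow> real) \<Rightarrow> nat list \<Rightarrow> real" where
  "james_form x y ps =
     (if ps = [] then 0 else x (hd ps) * y (hd ps) + var_form x y ps + x (last ps) * y (last ps))"

definition james_bounded :: "(nat \<Rightarrow> real) \<Rightarrow> real \<Rightarrow> bool" where
  "james_bounded x C \<longleftrightarrow> 0 \<le> C \<and> (\<forall>ps. sorted ps \<longrightarrow> james_form x x ps \<le> C\<^sup>2)"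

definition James :: "(nat \<Rightarrow> real) nspace" where
  "James = \<lparr>vecs = {x. x \<longlonglongrightarrow> 0 \<and> (\<exists>C. james_bounded x C)},
     vnorm = (\<lambda>x. sqrt (SUP ps\<in>{ps. sorted ps}. james_form x x ps))\<rparr>"

definition head :: "nat \<Rightarrow> (nat \<Rightarrow> real) \<Rightarrow> nat \<Rightarrow> real" where
  "head n x = (\<lambda>i. if i < n then x i else 0)"

definition tail :: "nat \<Rightarrow> (nat \<Rightarrow> real) \<Rightarrow> nat \<Rightarrow> real" where
  "tail n x = (\<lambda>i. if i < n then 0 else x i)"

lemma head_plus_tail: "head n x + tail n x = x"
  by (auto simp: head_def tail_def)

lemma var_form_nonneg: "0 \<le> var_form x x ps"
  by (induction x x ps rule: var_form.induct) auto

lemma var_form_commute: "var_form x y ps = var_form y x ps"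
  by (induction x y ps rule: var_form.induct) auto

lemma var_form_add: "var_form (x + z) y ps = var_form x y ps + var_form z y ps"
  by (induction x y ps rule: var_form.induct) (auto simp: field_simps)

lemma var_form_scale: "var_form (c *\<^sub>R x) y ps = c * var_form x y ps"
  by (induction x y ps rule: var_form.induct) (auto simp: field_simps)

lemma var_form_append:
  assumes "ps \<noteq> []" "qs \<noteq> []"
  shows "var_form x y (ps @ qs) = var_form x y ps
    + (x (last ps) - x (hd qs)) * (y (last ps) - y (hd qs)) / 2 + var_form x y qs"
  using assms
proof (induction x y ps rule: var_form.induct)
  case (2 x y p) then show ?case by (cases qs) auto
qed auto

lemma var_form_cong:
  "(\<And>p. p \<in> set ps \<Longrightarrow> x p = x' p) \<Longrightarrow> (\<And>p. p \<in> set ps \<Longrightarrow> y p = y' p) \<Longrightarrow>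
    var_form x y ps = var_form x' y' ps"
  by (induction x y ps rule: var_form.induct) auto

lemma james_form_nonneg: "0 \<le> james_form x x ps"
  by (simp add: james_form_def var_form_nonneg)

lemma james_form_commute: "james_form x y ps = james_form y x ps"
  by (simp add: james_form_def var_form_commute[of x y] mult.commute)

lemma james_form_add: "james_form (x + z) y ps = james_form x y ps + james_form z y ps"
  by (simp add: james_form_def var_form_add algebra_simps)

lemma james_form_scale: "james_form (c *\<^sub>R x) y ps = c * james_form x y ps"
  by (simp add: james_form_def var_form_scale algebra_simps)

lemma james_form_cong:
  "(\<And>p. p \<in> set ps \<Longrightarrow> x p = x' p) \<Longrightarrow> james_form x x ps = james_form x' x' ps"
  using var_form_cong[of ps x x' x x'] by (simp add: james_form_def)

lemma james_form_square_add:
  "james_form (x + t *\<^sub>R y) (x + t *\<^sub>R y) ps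
    = james_form x x ps + 2 * t * james_form x y ps + t\<^sup>2 * james_form y y ps"
  using james_form_commute[of y x ps] james_form_commute[of x "x + t *\<^sub>R y" ps]
    james_form_commute[of y "x + t *\<^sub>R y" ps]
  by (simp add: james_form_add james_form_scale power2_eq_square algebra_simps)

lemma james_form_Cauchy_Schwarz:
  "(james_form x y ps)\<^sup>2 \<le> james_form x x ps * james_form y y ps"
proof -
  define a b c where "a = james_form x x ps" and "b = james_form x y ps" and "c = james_form y y ps"
  have q: "0 \<le> a + 2 * t * b + t\<^sup>2 * c" for t
    using james_form_nonneg[of "x + t *\<^sub>R y" ps] by (simp add: james_form_square_add a_def b_def c_def)
  have "b\<^sup>2 \<le> a * c"
  proof (cases "c = 0")
    case True
    have "b = 0"
    proof (rule ccontr)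
      assume "b \<noteq> 0"
      then have "2 * (- (a + 1) / (2 * b)) * b = - (a + 1)" by (simp add: field_simps)
      then show False using q[of "- (a + 1) / (2 * b)"] True by simp
    qed
    then show ?thesis using True by simp
  next
    case False
    then have c: "c > 0" using james_form_nonneg[of y ps] by (simp add: c_def)
    have "0 \<le> a - b\<^sup>2 / c"
      using q[of "- b / c"] c by (simp add: power2_eq_square field_simps)
    then show ?thesis using c by (simp add: field_simps)
  qed
  then show ?thesis by (simp add: a_def b_def c_def)
qed

lemma half_square_diff_le: "(a - b :: real) * (a - b) / 2 \<le> a * a + b * b"
  using zero_le_square[of "a + b"] by (simp add: algebra_simps)

text \<open>The difference across the cut is absorbed by the two new end points.\<close>

lemma james_form_append_le:
  "james_form x x (ps @ qs) \<le> james_form x x ps + james_form x x qs"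
  using half_square_diff_le[of "x (last ps)" "x (hd qs)"]
  by (cases "ps = []"; cases "qs = []") (auto simp: james_form_def var_form_append)

lemma sorted_splitE:
  fixes M :: nat
  assumes "sorted ps"
  obtains as bs where "ps = as @ bs" "sorted as" "sorted bs"
    "\<And>p. p \<in> set as \<Longrightarrow> p < M" "\<And>p. p \<in> set bs \<Longrightarrow> M \<le> p"
proof (rule that)
  let ?as = "takeWhile (\<lambda>p. p < M) ps" and ?bs = "dropWhile (\<lambda>p. p < M) ps"
  show "ps = ?as @ ?bs" by simp
  show "sorted ?as" "sorted ?bs" using assms by (simp_all add: sorted_takeWhile sorted_dropWhile)
  then show "M \<le> p" if "p \<in> set ?bs" for p
    using that hd_dropWhile[of "\<lambda>p. p < M" ps] by (cases ?bs) force+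
  show "p < M" if "p \<in> set ?as" for p using that by (rule set_takeWhileD[THEN conjunct2])
qed

lemma james_bounded_nonneg: "james_bounded x C \<Longrightarrow> 0 \<le> C"
  by (simp add: james_bounded_def)

lemma james_boundedD: "james_bounded x C \<Longrightarrow> sorted ps \<Longrightarrow> james_form x x ps \<le> C\<^sup>2"
  by (simp add: james_bounded_def)

lemma james_bounded_mono: "james_bounded x C \<Longrightarrow> C \<le> D \<Longrightarrow> james_bounded x D"
  unfolding james_bounded_def by (meson order.trans power_mono)

lemma james_bounded_abs:
  assumes "james_bounded x C"
  shows "\<bar>x p\<bar> \<le> C"
proof -
  have "(x p)\<^sup>2 + (x p)\<^sup>2 \<le> C\<^sup>2"
    using james_boundedD[OF assms, of "[p]"] by (simp add: james_form_def power2_eq_square)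
  then have "(x p)\<^sup>2 \<le> C\<^sup>2" using zero_le_power2[of "x p"] by linarith
  then show ?thesis using james_bounded_nonneg[OF assms] abs_le_square_iff[of "x p" C] by simp
qed

lemma james_bounded_var:
  assumes "james_bounded x C" "sorted ps"
  shows "var_form x x ps \<le> C\<^sup>2"
proof (cases "ps = []")
  case False
  then have "x (hd ps) * x (hd ps) + var_form x x ps + x (last ps) * x (last ps) \<le> C\<^sup>2"
    using james_boundedD[OF assms] by (simp add: james_form_def)
  then show ?thesis
    using zero_le_square[of "x (hd ps)"] zero_le_square[of "x (last ps)"] by linarith
qed simp

lemma james_bounded_add:
  assumes "james_bounded x C" "james_bounded y D"
  shows "james_bounded (x + y) (C + D)"
  unfolding james_bounded_def
proof (intro conjI allI impI)
  show "0 \<le> C + D" using assms by (simp add: james_bounded_nonneg)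
  fix ps :: "nat list" assume s: "sorted ps"
  have le: "james_form x x ps \<le> C\<^sup>2" "james_form y y ps \<le> D\<^sup>2"
    using assms s by (simp_all add: james_boundedD)
  have "(james_form x y ps)\<^sup>2 \<le> C\<^sup>2 * D\<^sup>2"
    using james_form_Cauchy_Schwarz[of x y ps] mult_mono[OF le] james_form_nonneg[of y ps] by simp
  then have "\<bar>james_form x y ps\<bar> \<le> \<bar>C * D\<bar>"
    by (simp add: abs_le_square_iff power_mult_distrib)
  then have "james_form x y ps \<le> C * D"
    using assms by (simp add: james_bounded_nonneg abs_of_nonneg)
  then show "james_form (x + y) (x + y) ps \<le> (C + D)\<^sup>2"
    using james_form_square_add[of x 1 y ps] le by (simp add: power2_sum)
qed

lemma james_bounded_scale:
  assumes "james_bounded x C"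
  shows "james_bounded (c *\<^sub>R x) (\<bar>c\<bar> * C)"
  unfolding james_bounded_def
proof (intro conjI allI impI)
  show "0 \<le> \<bar>c\<bar> * C" using assms by (simp add: james_bounded_nonneg)
  fix ps :: "nat list" assume "sorted ps"
  then have "c\<^sup>2 * james_form x x ps \<le> c\<^sup>2 * C\<^sup>2"
    using assms by (intro mult_left_mono) (auto simp: james_boundedD)
  then show "james_form (c *\<^sub>R x) (c *\<^sub>R x) ps \<le> (\<bar>c\<bar> * C)\<^sup>2"
    using james_form_commute[of x "c *\<^sub>R x" ps]
    by (simp add: james_form_scale power_mult_distrib power2_eq_square[of c] mult.assoc)
qed

text \<open>A list of indices is cut where the second block takes over; each piece sees one block only.\<close>

lemma james_bounded_blocks:
  assumes u: "james_bounded u C" "\<And>i. M \<le> i \<Longrightarrow> u i = 0"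
    and v: "james_bounded v D" "\<And>i. i < M \<Longrightarrow> v i = 0"
  shows "james_bounded (u + v) (sqrt (C\<^sup>2 + D\<^sup>2))"
  unfolding james_bounded_def
proof (intro conjI allI impI)
  fix ps :: "nat list" assume "sorted ps"
  then obtain as bs where ps: "ps = as @ bs" "sorted as" "sorted bs"
    "\<And>p. p \<in> set as \<Longrightarrow> p < M" "\<And>p. p \<in> set bs \<Longrightarrow> M \<le> p" using sorted_splitE[of ps M] by blast
  have "james_form (u + v) (u + v) as = james_form u u as"
    by (rule james_form_cong) (use ps v in simp)
  moreover have "james_form (u + v) (u + v) bs = james_form v v bs"
    by (rule james_form_cong) (use ps u in simp)
  ultimately show "james_form (u + v) (u + v) ps \<le> (sqrt (C\<^sup>2 + D\<^sup>2))\<^sup>2"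
    using james_form_append_le[of "u + v" as bs] james_boundedD[OF u(1) ps(2)]
      james_boundedD[OF v(1) ps(3)] ps(1) by simp
qed simp

lemma james_form_eq_0:
  assumes "\<And>p. p \<in> set ps \<Longrightarrow> x p = 0"
  shows "james_form x x ps = 0"
proof -
  have "james_form x x ps = james_form (0 *\<^sub>R x) (0 *\<^sub>R x) ps"
    by (rule james_form_cong) (simp add: assms)
  also have "\<dots> = 0" by (simp only: james_form_scale mult_zero_left)
  finally show ?thesis .
qed

lemma james_bounded_head:
  assumes "james_bounded x C"
  shows "james_bounded (head n x) C"
  unfolding james_bounded_def
proof (intro conjI allI impI)
  fix ps :: "nat list" assume "sorted ps"
  then obtain as bs where ps: "ps = as @ bs" "sorted as" "sorted bs"
    "\<And>p. p \<in> set as \<Longrightarrow> p < n" "\<And>p. p \<in> set bs \<Longrightarrow> n \<le> p" using sorted_splitE[of ps n] by blast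
  have "james_form (head n x) (head n x) as = james_form x x as"
    by (rule james_form_cong) (use ps in \<open>simp add: head_def\<close>)
  moreover have "james_form (head n x) (head n x) bs = 0"
    by (rule james_form_eq_0) (use ps in \<open>force simp: head_def\<close>)
  ultimately show "james_form (head n x) (head n x) ps \<le> C\<^sup>2"
    using james_form_append_le[of "head n x" as bs] james_boundedD[OF assms ps(2)] ps(1) by simp
qed (use assms in \<open>rule james_bounded_nonneg\<close>)

lemma james_form_tail_le:
  assumes "sorted ps"
  obtains bs where "sorted bs" "\<And>p. p \<in> set bs \<Longrightarrow> n \<le> p"
    "james_form (tail n x) (tail n x) ps \<le> james_form x x bs"
proof -
  obtain as bs where ps: "ps = as @ bs" "sorted as" "sorted bs"
    "\<And>p. p \<in> set as \<Longrightarrow> p < n" "\<And>p. p \<in> set bs \<Longrightarrow> n \<le> p"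
    using sorted_splitE[OF assms, of n] by blast
  have "james_form (tail n x) (tail n x) bs = james_form x x bs"
    by (rule james_form_cong) (use ps in \<open>force simp: tail_def\<close>)
  moreover have "james_form (tail n x) (tail n x) as = 0"
    by (rule james_form_eq_0) (use ps in \<open>simp add: tail_def\<close>)
  ultimately show ?thesis
    using james_form_append_le[of "tail n x" as bs] ps that[of bs] by simp
qed

lemma james_bounded_tail:
  assumes "james_bounded x C"
  shows "james_bounded (tail n x) C"
  unfolding james_bounded_def
proof (intro conjI allI impI)
  fix ps :: "nat list" assume "sorted ps"
  then show "james_form (tail n x) (tail n x) ps \<le> C\<^sup>2"
    using james_form_tail_le[of ps n x] james_boundedD[OF assms] by (metis order.trans)
qed (use assms in \<open>rule james_bounded_nonneg\<close>)

lemma james_bounded_const: "james_bounded (\<lambda>_. 1) 2"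
proof -
  have "var_form (\<lambda>_. 1) (\<lambda>_. 1) ps = 0" for ps
    by (induction "(\<lambda>_. 1) :: nat \<Rightarrow> real" "(\<lambda>_. 1) :: nat \<Rightarrow> real" ps rule: var_form.induct) auto
  then show ?thesis by (simp add: james_bounded_def james_form_def)
qed

subsection \<open>Completeness\<close>

lemma vecs_James: "x \<in> vecs James \<longleftrightarrow> x \<longlonglongrightarrow> 0 \<and> (\<exists>C. james_bounded x C)"
  by (simp add: James_def)

lemma vnorm_James_le:
  assumes "james_bounded x C"
  shows "vnorm James x \<le> C"
proof -
  have "(SUP ps\<in>{ps. sorted ps}. james_form x x ps) \<le> C\<^sup>2"
    by (rule cSUP_least) (use assms in \<open>auto simp: james_bounded_def intro: exI[of _ "[]"]\<close>)
  then show ?thesis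
    using james_bounded_nonneg[OF assms] by (simp add: James_def real_le_lsqrt)
qed

lemma james_bounded_vnorm:
  assumes "x \<in> vecs James"
  shows "james_bounded x (vnorm James x)"
proof -
  obtain C where C: "james_bounded x C" using assms by (auto simp: vecs_James)
  have bdd: "bdd_above ((\<lambda>ps. james_form x x ps) ` {ps. sorted ps})"
    using C by (auto simp: james_bounded_def)
  have le: "james_form x x ps \<le> (SUP ps\<in>{ps. sorted ps}. james_form x x ps)" if "sorted ps" for ps
    using that by (intro cSUP_upper[OF _ bdd]) simp
  from le[of "[]"] have "0 \<le> (SUP ps\<in>{ps. sorted ps}. james_form x x ps)" by (simp add: james_form_def)
  then show ?thesis using le by (simp add: james_bounded_def James_def)
qed

lemma James_coord_le: "x \<in> vecs James \<Longrightarrow> \<bar>x n\<bar> \<le> vnorm James x"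
  by (rule james_bounded_abs[OF james_bounded_vnorm])

lemma normed_space_James: "normed_space James"
  unfolding normed_space_def
proof (intro conjI ballI allI)
  show sub: "subspace (vecs James)"
    unfolding subspace_def
  proof (intro conjI ballI allI)
    have "james_bounded (0 *\<^sub>R (\<lambda>_. 1)) (\<bar>0\<bar> * 2)"
      by (rule james_bounded_scale[OF james_bounded_const])
    then show "0 \<in> vecs James" by (auto simp: vecs_James zero_fun_def)
    show "x + y \<in> vecs James" if "x \<in> vecs James" "y \<in> vecs James" for x y
    proof -
      have "x + y \<longlonglongrightarrow> 0"
        using that tendsto_add[of x 0 sequentially y 0] by (simp add: vecs_James plus_fun_def)
      then show ?thesis using that james_bounded_add unfolding vecs_James by blast
    qed
    show "c *\<^sub>R x \<in> vecs James" if "x \<in> vecs James" for c x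
    proof -
      have "c *\<^sub>R x \<longlonglongrightarrow> 0"
        using that tendsto_mult_left[of x 0 sequentially c] by (simp add: vecs_James scaleR_fun_def)
      then show ?thesis using that james_bounded_scale unfolding vecs_James by blast
    qed
  qed
  show pos: "0 \<le> vnorm James x" if "x \<in> vecs James" for x
    using james_bounded_nonneg[OF james_bounded_vnorm[OF that]] .
  have scale: "vnorm James (c *\<^sub>R x) \<le> \<bar>c\<bar> * vnorm James x" if "x \<in> vecs James" for c x
    by (rule vnorm_James_le[OF james_bounded_scale[OF james_bounded_vnorm[OF that]]])
  show "vnorm James x = 0 \<longleftrightarrow> x = 0" if "x \<in> vecs James" for x
  proof
    assume "vnorm James x = 0"
    then show "x = 0" using James_coord_le[OF that] by auto
  next
    assume "x = 0"
    then show "vnorm James x = 0" using scale[OF that, of 0] pos[OF that] by simp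
  qed
  show "vnorm James (x + y) \<le> vnorm James x + vnorm James y"
    if "x \<in> vecs James" "y \<in> vecs James" for x y
    by (rule vnorm_James_le[OF james_bounded_add[OF james_bounded_vnorm[OF that(1)] james_bounded_vnorm[OF that(2)]]])
  show "vnorm James (c *\<^sub>R x) = \<bar>c\<bar> * vnorm James x" if x: "x \<in> vecs James" for c x
  proof (cases "c = 0")
    case True
    then show ?thesis using scale[OF x, of 0] pos[OF subspace_scale[OF sub x, of 0]] by simp
  next
    case False
    have "vnorm James ((1/c) *\<^sub>R (c *\<^sub>R x)) \<le> \<bar>1/c\<bar> * vnorm James (c *\<^sub>R x)"
      by (rule scale[OF subspace_scale[OF sub x]])
    then have "\<bar>c\<bar> * vnorm James x \<le> vnorm James (c *\<^sub>R x)"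
      using False by (simp add: field_simps)
    then show ?thesis using scale[OF x, of c] by simp
  qed
qed

lemma tendsto_0_uniform_limit:
  fixes x :: "nat \<Rightarrow> real"
  assumes "\<And>e. e > 0 \<Longrightarrow> \<exists>y. y \<longlonglongrightarrow> 0 \<and> (\<forall>k. \<bar>y k - x k\<bar> \<le> e)"
  shows "x \<longlonglongrightarrow> 0"
proof (rule LIMSEQ_I)
  fix r :: real assume "0 < r"
  then obtain y where y: "y \<longlonglongrightarrow> 0" "\<And>k. \<bar>y k - x k\<bar> \<le> r / 2"
    using assms[of "r / 2"] by auto
  obtain N where N: "\<And>k. k \<ge> N \<Longrightarrow> norm (y k - 0) < r / 2"
    using LIMSEQ_D[OF y(1), of "r / 2"] \<open>0 < r\<close> by auto
  have "norm (x k - 0) < r" if "k \<ge> N" for k using N[OF that] y(2)[of k] unfolding diff_0_right real_norm_def by argo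
  then show "\<exists>no. \<forall>n\<ge>no. norm (x n - 0) < r" by blast
qed

text \<open>
  Cauchy sequences in a normed space of real sequences converge coordinatewise as soon as the
  norm dominates the coordinates, so that only the limit of the norms remains to be controlled.
\<close>

lemma coordinatewise_limit:
  fixes \<sigma> :: "nat \<Rightarrow> nat \<Rightarrow> real"
  assumes "\<And>e. e > 0 \<Longrightarrow> \<exists>N. \<forall>m\<ge>N. \<forall>n\<ge>N. \<forall>k. \<bar>\<sigma> m k - \<sigma> n k\<bar> \<le> e"
  obtains x where "\<And>k. (\<lambda>n. \<sigma> n k) \<longlonglongrightarrow> x k"
proof -
  have "Cauchy (\<lambda>n. \<sigma> n k)" for k
  proof (rule metric_CauchyI)
    fix e :: real assume "e > 0"
    then obtain N where "\<forall>m\<ge>N. \<forall>n\<ge>N. \<forall>k. \<bar>\<sigma> m k - \<sigma> n k\<bar> \<le> e / 2" using assms[of "e / 2"] by auto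
    moreover have "e / 2 < e" using \<open>e > 0\<close> by simp
    ultimately have "dist (\<sigma> m k) (\<sigma> n k) < e" if "m \<ge> N" "n \<ge> N" for m n
      using that unfolding dist_real_def by (meson le_less_trans)
    then show "\<exists>M. \<forall>m\<ge>M. \<forall>n\<ge>M. dist (\<sigma> m k) (\<sigma> n k) < e" by blast
  qed
  then have "(\<lambda>n. \<sigma> n k) \<longlonglongrightarrow> lim (\<lambda>n. \<sigma> n k)" for k
    by (simp add: Cauchy_convergent_iff convergent_LIMSEQ_iff)
  then show ?thesis by (rule that)
qed

lemma var_form_tendsto:
  assumes "\<And>k. (\<lambda>n. \<sigma> n k) \<longlonglongrightarrow> x k"
  shows "(\<lambda>n. var_form (\<sigma> n) (\<sigma> n) ps) \<longlonglongrightarrow> var_form x x ps"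
  by (induction ps rule: induct_list012) (auto intro!: tendsto_intros assms)

lemma james_bounded_limit:
  assumes lim: "\<And>k. (\<lambda>n. \<sigma> n k) \<longlonglongrightarrow> x k" and C: "\<And>n. n \<ge> N \<Longrightarrow> james_bounded (\<sigma> n) C"
  shows "james_bounded x C"
  unfolding james_bounded_def
proof (intro conjI allI impI)
  show "0 \<le> C" using james_bounded_nonneg[OF C[of N]] by simp
  fix ps :: "nat list" assume ps: "sorted ps"
  have "(\<lambda>n. james_form (\<sigma> n) (\<sigma> n) ps) \<longlonglongrightarrow> james_form x x ps"
    by (auto simp: james_form_def intro!: tendsto_intros lim var_form_tendsto)
  moreover have "\<forall>\<^sub>F n in sequentially. james_form (\<sigma> n) (\<sigma> n) ps \<le> C\<^sup>2"
    by (rule eventually_sequentiallyI[of N]) (use C ps james_boundedD in blast)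
  ultimately show "james_form x x ps \<le> C\<^sup>2" by (rule tendsto_upperbound) simp
qed

lemma cauchy_complete_James: "cauchy_complete James"
  unfolding cauchy_complete_def
proof (intro allI impI)
  fix \<sigma> :: "nat \<Rightarrow> nat \<Rightarrow> real"
  assume r: "range \<sigma> \<subseteq> vecs James"
    and c: "\<forall>e>0. \<exists>N. \<forall>m\<ge>N. \<forall>n\<ge>N. vnorm James (\<sigma> m - \<sigma> n) \<le> e"
  note sub = normed_space_subspace[OF normed_space_James]
  have \<sigma>: "\<sigma> n \<in> vecs James" for n using r by blast
  have diff: "\<sigma> m - \<sigma> n \<in> vecs James" for m n using \<sigma> sub by (simp add: subspace_diff)
  have "\<exists>N. \<forall>m\<ge>N. \<forall>n\<ge>N. \<forall>k. \<bar>\<sigma> m k - \<sigma> n k\<bar> \<le> e" if e: "e > 0" for e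
  proof -
    obtain N where "\<forall>m\<ge>N. \<forall>n\<ge>N. vnorm James (\<sigma> m - \<sigma> n) \<le> e" using c e by blast
    then have "\<forall>m\<ge>N. \<forall>n\<ge>N. \<forall>k. \<bar>\<sigma> m k - \<sigma> n k\<bar> \<le> e"
      using James_coord_le[OF diff] minus_apply by (metis order.trans)
    then show ?thesis ..
  qed
  then obtain x where x: "\<And>k. (\<lambda>n. \<sigma> n k) \<longlonglongrightarrow> x k" using coordinatewise_limit[of \<sigma>] by blast
  have bd: "\<exists>N. \<forall>n\<ge>N. james_bounded (\<sigma> n - x) e" if e: "e > 0" for e
  proof -
    obtain N where N: "\<forall>m\<ge>N. \<forall>n\<ge>N. vnorm James (\<sigma> m - \<sigma> n) \<le> e" using c e by blast
    have "james_bounded (\<sigma> n - x) e" if n: "n \<ge> N" for n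
    proof (rule james_bounded_limit)
      show "(\<lambda>m. (\<sigma> n - \<sigma> m) k) \<longlonglongrightarrow> (\<sigma> n - x) k" for k by (auto intro!: tendsto_intros x)
      show "james_bounded (\<sigma> n - \<sigma> m) e" if "m \<ge> N" for m
        using james_bounded_mono[OF james_bounded_vnorm[OF diff]] N n that by blast
    qed
    then show ?thesis by blast
  qed
  have "x \<longlonglongrightarrow> 0"
  proof (rule tendsto_0_uniform_limit)
    fix e :: real assume "e > 0"
    then obtain N where "james_bounded (\<sigma> N - x) e" using bd by blast
    then have "\<forall>k. \<bar>\<sigma> N k - x k\<bar> \<le> e" using james_bounded_abs[of "\<sigma> N - x" e] by simp
    then show "\<exists>y. y \<longlonglongrightarrow> 0 \<and> (\<forall>k. \<bar>y k - x k\<bar> \<le> e)" using \<sigma>[of N] by (auto simp: vecs_James)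
  qed
  moreover have "\<exists>C. james_bounded x C"
  proof -
    obtain N where N: "james_bounded (\<sigma> N - x) 1" using bd[of 1] by auto
    have "james_bounded (\<sigma> N + (-1) *\<^sub>R (\<sigma> N - x)) (vnorm James (\<sigma> N) + \<bar>-1\<bar> * 1)"
      by (intro james_bounded_add james_bounded_scale james_bounded_vnorm \<sigma> N)
    then show ?thesis by auto
  qed
  ultimately have "x \<in> vecs James" by (simp add: vecs_James)
  then show "\<exists>x\<in>vecs James. \<forall>e>0. \<exists>N. \<forall>n\<ge>N. vnorm James (\<sigma> n - x) \<le> e"
    using bd vnorm_James_le by (intro bexI[of _ x]) blast+
qed

subsection \<open>Bounded square variation\<close>

text \<open>
  Variation is superadditive under concatenation, so infinitely many successive lists of variation
  at least \<open>e\<close> would add up to unbounded variation.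
\<close>

lemma variation_tail_small:
  assumes C: "james_bounded x C" and e: "e > 0"
  obtains N where "\<And>ps. sorted ps \<Longrightarrow> (\<And>p. p \<in> set ps \<Longrightarrow> N \<le> p) \<Longrightarrow> var_form x x ps \<le> e"
proof (rule ccontr)
  assume "\<not> thesis"
  then have ex: "\<exists>ps. sorted ps \<and> (\<forall>p\<in>set ps. N \<le> p) \<and> e < var_form x x ps" for N
    using that by (meson not_le_imp_less)
  have "\<exists>ps. sorted ps \<and> real n * e \<le> var_form x x ps" for n
  proof (induction n)
    case 0
    show ?case by (intro exI[of _ "[]"]) simp
  next
    case (Suc n)
    then obtain ps where ps: "sorted ps" "real n * e \<le> var_form x x ps" by blast
    obtain qs where qs: "sorted qs" "\<forall>p\<in>set qs. Max (insert 0 (set ps)) \<le> p" "e < var_form x x qs"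
      using ex by blast
    have "sorted (ps @ qs)" using ps(1) qs(1,2) by (auto simp: sorted_append)
    moreover have "var_form x x ps + var_form x x qs \<le> var_form x x (ps @ qs)"
      using var_form_append[of ps qs x x] by (cases "ps = []"; cases "qs = []") auto
    ultimately show ?case using ps(2) qs(3) by (intro exI[of _ "ps @ qs"]) (auto simp: algebra_simps)
  qed
  moreover obtain n where "C\<^sup>2 < real n * e" using e ex_less_of_nat_mult by blast
  ultimately show False using james_bounded_var[OF C] by (meson not_less order.trans)
qed

lemma james_bounded_convergent:
  assumes "james_bounded x C"
  obtains c where "x \<longlonglongrightarrow> c"
proof -
  have "Cauchy x"
    unfolding Cauchy_iff2 
  proof
    fix j
    have "0 < (1 / (2 * real (Suc j)))\<^sup>2 / 2" by simp
    then obtain N where N: "\<And>ps. sorted ps \<Longrightarrow> (\<And>p. p \<in> set ps \<Longrightarrow> N \<le> p) \<Longrightarrow>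
      var_form x x ps \<le> (1 / (2 * real (Suc j)))\<^sup>2 / 2"
      using variation_tail_small[OF assms] by blast
    have "\<bar>x m - x n\<bar> < inverse (real (Suc j))" if "m \<ge> N" "n \<ge> N" "m \<le> n" for m n
    proof -
      have "(x m - x n)\<^sup>2 \<le> (1 / (2 * real (Suc j)))\<^sup>2"
      proof -
        have "var_form x x [m, n] \<le> (1 / (2 * real (Suc j)))\<^sup>2 / 2" by (rule N) (use that in auto)
        then show ?thesis by (simp add: power2_eq_square)
      qed
      then have "\<bar>x m - x n\<bar> \<le> 1 / (2 * real (Suc j))"
        using abs_le_square_iff[of "x m - x n" "1 / (2 * real (Suc j))"] by simp
      also have "\<dots> < inverse (real (Suc j))" by (simp add: field_simps)
      finally show ?thesis .
    qed
    then have "\<forall>m\<ge>N. \<forall>n\<ge>N. \<bar>x m - x n\<bar> < inverse (real (Suc j))"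
      by (metis abs_minus_commute nle_le)
    then show "\<exists>M. \<forall>m\<ge>M. \<forall>n\<ge>M. \<bar>x m - x n\<bar> < inverse (real (Suc j))" ..
  qed
  then show ?thesis using that by (auto simp: Cauchy_convergent_iff convergent_def)
qed

lemma James_tail: "x \<in> vecs James \<Longrightarrow> tail n x \<in> vecs James"
  and James_head: "x \<in> vecs James \<Longrightarrow> head n x \<in> vecs James"
proof -
  have "tail n x \<longlonglongrightarrow> 0" if "x \<longlonglongrightarrow> 0"
    by (rule Lim_transform_eventually[OF that]) (auto simp: tail_def eventually_sequentially intro!: exI[of _ n])
  then show "x \<in> vecs James \<Longrightarrow> tail n x \<in> vecs James"
    using james_bounded_tail by (auto simp: vecs_James)
  have "head n x \<longlonglongrightarrow> 0"
    by (rule Lim_transform_eventually[OF tendsto_const]) (auto simp: head_def eventually_sequentially intro!: exI[of _ n])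
  then show "x \<in> vecs James \<Longrightarrow> head n x \<in> vecs James"
    using james_bounded_head by (auto simp: vecs_James)
qed

lemma James_tail_small:
  assumes x: "x \<in> vecs James" and e: "e > 0"
  obtains N where "\<And>n. n \<ge> N \<Longrightarrow> vnorm James (tail n x) \<le> e"
proof -
  have e3: "e\<^sup>2 / 3 > 0" using e by simp
  obtain N1 where N1: "\<And>ps. sorted ps \<Longrightarrow> (\<And>p. p \<in> set ps \<Longrightarrow> N1 \<le> p) \<Longrightarrow> var_form x x ps \<le> e\<^sup>2 / 3"
    using variation_tail_small[OF james_bounded_vnorm[OF x] e3] by blast
  have "(\<lambda>n. (x n)\<^sup>2) \<longlonglongrightarrow> 0" using x tendsto_power[of x 0 sequentially 2] by (auto simp: vecs_James)
  then obtain N2 where N2: "\<And>n. n \<ge> N2 \<Longrightarrow> (x n)\<^sup>2 < e\<^sup>2 / 3"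
    using order_tendstoD(2)[of "\<lambda>n. (x n)\<^sup>2" 0 sequentially, OF _ e3] unfolding eventually_sequentially by blast
  have "james_bounded (tail n x) e" if n: "n \<ge> max N1 N2" for n
    unfolding james_bounded_def
  proof (intro conjI allI impI)
    fix ps :: "nat list" assume "sorted ps"
    then obtain bs where bs: "sorted bs" "\<And>p. p \<in> set bs \<Longrightarrow> n \<le> p"
      "james_form (tail n x) (tail n x) ps \<le> james_form x x bs"
      using james_form_tail_le[of ps n x] by blast
    have "james_form x x bs \<le> e\<^sup>2"
    proof (cases "bs = []")
      case False
      have "var_form x x bs \<le> e\<^sup>2 / 3"
        by (rule N1[OF bs(1)]) (use bs(2) n in force)
      moreover have "(x (hd bs))\<^sup>2 < e\<^sup>2 / 3" "(x (last bs))\<^sup>2 < e\<^sup>2 / 3"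
        using bs(2)[of "hd bs"] bs(2)[of "last bs"] n False by (meson N2 hd_in_set last_in_set max.boundedE order.trans)+
      ultimately show ?thesis using False by (simp add: james_form_def power2_eq_square)
    qed (simp add: james_form_def)
    then show "james_form (tail n x) (tail n x) ps \<le> e\<^sup>2" using bs(3) by simp
  qed (use e in simp)
  then show ?thesis using that vnorm_James_le by blast
qed

lemma James_head_const: "head n (\<lambda>_. 1) \<in> vecs James" "vnorm James (head n (\<lambda>_. 1)) \<le> 2"
proof -
  have "head n (\<lambda>_. 1) \<longlonglongrightarrow> 0"
    by (rule Lim_transform_eventually[OF tendsto_const]) (auto simp: head_def eventually_sequentially intro!: exI[of _ n])
  then show "head n (\<lambda>_. 1) \<in> vecs James"
    using james_bounded_head[OF james_bounded_const] by (auto simp: vecs_James)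
  show "vnorm James (head n (\<lambda>_. 1)) \<le> 2"
    by (rule vnorm_James_le[OF james_bounded_head[OF james_bounded_const]])
qed

definition unit_seq :: "nat \<Rightarrow> nat \<Rightarrow> real" where
  "unit_seq n = (\<lambda>i. if i = n then 1 else 0)"

lemma head_eq_sum: "head K y = (\<Sum>m<K. y m *\<^sub>R unit_seq m)"
proof
  fix i
  have "(\<Sum>m<K. y m *\<^sub>R unit_seq m) i = (\<Sum>m<K. if m = i then y m else 0)"
    unfolding sum_fun_apply by (rule sum.cong) (auto simp: unit_seq_def)
  then show "head K y i = (\<Sum>m<K. y m *\<^sub>R unit_seq m) i" by (simp add: head_def)
qed

subsection \<open>The dual and the bidual of the James space\<close>

lemma unit_seq_James: "unit_seq n \<in> vecs James"
proof -
  have "unit_seq n = head (Suc n) (\<lambda>_. 1) - head n (\<lambda>_. 1)"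
    by (auto simp: unit_seq_def head_def)
  then show ?thesis
    using James_head_const(1) subspace_diff[OF normed_space_subspace[OF normed_space_James]] by simp
qed

lemma James_functional_head:
  assumes "linear_functional_on (vecs James) h"
  shows "h (head K y) = (\<Sum>m<K. y m * h (unit_seq m))"
  unfolding head_eq_sum
  by (rule linear_functional_on_sum[OF normed_space_subspace[OF normed_space_James] assms unit_seq_James])

text \<open>
  The unit vectors of the James space are shrinking. If a functional stayed above \<open>e\<close> on unit
  vectors with arbitrarily late support, then \<open>n\<close> successive blocks would add up to a vector of
  norm at most \<open>sqrt n\<close> on which it is at least \<open>n * e\<close>.
\<close>

lemma James_shrinking:
  assumes h: "linear_functional_on (vecs James) h"
    and C: "\<And>y. y \<in> vecs James \<Longrightarrow> \<bar>h y\<bar> \<le> C * vnorm James y" and e: "e > 0"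
  obtains N where "\<And>y. y \<in> vecs James \<Longrightarrow> (\<And>i. i < N \<Longrightarrow> y i = 0) \<Longrightarrow> \<bar>h y\<bar> \<le> e * vnorm James y"
proof (rule ccontr)
  assume "\<not> thesis"
  then have ex: "\<exists>y\<in>vecs James. (\<forall>i<N. y i = 0) \<and> e * vnorm James y < \<bar>h y\<bar>" for N
    using that by (meson not_le_imp_less)
  note sub = normed_space_subspace[OF normed_space_James]
  have block: "\<exists>v M'. v \<in> vecs James \<and> (\<forall>i<M. v i = 0) \<and> (\<forall>i\<ge>M'. v i = 0) \<and> james_bounded v 1 \<and> e \<le> h v"
    for M
  proof -
    obtain y where y: "y \<in> vecs James" "\<forall>i<M. y i = 0" "e * vnorm James y < \<bar>h y\<bar>" using ex by blast
    have "vnorm James y \<noteq> 0"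
    proof
      assume "vnorm James y = 0"
      then have "y = 0" using vnorm_eq_0[OF normed_space_James y(1)] by simp
      then show False using y(3) linear_functional_on_zero[OF sub h] vnorm_zero[OF normed_space_James] by simp
    qed
    then have pos: "vnorm James y > 0" using vnorm_nonneg[OF normed_space_James y(1)] by simp
    define w where "w = (sgn (h y) / vnorm James y) *\<^sub>R y"
    have w: "w \<in> vecs James" using y(1) sub by (simp add: w_def subspace_scale)
    have hw: "h w = \<bar>h y\<bar> / vnorm James y"
      unfolding w_def linear_functional_on_scale[OF h y(1)] by (simp add: abs_sgn mult.commute)
    then have "e < h w" using y(3) pos by (simp add: pos_less_divide_eq)
    have "james_bounded w (\<bar>sgn (h y) / vnorm James y\<bar> * vnorm James y)"
      unfolding w_def by (rule james_bounded_scale[OF james_bounded_vnorm[OF y(1)]])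
    then have w1: "james_bounded w 1"
      by (rule james_bounded_mono) (use pos in \<open>simp add: abs_sgn_eq\<close>)
    have d: "(h w - e) / (\<bar>C\<bar> + 1) > 0" using \<open>e < h w\<close> by simp
    obtain K where K: "\<And>n. n \<ge> K \<Longrightarrow> vnorm James (tail n w) \<le> (h w - e) / (\<bar>C\<bar> + 1)"
      using James_tail_small[OF w d] by blast
    have "h (tail K w) \<le> C * vnorm James (tail K w)"
      using C[OF James_tail[OF w, of K]] by simp
    also have "\<dots> \<le> (\<bar>C\<bar> + 1) * vnorm James (tail K w)"
      using vnorm_nonneg[OF normed_space_James James_tail[OF w, of K]] by (intro mult_right_mono) auto
    also have "\<dots> \<le> (\<bar>C\<bar> + 1) * ((h w - e) / (\<bar>C\<bar> + 1))"
      using K[of K] by (intro mult_left_mono) auto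
    also have "\<dots> = h w - e" by simp
    finally have "h (tail K w) \<le> h w - e" .
    moreover have "h (head K w) + h (tail K w) = h w"
      using linear_functional_on_add[OF h James_head[OF w, of K] James_tail[OF w, of K]]
      by (simp add: head_plus_tail)
    ultimately have "e \<le> h (head K w)" by simp
    moreover have "\<forall>i<M. head K w i = 0" using y(2) by (simp add: head_def w_def)
    moreover have "\<forall>i\<ge>K. head K w i = 0" by (simp add: head_def)
    ultimately show ?thesis using James_head[OF w] james_bounded_head[OF w1] by blast
  qed
  have "\<exists>u M. u \<in> vecs James \<and> (\<forall>i\<ge>M. u i = 0) \<and> james_bounded u (sqrt (real n)) \<and> real n * e \<le> h u" for n
  proof (induction n)
    case 0
    have "james_bounded 0 0" using james_bounded_scale[OF james_bounded_const, of 0] by simp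
    then have "james_bounded 0 (sqrt (real 0))" "real 0 * e \<le> h 0"
      using linear_functional_on_zero[OF sub h] by simp_all
    moreover have "\<forall>i\<ge>0::nat. (0 :: nat \<Rightarrow> real) i = 0" by simp
    moreover note subspace_0[OF sub]
    ultimately show ?case by (intro exI[of _ "0 :: nat \<Rightarrow> real"] exI[of _ "0 :: nat"] conjI)
  next
    case (Suc n)
    then obtain u M where u: "u \<in> vecs James" "\<forall>i\<ge>M. u i = 0" "james_bounded u (sqrt (real n))"
      "real n * e \<le> h u" by (elim exE conjE) (rule that)
    obtain v M' where v: "v \<in> vecs James" "\<forall>i<M. v i = 0" "\<forall>i\<ge>M'. v i = 0" "james_bounded v 1"
      "e \<le> h v" using block[of M] by (elim exE conjE) (rule that)
    have "james_bounded (u + v) (sqrt ((sqrt (real n))\<^sup>2 + 1\<^sup>2))"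
      by (rule james_bounded_blocks[of _ _ M]) (use u v in auto)
    moreover have "(sqrt (real n))\<^sup>2 + 1\<^sup>2 = real (Suc n)" by simp
    ultimately have "james_bounded (u + v) (sqrt (real (Suc n)))" by metis
    moreover have "\<forall>i\<ge>max M M'. (u + v) i = 0" using u(2) v(3) by simp
    moreover have "real (Suc n) * e \<le> h (u + v)"
      using u(4) v(5) linear_functional_on_add[OF h u(1) v(1)] by (simp add: algebra_simps)
    moreover note subspace_add[OF sub u(1) v(1)]
    ultimately show ?case by (intro exI[of _ "u + v"] exI[of _ "max M M'"] conjI)
  qed
  note big = this
  obtain n :: nat where n: "real n > (\<bar>C\<bar> / e)\<^sup>2" using reals_Archimedean2 by blast
  obtain u where u: "u \<in> vecs James" "james_bounded u (sqrt (real n))" "real n * e \<le> h u"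
    using big[of n] by blast
  have n0: "real n > 0" using n zero_le_power2[of "\<bar>C\<bar> / e"] by linarith
  have "sqrt (real n) * (sqrt (real n) * e) \<le> h u" using u(3) by (simp flip: mult.assoc)
  also have "\<dots> \<le> \<bar>C\<bar> * vnorm James u"
    using C[OF u(1)] mult_right_mono[OF abs_ge_self[of C] vnorm_nonneg[OF normed_space_James u(1)]] by simp
  also have "\<dots> \<le> sqrt (real n) * \<bar>C\<bar>"
    using mult_left_mono[OF vnorm_James_le[OF u(2)] abs_ge_zero[of C]] by (simp add: mult.commute)
  finally have "sqrt (real n) * e \<le> \<bar>C\<bar>" using n0 by simp
  then have "sqrt (real n) \<le> \<bar>C\<bar> / e" using e by (simp add: field_simps)
  then have "real n \<le> (\<bar>C\<bar> / e)\<^sup>2" by (rule sqrt_le_D)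
  then show False using n by simp
qed

lemma coord_James: "coord James n \<in> vecs (dual James)"
  by (rule coord_in_dual[OF normed_space_James, of _ 1]) (simp add: James_coord_le)

text \<open>
  The form with one argument fixed is a combination of coordinates, so a functional on the dual
  can be evaluated on it. By the Cauchy--Schwarz inequality its dual norm is at most the square root
  of the form, which bounds the square variation of the coordinate values of the functional.
\<close>

lemma bidual_james_form:
  assumes \<psi>: "linear_functional_on (vecs (dual James)) \<psi>"
  defines "x \<equiv> \<lambda>m. \<psi> (coord James m)"
  shows "(\<lambda>y. if y \<in> vecs James then james_form y z ps else 0) \<in> vecs (dual James) \<and>
    \<psi> (\<lambda>y. if y \<in> vecs James then james_form y z ps else 0) = james_form x z ps"
proof -
  note sub = subspace_dual[OF normed_space_James]
  let ?c = "coord James"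
  let ?V = "\<lambda>ps y. if y \<in> vecs James then var_form y z ps else 0"
  have var: "?V ps \<in> vecs (dual James) \<and> \<psi> (?V ps) = var_form x z ps" for ps
  proof (induction ps rule: induct_list012)
    case 1
    have "?V [] = 0" by auto
    then show ?case
      using subspace_0[OF sub] linear_functional_on_zero[OF sub \<psi>] by (simp del: var_form.simps) simp
  next
    case (2 p)
    have "?V [p] = 0" by auto
    then show ?case
      using subspace_0[OF sub] linear_functional_on_zero[OF sub \<psi>] by (simp del: var_form.simps) simp
  next
    case (3 p q ps)
    have eq: "?V (p # q # ps) = ((z p - z q) / 2) *\<^sub>R (?c p - ?c q) + ?V (q # ps)"
      by (auto simp: coord_def)
    have d: "?c p - ?c q \<in> vecs (dual James)" using sub by (simp add: subspace_diff coord_James)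
    then have s: "((z p - z q) / 2) *\<^sub>R (?c p - ?c q) \<in> vecs (dual James)" using sub by (simp add: subspace_scale)
    have "\<psi> (?V (p # q # ps)) = (z p - z q) / 2 * \<psi> (?c p - ?c q) + \<psi> (?V (q # ps))"
      unfolding eq using 3 s d by (simp add: linear_functional_on_add[OF \<psi>] linear_functional_on_scale[OF \<psi>])
    also have "\<psi> (?c p - ?c q) = x p - x q"
      unfolding x_def by (rule linear_functional_on_diff[OF sub \<psi> coord_James coord_James])
    finally have "\<psi> (?V (p # q # ps)) = var_form x z (p # q # ps)" using 3 by simp
    then show ?case using subspace_add[OF sub s, of "?V (q # ps)"] 3 unfolding eq by blast
  qed
  show ?thesis
  proof (cases "ps = []")
    case True
    then have "(\<lambda>y. if y \<in> vecs James then james_form y z ps else 0) = 0" "james_form x z ps = 0"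
      by (auto simp: james_form_def)
    then show ?thesis
      using subspace_0[OF sub] linear_functional_on_zero[OF sub \<psi>] by simp
  next
    case False
    let ?J = "\<lambda>y. if y \<in> vecs James then james_form y z ps else 0"
    have eq: "?J = z (hd ps) *\<^sub>R ?c (hd ps) + ?V ps + z (last ps) *\<^sub>R ?c (last ps)"
      using False by (auto simp: coord_def james_form_def)
    have s: "z p *\<^sub>R ?c p \<in> vecs (dual James)" for p using sub by (simp add: subspace_scale coord_James)
    have s2: "z (hd ps) *\<^sub>R ?c (hd ps) + ?V ps \<in> vecs (dual James)"
      using subspace_add[OF sub s] var by blast
    have "\<psi> ?J = \<psi> (z (hd ps) *\<^sub>R ?c (hd ps)) + \<psi> (?V ps) + \<psi> (z (last ps) *\<^sub>R ?c (last ps))"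
      unfolding eq linear_functional_on_add[OF \<psi> s2 s]
      using linear_functional_on_add[OF \<psi> s, of "?V ps"] var by simp
    also have "\<dots> = james_form x z ps"
      using var False linear_functional_on_scale[OF \<psi> coord_James]
      by (simp add: x_def james_form_def mult.commute)
    finally have "\<psi> ?J = james_form x z ps" .
    then show ?thesis using subspace_add[OF sub s2 s] unfolding eq by simp
  qed
qed

text \<open>
  Elements of the bidual of the James space are sequences of bounded square variation; the unit
  vectors being shrinking, such a sequence acts on the dual by the obvious series.
\<close>

lemma James_bidual:
  assumes \<psi>: "linear_functional_on (vecs (dual James)) \<psi>"
    and bd: "\<And>h. h \<in> vecs (dual James) \<Longrightarrow> \<bar>\<psi> h\<bar> \<le> vnorm (dual James) h"
  defines "x \<equiv> \<lambda>m. \<psi> (coord James m)"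
  shows "james_bounded x 1"
    and "\<And>h. h \<in> vecs (dual James) \<Longrightarrow> (\<lambda>m. x m * h (unit_seq m)) sums \<psi> h"
proof -
  note sub = subspace_dual[OF normed_space_James]
  show "james_bounded x 1"
    unfolding james_bounded_def
  proof (intro conjI allI impI)
    fix ps :: "nat list" assume ps: "sorted ps"
    let ?J = "\<lambda>y. if y \<in> vecs James then james_form y x ps else 0"
    let ?Q = "james_form x x ps"
    have J: "?J \<in> vecs (dual James)" "\<psi> ?J = ?Q"
      using bidual_james_form[OF \<psi>, of x ps] unfolding x_def by blast+
    have "vnorm (dual James) ?J \<le> sqrt ?Q"
    proof (rule vnorm_dual_le[OF normed_space_James])
      fix y assume y: "y \<in> vecs James"
      have "(james_form y x ps)\<^sup>2 \<le> (vnorm James y)\<^sup>2 * ?Q"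
        using james_form_Cauchy_Schwarz[of y x ps]
          mult_right_mono[OF james_boundedD[OF james_bounded_vnorm[OF y] ps] james_form_nonneg[of x ps]]
        by simp
      also have "\<dots> = (sqrt ?Q * vnorm James y)\<^sup>2"
        by (simp add: power_mult_distrib james_form_nonneg mult.commute)
      finally have "\<bar>james_form y x ps\<bar> \<le> \<bar>sqrt ?Q * vnorm James y\<bar>" by (simp add: abs_le_square_iff)
      then show "\<bar>?J y\<bar> \<le> sqrt ?Q * vnorm James y"
        using y vnorm_nonneg[OF normed_space_James y] james_form_nonneg[of x ps] by (simp add: abs_mult)
    qed (simp add: james_form_nonneg)
    then have le: "?Q \<le> sqrt ?Q" using bd[OF J(1)] J(2) by simp
    show "?Q \<le> 1\<^sup>2"
    proof (rule ccontr)
      assume "\<not> ?Q \<le> 1\<^sup>2"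
      then have "1 < sqrt ?Q" by simp
      then have "sqrt ?Q * 1 < sqrt ?Q * sqrt ?Q" by (intro mult_strict_left_mono) auto
      then show False using le james_form_nonneg[of x ps] by simp
    qed
  qed simp
  fix h assume h: "h \<in> vecs (dual James)"
  let ?a = "\<lambda>m. h (unit_seq m)"
  have "(\<lambda>K. \<Sum>m<K. x m * ?a m) \<longlonglongrightarrow> \<psi> h"
  proof (rule LIMSEQ_I)
    fix r :: real assume r: "0 < r"
    then obtain N where N: "\<And>y. y \<in> vecs James \<Longrightarrow> (\<And>i. i < N \<Longrightarrow> y i = 0) \<Longrightarrow> \<bar>h y\<bar> \<le> (r / 2) * vnorm James y"
      using James_shrinking[OF dual_linear[OF h] dual_apply_le[OF normed_space_James h], of "r / 2"] half_gt_zero by blast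
    have "norm ((\<Sum>m<K. x m * ?a m) - \<psi> h) < r" if K: "K \<ge> N" for K
    proof -
      define g where "g = (\<Sum>m<K. ?a m *\<^sub>R coord James m)"
      have g: "g \<in> vecs (dual James)"
        unfolding g_def by (intro subspace_sum subspace_scale sub coord_James)
      have "\<psi> g = (\<Sum>m<K. ?a m * \<psi> (coord James m))"
        unfolding g_def by (rule linear_functional_on_sum[OF sub \<psi> coord_James])
      then have \<psi>g: "\<psi> g = (\<Sum>m<K. x m * ?a m)" by (simp add: x_def mult.commute)
      have "vnorm (dual James) (h - g) \<le> r / 2"
      proof (rule vnorm_dual_le[OF normed_space_James])
        fix y assume y: "y \<in> vecs James"
        have "g y = (\<Sum>m<K. y m * ?a m)" using y by (simp add: g_def sum_fun_apply coord_def mult.commute)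
        also have "\<dots> = h (head K y)" by (rule James_functional_head[OF dual_linear[OF h], symmetric])
        finally have "(h - g) y = h (tail K y)"
          using linear_functional_on_add[OF dual_linear[OF h] James_head[OF y, of K] James_tail[OF y, of K]]
          by (simp add: head_plus_tail)
        also have "\<bar>\<dots>\<bar> \<le> r / 2 * vnorm James (tail K y)"
          by (rule N[OF James_tail[OF y]]) (use K in \<open>simp add: tail_def\<close>)
        also have "\<dots> \<le> r / 2 * vnorm James y"
          using r vnorm_James_le[OF james_bounded_tail[OF james_bounded_vnorm[OF y]]] by (intro mult_left_mono) auto
        finally show "\<bar>(h - g) y\<bar> \<le> r / 2 * vnorm James y" .
      qed (use r in simp)
      then have "\<bar>\<psi> (h - g)\<bar> \<le> r / 2" using bd[OF subspace_diff[OF sub h g]] by simp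
      then show ?thesis
        using linear_functional_on_diff[OF sub \<psi> h g] \<psi>g r by (simp add: abs_minus_commute)
    qed
    then show "\<exists>no. \<forall>n\<ge>no. norm ((\<Sum>m<n. x m * ?a m) - \<psi> h) < r" by blast
  qed
  then show "(\<lambda>m. x m * h (unit_seq m)) sums \<psi> h" by (simp add: sums_def)
qed

text \<open>A vector of the James space is the limit of its initial segments.\<close>

lemma James_functional_sums:
  assumes h: "h \<in> vecs (dual James)" and y: "y \<in> vecs James"
  shows "(\<lambda>m. y m * h (unit_seq m)) sums h y"
  unfolding sums_def
proof (rule LIMSEQ_I)
  note lin = dual_linear[OF h]
  fix r :: real assume r: "0 < r"
  let ?C = "vnorm (dual James) h"
  have C: "?C \<ge> 0" using vnorm_dual_nonneg[OF normed_space_James h] .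
  define d where "d = r / 2 / (?C + 1)"
  have d: "d > 0" using r C by (simp add: d_def)
  have dC: "d * (?C + 1) = r / 2"
    by (rule iffD1[OF nonzero_eq_divide_eq]) (use C d_def in linarith)+
  obtain N where N: "\<And>n. n \<ge> N \<Longrightarrow> vnorm James (tail n y) \<le> d"
    using James_tail_small[OF y d] by blast
  have "norm ((\<Sum>m<n. y m * h (unit_seq m)) - h y) < r" if n: "n \<ge> N" for n
  proof -
    have "h y - h (head n y) = h (tail n y)"
      using linear_functional_on_add[OF lin James_head[OF y, of n] James_tail[OF y, of n]]
      by (simp add: head_plus_tail)
    also have "\<bar>h (tail n y)\<bar> \<le> ?C * vnorm James (tail n y)"
      by (rule dual_apply_le[OF normed_space_James h James_tail[OF y]])
    also have "\<dots> \<le> d * (?C + 1)"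
      unfolding mult.commute[of d]
      using N[OF n] C vnorm_nonneg[OF normed_space_James James_tail[OF y, of n]] by (intro mult_mono) auto
    also have "\<dots> = r / 2" by (rule dC)
    also have "\<dots> < r" using r by simp
    finally show ?thesis using James_functional_head[OF lin, of n y] by (simp add: abs_minus_commute)
  qed
  then show "\<exists>no. \<forall>n\<ge>no. norm ((\<Sum>m<n. y m * h (unit_seq m)) - h y) < r" by blast
qed

section \<open>The space of null sequences\<close>

lemma vecs_c0: "x \<in> vecs c0 \<longleftrightarrow> x \<longlonglongrightarrow> 0"
  by (simp add: c0_def)

lemma c0_coord_le:
  assumes "x \<in> vecs c0"
  shows "\<bar>x n\<bar> \<le> vnorm c0 x"
proof -
  obtain K where "\<And>n. \<bar>x n\<bar> \<le> K"
    using assms convergent_imp_bounded[of x 0] by (auto simp: vecs_c0 bounded_iff)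
  then have "bdd_above (range (\<lambda>n. \<bar>x n\<bar>))" by (intro bdd_aboveI2)
  then have "\<bar>x n\<bar> \<le> (SUP n. \<bar>x n\<bar>)" by (rule cSUP_upper[OF UNIV_I])
  then show ?thesis by (simp add: c0_def)
qed

lemma vnorm_c0_le: "(\<And>n. \<bar>x n\<bar> \<le> C) \<Longrightarrow> vnorm c0 x \<le> C"
  unfolding c0_def by (simp add: cSUP_least)

lemma vnorm_c0_attained:
  assumes x: "x \<in> vecs c0"
  obtains n where "vnorm c0 x = \<bar>x n\<bar>"
proof (cases "\<forall>n. x n = 0")
  case True
  then have "vnorm c0 x = \<bar>x 0\<bar>" using vnorm_c0_le[of x 0] c0_coord_le[OF x, of 0] by simp
  then show ?thesis by (rule that)
next
  case False
  then obtain m where m: "\<bar>x m\<bar> > 0" by auto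
  obtain N where N: "\<And>n. n \<ge> N \<Longrightarrow> \<bar>x n\<bar> < \<bar>x m\<bar>"
    using LIMSEQ_D[of x 0 "\<bar>x m\<bar>"] x m by (auto simp: vecs_c0)
  define M where "M = Max ((\<lambda>n. \<bar>x n\<bar>) ` {..max m N})"
  have "M \<in> (\<lambda>n. \<bar>x n\<bar>) ` {..max m N}" unfolding M_def by (rule Max_in) auto
  then obtain k where k: "M = \<bar>x k\<bar>" by blast
  have le: "\<bar>x n\<bar> \<le> M" if "n \<le> max m N" for n unfolding M_def using that by (intro Max_ge) auto
  have "\<bar>x n\<bar> \<le> M" for n
  proof (cases "n \<le> max m N")
    case False
    then have "N \<le> n" by simp
    then show ?thesis using N[of n] le[of m] by simp
  qed (rule le)
  then have "vnorm c0 x \<le> \<bar>x k\<bar>" using k by (intro vnorm_c0_le) simp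
  then show ?thesis using c0_coord_le[OF x, of k] that[of k] by simp
qed

lemma subspace_c0: "subspace (vecs c0)"
  unfolding subspace_def
proof (intro conjI ballI allI)
  show "0 \<in> vecs c0" by (simp add: vecs_c0 zero_fun_def)
  show "x + y \<in> vecs c0" if "x \<in> vecs c0" "y \<in> vecs c0" for x y
    using that tendsto_add[of x 0 sequentially y 0] by (simp add: vecs_c0 plus_fun_def)
  show "c *\<^sub>R x \<in> vecs c0" if "x \<in> vecs c0" for c x
    using that tendsto_mult_left[of x 0 sequentially c] by (simp add: vecs_c0 scaleR_fun_def)
qed

lemma normed_space_c0: "normed_space c0"
  unfolding normed_space_def
proof (intro conjI ballI allI)
  show "subspace (vecs c0)" by (rule subspace_c0)
  show pos: "0 \<le> vnorm c0 x" if "x \<in> vecs c0" for x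
    using c0_coord_le[OF that, of 0] by simp
  show "vnorm c0 x = 0 \<longleftrightarrow> x = 0" if "x \<in> vecs c0" for x
    using c0_coord_le[OF that] vnorm_c0_le[of x 0] pos[OF that] by fastforce
  show "vnorm c0 (x + y) \<le> vnorm c0 x + vnorm c0 y" if "x \<in> vecs c0" "y \<in> vecs c0" for x y
    by (rule vnorm_c0_le) (auto intro!: order.trans[OF abs_triangle_ineq] add_mono c0_coord_le that)
  show "vnorm c0 (c *\<^sub>R x) = \<bar>c\<bar> * vnorm c0 x" if x: "x \<in> vecs c0" for c x
  proof (rule antisym)
    show "vnorm c0 (c *\<^sub>R x) \<le> \<bar>c\<bar> * vnorm c0 x"
      by (rule vnorm_c0_le) (simp add: abs_mult mult_left_mono c0_coord_le[OF x])
    obtain n where "vnorm c0 x = \<bar>x n\<bar>" using vnorm_c0_attained[OF x] .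
    then show "\<bar>c\<bar> * vnorm c0 x \<le> vnorm c0 (c *\<^sub>R x)"
      using c0_coord_le[OF subspace_scale[OF subspace_c0 x], of c n] by (simp add: abs_mult)
  qed
qed

lemma cauchy_complete_c0: "cauchy_complete c0"
  unfolding cauchy_complete_def
proof (intro allI impI)
  fix \<sigma> :: "nat \<Rightarrow> nat \<Rightarrow> real"
  assume r: "range \<sigma> \<subseteq> vecs c0"
    and c: "\<forall>e>0. \<exists>N. \<forall>m\<ge>N. \<forall>n\<ge>N. vnorm c0 (\<sigma> m - \<sigma> n) \<le> e"
  have \<sigma>: "\<sigma> n \<in> vecs c0" for n using r by blast
  have diff: "\<sigma> m - \<sigma> n \<in> vecs c0" for m n using \<sigma> subspace_c0 by (simp add: subspace_diff)
  have unif: "\<exists>N. \<forall>m\<ge>N. \<forall>n\<ge>N. \<forall>k. \<bar>\<sigma> m k - \<sigma> n k\<bar> \<le> e" if e: "e > 0" for e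
  proof -
    obtain N where "\<forall>m\<ge>N. \<forall>n\<ge>N. vnorm c0 (\<sigma> m - \<sigma> n) \<le> e" using c e by blast
    then have "\<forall>m\<ge>N. \<forall>n\<ge>N. \<forall>k. \<bar>\<sigma> m k - \<sigma> n k\<bar> \<le> e"
      using c0_coord_le[OF diff] minus_apply by (metis order.trans)
    then show ?thesis ..
  qed
  then obtain x where x: "\<And>k. (\<lambda>n. \<sigma> n k) \<longlonglongrightarrow> x k" using coordinatewise_limit[of \<sigma>] by blast
  have bd: "\<exists>N. \<forall>n\<ge>N. \<forall>k. \<bar>\<sigma> n k - x k\<bar> \<le> e" if e: "e > 0" for e
  proof -
    obtain N where N: "\<forall>m\<ge>N. \<forall>n\<ge>N. \<forall>k. \<bar>\<sigma> m k - \<sigma> n k\<bar> \<le> e" using unif e by blast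
    have "\<bar>\<sigma> n k - x k\<bar> \<le> e" if n: "n \<ge> N" for n k
    proof (rule tendsto_upperbound)
      show "(\<lambda>m. \<bar>\<sigma> n k - \<sigma> m k\<bar>) \<longlonglongrightarrow> \<bar>\<sigma> n k - x k\<bar>" by (intro tendsto_intros x)
      show "\<forall>\<^sub>F m in sequentially. \<bar>\<sigma> n k - \<sigma> m k\<bar> \<le> e"
        by (rule eventually_sequentiallyI[of N]) (use N n in blast)
    qed simp
    then show ?thesis by blast
  qed
  have "x \<longlonglongrightarrow> 0"
  proof (rule tendsto_0_uniform_limit)
    fix e :: real assume "e > 0"
    then obtain N where "\<forall>k. \<bar>\<sigma> N k - x k\<bar> \<le> e" using bd by blast
    then show "\<exists>y. y \<longlonglongrightarrow> 0 \<and> (\<forall>k. \<bar>y k - x k\<bar> \<le> e)" using \<sigma>[of N] by (auto simp: vecs_c0)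
  qed
  moreover have "\<exists>N. \<forall>n\<ge>N. vnorm c0 (\<sigma> n - x) \<le> e" if e: "e > 0" for e
  proof -
    obtain N where N: "\<forall>n\<ge>N. \<forall>k. \<bar>\<sigma> n k - x k\<bar> \<le> e" using bd e by blast
    then have "\<forall>n\<ge>N. vnorm c0 (\<sigma> n - x) \<le> e" by (auto intro!: vnorm_c0_le)
    then show ?thesis ..
  qed
  ultimately show "\<exists>x\<in>vecs c0. \<forall>e>0. \<exists>N. \<forall>n\<ge>N. vnorm c0 (\<sigma> n - x) \<le> e"
    by (intro bexI[of _ x]) (auto simp: vecs_c0)
qed

lemma finite_support_c0:
  assumes "\<And>i. i \<ge> N \<Longrightarrow> z i = 0"
  shows "z \<in> vecs c0"
  unfolding vecs_c0
  by (rule Lim_transform_eventually[OF tendsto_const])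
    (auto simp: assms eventually_sequentially intro!: exI[of _ N])

lemma unit_seq_c0: "unit_seq n \<in> vecs c0"
  by (rule finite_support_c0[of "Suc n"]) (simp add: unit_seq_def)

text \<open>Testing a functional against sign vectors shows that its coefficients are absolutely summable.\<close>

lemma c0_functional_coeff_sum_le:
  assumes g: "linear_functional_on (vecs c0) g" and C: "\<And>z. z \<in> vecs c0 \<Longrightarrow> \<bar>g z\<bar> \<le> C * vnorm c0 z"
    and "0 \<le> C"
  shows "(\<Sum>n<K. \<bar>g (unit_seq n)\<bar>) \<le> C"
proof -
  let ?s = "\<lambda>n. sgn (g (unit_seq n))"
  have "head K ?s \<in> vecs c0" by (rule finite_support_c0[of K]) (simp add: head_def)
  moreover have "vnorm c0 (head K ?s) \<le> 1"
    by (rule vnorm_c0_le) (simp add: head_def abs_sgn_eq)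
  ultimately have "\<bar>g (head K ?s)\<bar> \<le> C"
    using C[of "head K ?s"] mult_left_mono[of "vnorm c0 (head K ?s)" 1 C] \<open>0 \<le> C\<close> by simp
  moreover have "g (head K ?s) = (\<Sum>n<K. ?s n * g (unit_seq n))"
    unfolding head_eq_sum by (rule linear_functional_on_sum[OF subspace_c0 g unit_seq_c0])
  moreover have "\<dots> = (\<Sum>n<K. \<bar>g (unit_seq n)\<bar>)" by (simp add: abs_sgn mult.commute)
  ultimately show ?thesis by simp
qed

lemma c0_functional_summable:
  assumes "linear_functional_on (vecs c0) g" "\<And>z. z \<in> vecs c0 \<Longrightarrow> \<bar>g z\<bar> \<le> C * vnorm c0 z" "0 \<le> C"
  shows "summable (\<lambda>n. \<bar>g (unit_seq n)\<bar>)"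
  by (rule summableI_nonneg_bounded[of _ C])
    (use c0_functional_coeff_sum_le[of g C, OF assms] in auto)

lemma c0_functional_sums:
  assumes g: "linear_functional_on (vecs c0) g" and C: "\<And>z. z \<in> vecs c0 \<Longrightarrow> \<bar>g z\<bar> \<le> C * vnorm c0 z"
    and "0 \<le> C" and z: "z \<in> vecs c0"
  shows "(\<lambda>n. z n * g (unit_seq n)) sums g z"
  unfolding sums_def
proof (rule LIMSEQ_I)
  fix r :: real assume r: "0 < r"
  define d where "d = r / 2 / (C + 1)"
  have d: "d > 0" using r \<open>0 \<le> C\<close> by (simp add: d_def)
  have dC: "d * (C + 1) = r / 2"
    by (rule iffD1[OF nonzero_eq_divide_eq]) (use \<open>0 \<le> C\<close> d_def in linarith)+
  obtain N where N: "\<And>n. n \<ge> N \<Longrightarrow> \<bar>z n\<bar> < d"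
    using LIMSEQ_D[of z 0 d] z d by (auto simp: vecs_c0)
  have "norm ((\<Sum>m<n. z m * g (unit_seq m)) - g z) < r" if n: "n \<ge> N" for n
  proof -
    have h: "head n z \<in> vecs c0" by (rule finite_support_c0[of n]) (simp add: head_def)
    have "tail n z = z - head n z" by (auto simp: tail_def head_def)
    then have t: "tail n z \<in> vecs c0" using subspace_diff[OF subspace_c0 z h] by simp
    have "g (head n z) = (\<Sum>m<n. z m * g (unit_seq m))"
      unfolding head_eq_sum by (rule linear_functional_on_sum[OF subspace_c0 g unit_seq_c0])
    moreover have "g z = g (head n z) + g (tail n z)"
      using linear_functional_on_add[OF g h t] by (simp add: head_plus_tail)
    moreover have "\<bar>g (tail n z)\<bar> < r"
    proof -
      have "vnorm c0 (tail n z) \<le> d"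
        by (rule vnorm_c0_le) (use N n d in \<open>simp add: tail_def less_imp_le\<close>)
      then have "C * vnorm c0 (tail n z) \<le> d * (C + 1)"
        unfolding mult.commute[of d] using \<open>0 \<le> C\<close> vnorm_nonneg[OF normed_space_c0 t] by (intro mult_mono) auto
      also have "\<dots> = r / 2" by (rule dC)
      also have "\<dots> < r" using r by simp
      finally show ?thesis using C[OF t] by simp
    qed
    ultimately show ?thesis by simp
  qed
  then show "\<exists>no. \<forall>n\<ge>no. norm ((\<Sum>m<n. z m * g (unit_seq m)) - g z) < r" by blast
qed

section \<open>Direct sums of sequence spaces\<close>

definition evens :: "(nat \<Rightarrow> real) \<Rightarrow> nat \<Rightarrow> real" where "evens x = (\<lambda>n. x (2 * n))"

definition odds :: "(nat \<Rightarrow> real) \<Rightarrow> nat \<Rightarrow> real" where "odds x = (\<lambda>n. x (2 * n + 1))"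

definition interleave :: "(nat \<Rightarrow> real) \<Rightarrow> (nat \<Rightarrow> real) \<Rightarrow> nat \<Rightarrow> real" where
  "interleave x y = (\<lambda>n. if even n then x (n div 2) else y (n div 2))"

definition direct_sum ::
    "(nat \<Rightarrow> real) nspace \<Rightarrow> (nat \<Rightarrow> real) nspace \<Rightarrow> (nat \<Rightarrow> real) nspace" where
  "direct_sum A B = \<lparr>vecs = {x. evens x \<in> vecs A \<and> odds x \<in> vecs B},
     vnorm = (\<lambda>x. vnorm A (evens x) + vnorm B (odds x))\<rparr>"

lemma evens_interleave [simp]: "evens (interleave x y) = x"
  and odds_interleave [simp]: "odds (interleave x y) = y"
  and interleave_evens_odds [simp]: "interleave (evens z) (odds z) = z"
  by (auto simp: evens_def odds_def interleave_def fun_eq_iff)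

lemma evens_linear [simp]:
  "evens (x + y) = evens x + evens y" "evens (x - y) = evens x - evens y"
  "evens (c *\<^sub>R x) = c *\<^sub>R evens x" "evens 0 = 0"
  by (auto simp: evens_def)

lemma odds_linear [simp]:
  "odds (x + y) = odds x + odds y" "odds (x - y) = odds x - odds y"
  "odds (c *\<^sub>R x) = c *\<^sub>R odds x" "odds 0 = 0"
  by (auto simp: odds_def)

lemma interleave_add: "interleave x y + interleave x' y' = interleave (x + x') (y + y')"
  and interleave_scale: "c *\<^sub>R interleave x y = interleave (c *\<^sub>R x) (c *\<^sub>R y)"
  by (auto simp: interleave_def)

lemma eq_0_iff_evens_odds: "x = 0 \<longleftrightarrow> evens x = 0 \<and> odds x = 0"
proof
  assume "evens x = 0 \<and> odds x = 0"
  then have "x = interleave 0 0" using interleave_evens_odds[of x] by simp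
  then show "x = 0" by (auto simp: interleave_def)
qed simp

lemma vecs_direct_sum: "x \<in> vecs (direct_sum A B) \<longleftrightarrow> evens x \<in> vecs A \<and> odds x \<in> vecs B"
  and vnorm_direct_sum: "vnorm (direct_sum A B) x = vnorm A (evens x) + vnorm B (odds x)"
  by (simp_all add: direct_sum_def)

lemma normed_space_direct_sum:
  assumes A: "normed_space A" and B: "normed_space B"
  shows "normed_space (direct_sum A B)"
  unfolding normed_space_def
proof (intro conjI ballI allI)
  note sub = normed_space_subspace[OF A] normed_space_subspace[OF B]
  show "subspace (vecs (direct_sum A B))"
    using sub by (simp add: subspace_def vecs_direct_sum)
  show "0 \<le> vnorm (direct_sum A B) x" if "x \<in> vecs (direct_sum A B)" for x
    using that vnorm_nonneg[OF A] vnorm_nonneg[OF B] by (simp add: vecs_direct_sum vnorm_direct_sum)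
  show "vnorm (direct_sum A B) x = 0 \<longleftrightarrow> x = 0" if "x \<in> vecs (direct_sum A B)" for x
    using that vnorm_nonneg[OF A] vnorm_nonneg[OF B] vnorm_eq_0[OF A] vnorm_eq_0[OF B]
    unfolding eq_0_iff_evens_odds[of x] by (simp add: vecs_direct_sum vnorm_direct_sum add_nonneg_eq_0_iff)
  show "vnorm (direct_sum A B) (x + y) \<le> vnorm (direct_sum A B) x + vnorm (direct_sum A B) y"
    if "x \<in> vecs (direct_sum A B)" "y \<in> vecs (direct_sum A B)" for x y
    using that vnorm_triangle[OF A, of "evens x" "evens y"] vnorm_triangle[OF B, of "odds x" "odds y"]
    by (simp add: vecs_direct_sum vnorm_direct_sum)
  show "vnorm (direct_sum A B) (c *\<^sub>R x) = \<bar>c\<bar> * vnorm (direct_sum A B) x"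
    if "x \<in> vecs (direct_sum A B)" for c x
    using that by (simp add: vecs_direct_sum vnorm_direct_sum vnorm_scale[OF A] vnorm_scale[OF B] distrib_left)
qed

lemma cauchy_complete_direct_sum:
  assumes A: "normed_space A" "cauchy_complete A" and B: "normed_space B" "cauchy_complete B"
  shows "cauchy_complete (direct_sum A B)"
  unfolding cauchy_complete_def
proof (intro allI impI)
  fix \<sigma> :: "nat \<Rightarrow> nat \<Rightarrow> real"
  assume r: "range \<sigma> \<subseteq> vecs (direct_sum A B)"
    and c: "\<forall>e>0. \<exists>N. \<forall>m\<ge>N. \<forall>n\<ge>N. vnorm (direct_sum A B) (\<sigma> m - \<sigma> n) \<le> e"
  have ab: "evens (\<sigma> n) \<in> vecs A" "odds (\<sigma> n) \<in> vecs B" for n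
    using r unfolding image_subset_iff vecs_direct_sum by blast+
  have le: "vnorm A (evens (\<sigma> m) - evens (\<sigma> n)) \<le> vnorm (direct_sum A B) (\<sigma> m - \<sigma> n)"
    "vnorm B (odds (\<sigma> m) - odds (\<sigma> n)) \<le> vnorm (direct_sum A B) (\<sigma> m - \<sigma> n)" for m n
    using vnorm_nonneg[OF A(1) subspace_diff[OF normed_space_subspace[OF A(1)] ab(1) ab(1)], of m n]
      vnorm_nonneg[OF B(1) subspace_diff[OF normed_space_subspace[OF B(1)] ab(2) ab(2)], of m n]
    by (simp_all add: vnorm_direct_sum)
  have "\<forall>e>0. \<exists>N. \<forall>m\<ge>N. \<forall>n\<ge>N. vnorm A (evens (\<sigma> m) - evens (\<sigma> n)) \<le> e"
    using c le(1) by (meson order.trans)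
  then obtain a where a: "a \<in> vecs A" "\<forall>e>0. \<exists>N. \<forall>n\<ge>N. vnorm A (evens (\<sigma> n) - a) \<le> e"
    using cauchy_completeD[OF A(2), of "\<lambda>n. evens (\<sigma> n)"] ab(1) by blast
  have "\<forall>e>0. \<exists>N. \<forall>m\<ge>N. \<forall>n\<ge>N. vnorm B (odds (\<sigma> m) - odds (\<sigma> n)) \<le> e"
    using c le(2) by (meson order.trans)
  then obtain b where b: "b \<in> vecs B" "\<forall>e>0. \<exists>N. \<forall>n\<ge>N. vnorm B (odds (\<sigma> n) - b) \<le> e"
    using cauchy_completeD[OF B(2), of "\<lambda>n. odds (\<sigma> n)"] ab(2) by blast
  show "\<exists>x\<in>vecs (direct_sum A B). \<forall>e>0. \<exists>N. \<forall>n\<ge>N. vnorm (direct_sum A B) (\<sigma> n - x) \<le> e"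
  proof (intro bexI[of _ "interleave a b"] allI impI)
    fix e :: real assume "e > 0"
    then have e2: "e / 2 > 0" by simp
    obtain N1 where N1: "\<forall>n\<ge>N1. vnorm A (evens (\<sigma> n) - a) \<le> e / 2" using a(2) e2 by blast
    obtain N2 where N2: "\<forall>n\<ge>N2. vnorm B (odds (\<sigma> n) - b) \<le> e / 2" using b(2) e2 by blast
    have "\<forall>n\<ge>max N1 N2. vnorm (direct_sum A B) (\<sigma> n - interleave a b) \<le> e"
      using N1 N2 by (fastforce simp: vnorm_direct_sum)
    then show "\<exists>N. \<forall>n\<ge>N. vnorm (direct_sum A B) (\<sigma> n - interleave a b) \<le> e" ..
  qed (use a b in \<open>simp add: vecs_direct_sum\<close>)
qed

section \<open>The direct sum of the James space and the null sequences\<close>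

abbreviation James_c0 :: "(nat \<Rightarrow> real) nspace" where
  "James_c0 \<equiv> direct_sum James c0"

lemma normed_space_James_c0: "normed_space James_c0"
  by (rule normed_space_direct_sum[OF normed_space_James normed_space_c0])

lemma banach_space_James_c0: "banach_space James_c0"
  by (intro banach_spaceI normed_space_James_c0 cauchy_complete_direct_sum
      normed_space_James normed_space_c0 cauchy_complete_James cauchy_complete_c0)

lemma James_subset_c0: "x \<in> vecs James \<Longrightarrow> x \<in> vecs c0"
  by (simp add: vecs_James vecs_c0)

lemma vnorm_c0_le_James: "x \<in> vecs James \<Longrightarrow> vnorm c0 x \<le> vnorm James x"
  by (rule vnorm_c0_le) (rule James_coord_le)

lemma zero_in_James [simp]: "0 \<in> vecs James" and zero_in_c0 [simp]: "0 \<in> vecs c0"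
  using subspace_0 normed_space_subspace normed_space_James subspace_c0 by blast+

lemma vnorm_zeros [simp]: "vnorm James 0 = 0" "vnorm c0 0 = 0"
  by (simp_all add: vnorm_zero normed_space_James normed_space_c0)

lemma James_c0_coord_le:
  assumes x: "x \<in> vecs James_c0"
  shows "\<bar>x n\<bar> \<le> vnorm James_c0 x"
proof -
  have e: "evens x \<in> vecs James" and o: "odds x \<in> vecs c0" using x by (simp_all add: vecs_direct_sum)
  have n: "0 \<le> vnorm James (evens x)" "0 \<le> vnorm c0 (odds x)"
    using e o vnorm_nonneg normed_space_James normed_space_c0 by blast+
  show ?thesis
  proof (cases "even n")
    case True
    then have "x n = evens x (n div 2)" by (simp add: evens_def)
    then show ?thesis using James_coord_le[OF e, of "n div 2"] n by (simp add: vnorm_direct_sum)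
  next
    case False
    then have "x n = odds x (n div 2)" by (simp add: odds_def)
    then show ?thesis using c0_coord_le[OF o, of "n div 2"] n by (simp add: vnorm_direct_sum)
  qed
qed

lemma coord_James_c0: "coord James_c0 n \<in> vecs (dual James_c0)"
  by (rule coord_in_dual[OF normed_space_James_c0, of _ 1]) (simp add: James_c0_coord_le)

subsection \<open>The projection to the null sequences\<close>

lemma bounded_operator_evens: "bounded_operator James_c0 c0 evens"
  unfolding bounded_operator_def
proof (intro conjI)
  show "\<exists>C. \<forall>x\<in>vecs James_c0. vnorm c0 (evens x) \<le> C * vnorm James_c0 x"
  proof (intro exI[of _ 1] ballI)
    fix x assume "x \<in> vecs James_c0"
    then have "evens x \<in> vecs James" "odds x \<in> vecs c0" by (simp_all add: vecs_direct_sum)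
    then show "vnorm c0 (evens x) \<le> 1 * vnorm James_c0 x"
      using vnorm_c0_le_James[of "evens x"] vnorm_nonneg[OF normed_space_c0, of "odds x"]
      by (simp add: vnorm_direct_sum)
  qed
qed (auto simp: vecs_direct_sum James_subset_c0)

text \<open>
  A gliding hump. On an infinite-dimensional space there are vectors that vanish on any given
  finite set of coordinates, so normalized humps can be added one after the other: the supremum norm
  stays at most 5/4, while every hump contributes at least 1/8 to the square variation.
\<close>

lemma James_norm_not_equivalent_to_sup_norm:
  assumes L: "subspace L" "L \<subseteq> vecs James_c0" "infinite_dimensional L"
    and C: "\<And>x. x \<in> L \<Longrightarrow> vnorm James_c0 x \<le> C * vnorm c0 (evens x)"
  shows False
proof -
  have lin: "linear_functional_on L (\<lambda>x. evens x i)" for i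
    by (simp add: linear_functional_on_def)
  have ev: "evens x \<in> vecs c0" "evens x \<in> vecs James" "odds x \<in> vecs c0" if "x \<in> L" for x
    using that L(2) James_subset_c0 by (auto simp: vecs_direct_sum)
  have hump: "\<exists>v\<in>L. (\<forall>i\<le>M. evens v i = 0) \<and> (\<forall>i. \<bar>evens v i\<bar> \<le> 1) \<and> (\<exists>p>M. \<bar>evens v p\<bar> = 1)" for M
  proof -
    obtain x where x: "x \<in> L" "x \<noteq> 0" "\<forall>i<Suc M. evens x i = 0"
      using infinite_dimensional_common_zero[where f = "\<lambda>i x. evens x i", OF L(1,3) lin, of "Suc M"]
      by (elim bexE conjE) (rule that)
    define s where "s = vnorm c0 (evens x)"
    have "s \<noteq> 0"
    proof
      assume "s = 0"
      then have "vnorm James_c0 x = 0"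
        using C[OF x(1)] vnorm_nonneg[OF normed_space_James_c0, of x] x(1) L(2) by (auto simp: s_def)
      then show False using vnorm_eq_0[OF normed_space_James_c0, of x] x(1,2) L(2) by blast
    qed
    then have s: "s > 0" using vnorm_nonneg[OF normed_space_c0 ev(1)[OF x(1)]] by (simp add: s_def)
    obtain p where p: "s = \<bar>evens x p\<bar>" using vnorm_c0_attained[OF ev(1)[OF x(1)]] by (auto simp: s_def)
    have "p > M" using x(3) p s by (cases "p < Suc M") auto
    moreover have "(1/s) *\<^sub>R x \<in> L" using L(1) x(1) by (rule subspace_scale)
    moreover have "\<bar>evens ((1/s) *\<^sub>R x) i\<bar> \<le> 1" for i
      using s c0_coord_le[OF ev(1)[OF x(1)], of i] by (simp add: s_def abs_mult)
    moreover have "\<bar>evens ((1/s) *\<^sub>R x) p\<bar> = 1" using s p by (simp add: abs_mult)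
    moreover have "\<forall>i\<le>M. evens ((1/s) *\<^sub>R x) i = 0" using x(3) by simp
    ultimately show ?thesis by blast
  qed
  have grow: "\<exists>w\<in>L. \<exists>ps. sorted ps \<and> (\<forall>k. \<bar>evens w k\<bar> \<le> 5/4) \<and> real n / 8 \<le> var_form (evens w) (evens w) ps" for n
  proof (induction n)
    case 0
    show ?case by (rule bexI[OF _ subspace_0[OF L(1)]]) (intro exI[of _ "[]"], simp add: evens_def)
  next
    case (Suc n)
    then obtain w ps where w: "w \<in> L" "sorted ps" "\<And>k. \<bar>evens w k\<bar> \<le> 5/4"
      "real n / 8 \<le> var_form (evens w) (evens w) ps" by blast
    obtain N0 where N0: "\<And>k. k \<ge> N0 \<Longrightarrow> \<bar>evens w k\<bar> < 1/4"
      using LIMSEQ_D[of "evens w" 0 "1/4"] ev(1)[OF w(1)] by (auto simp: vecs_c0)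
    define M where "M = max N0 (Max (insert 0 (set ps)))"
    have M: "p \<le> M" if "p \<in> set ps" for p using that by (simp add: M_def le_max_iff_disj)
    obtain v p where v: "v \<in> L" "\<And>i. i \<le> M \<Longrightarrow> evens v i = 0" "\<And>i. \<bar>evens v i\<bar> \<le> 1" "p > M" "\<bar>evens v p\<bar> = 1"
      using hump[of M] by blast
    let ?u = "evens (w + v)"
    have "\<bar>?u k\<bar> \<le> 5/4" for k
    proof (cases "k \<le> M")
      case True
      then show ?thesis using w(3)[of k] v(2)[of k] by simp
    next
      case False
      then have "\<bar>evens w k\<bar> < 1/4" by (intro N0) (simp add: M_def)
      then show ?thesis using v(3)[of k] abs_triangle_ineq[of "evens w k" "evens v k"] by simp
    qed
    moreover have "sorted (ps @ [M, p])" using w(2) M v(4) by (fastforce simp: sorted_append)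
    moreover have "real (Suc n) / 8 \<le> var_form ?u ?u (ps @ [M, p])"
    proof -
      have "var_form ?u ?u ps = var_form (evens w) (evens w) ps"
        by (rule var_form_cong) (simp_all add: v(2) M)
      moreover have "1/8 \<le> var_form ?u ?u [M, p]"
      proof -
        have "\<bar>evens w M\<bar> < 1/4" "\<bar>evens w p\<bar> < 1/4" 
          using N0[of M] N0[of p] v(4) M_def by simp_all
        moreover have "?u M - ?u p = evens w M - evens w p - evens v p" using v(2)[of M] by simp
        ultimately have "1/2 \<le> \<bar>?u M - ?u p\<bar>" using v(5) by linarith
        then have "(1/2)\<^sup>2 \<le> (?u M - ?u p)\<^sup>2" using abs_le_square_iff[of "1/2" "?u M - ?u p"] by simp
        then show ?thesis by (simp add: power2_eq_square)
      qed
      moreover have "var_form ?u ?u ps + var_form ?u ?u [M, p] \<le> var_form ?u ?u (ps @ [M, p])"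
        using var_form_append[of ps "[M, p]" ?u ?u] by (cases "ps = []") auto
      ultimately have "real n / 8 + 1/8 \<le> var_form ?u ?u (ps @ [M, p])" using w(4) by linarith
      then show ?thesis by simp
    qed
    ultimately show ?case using subspace_add[OF L(1) w(1) v(1)] by blast
  qed
  obtain n :: nat where n: "real n > 8 * (\<bar>C\<bar> * (5/4))\<^sup>2" using reals_Archimedean2 by blast
  obtain w ps where w: "w \<in> L" "sorted ps" "\<And>k. \<bar>evens w k\<bar> \<le> 5/4"
    "real n / 8 \<le> var_form (evens w) (evens w) ps" using grow[of n] by blast
  have c: "vnorm c0 (evens w) \<le> 5/4" using w(3) by (rule vnorm_c0_le)
  have "vnorm James (evens w) \<le> vnorm James_c0 w"
    using vnorm_nonneg[OF normed_space_c0 ev(3)[OF w(1)]] by (simp add: vnorm_direct_sum)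
  also have "\<dots> \<le> C * vnorm c0 (evens w)" by (rule C[OF w(1)])
  also have "\<dots> \<le> \<bar>C\<bar> * (5/4)"
    using c vnorm_nonneg[OF normed_space_c0 ev(1)[OF w(1)]] by (intro mult_mono) auto
  finally have "(vnorm James (evens w))\<^sup>2 \<le> (\<bar>C\<bar> * (5/4))\<^sup>2"
    using vnorm_nonneg[OF normed_space_James ev(2)[OF w(1)]] by (intro power_mono)
  then show False
    using james_bounded_var[OF james_bounded_vnorm[OF ev(2)[OF w(1)]] w(2)] w(4) n by linarith
qed

lemma strictly_singular_evens: "strictly_singular James_c0 c0 evens"
  unfolding strictly_singular_def
proof (intro conjI allI impI notI)
  show "bounded_operator James_c0 c0 evens" by (rule bounded_operator_evens)
  fix L assume L: "closed_subspace James_c0 L \<and> infinite_dimensional L"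
    and iso: "isomorphism_onto_image (James_c0\<lparr>vecs := L\<rparr>) c0 evens"
  have inj: "inj_on evens L" using iso by (simp add: isomorphism_onto_image_def)
  obtain C where C: "\<forall>w\<in>evens ` L. vnorm James_c0 (inv_into L evens w) \<le> C * vnorm c0 w"
    using iso by (auto simp: isomorphism_onto_image_def bounded_operator_def)
  have "vnorm James_c0 x \<le> C * vnorm c0 (evens x)" if "x \<in> L" for x
    using C that inv_into_f_f[OF inj that] by fastforce
  moreover have "subspace L" using L by (simp add: closed_subspace_def)
  moreover have "L \<subseteq> vecs James_c0" using L closed_subspace_subset[OF normed_space_James_c0] by blast
  ultimately show False using James_norm_not_equivalent_to_sup_norm[of L C] L by blast
qed

lemma topspace_weak_topology_c0: "topspace (weak_topology c0) = vecs c0"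
proof -
  have "coord c0 0 \<in> vecs (dual c0)"
    by (rule coord_in_dual[OF normed_space_c0, of _ 1]) (simp add: c0_coord_le)
  then have "vecs c0 \<in> {{x \<in> vecs c0. f x \<in> U} |f U. f \<in> vecs (dual c0) \<and> open U}"
    by (intro CollectI exI[of _ "coord c0 0"] exI[of _ UNIV]) auto
  then show ?thesis unfolding weak_topology_def topology_generated_by_topspace by blast
qed

text \<open>
  Each null sequence has a coordinate below 1/2, so the weakly open sets \<open>U i\<close> cover the null
  sequences; but finitely many of them miss the sequence that is 1/2 on a long initial segment, and
  all these sequences are images of vectors of norm at most 1.
\<close>

lemma not_weakly_compact_evens: "\<not> weakly_compact James_c0 c0 evens"
proof
  let ?W = "weak_topology c0"
  let ?A = "evens ` {x \<in> vecs James_c0. vnorm James_c0 x \<le> 1}"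
  assume "weakly_compact James_c0 c0 evens"
  then have K: "compactin ?W (?W closure_of ?A)" by (simp add: weakly_compact_def)
  define U where "U i = {z \<in> vecs c0. coord c0 i z \<in> {-1/2<..<1/2}}" for i
  have "openin ?W (U i)" for i
  proof -
    have "coord c0 i \<in> vecs (dual c0)"
      by (rule coord_in_dual[OF normed_space_c0, of _ 1]) (simp add: c0_coord_le)
    then show ?thesis
      unfolding weak_topology_def U_def
      by (intro topology_generated_by_Basis CollectI exI[of _ "coord c0 i"] exI[of _ "{-1/2<..<1/2}"])
        simp
  qed
  moreover have "?W closure_of ?A \<subseteq> \<Union>(range U)"
  proof
    fix z assume "z \<in> ?W closure_of ?A"
    then have z: "z \<in> vecs c0" 
      using closure_of_subset_topspace[of ?W ?A] unfolding topspace_weak_topology_c0 by (rule subsetD[rotated])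
    then obtain n where "\<bar>z n\<bar> < 1/2" using LIMSEQ_D[of z 0 "1/2"] by (auto simp: vecs_c0)
    then have "z \<in> U n" using z by (auto simp: U_def coord_def)
    then show "z \<in> \<Union>(range U)" by blast
  qed
  ultimately have "\<exists>\<F>. finite \<F> \<and> \<F> \<subseteq> range U \<and> ?W closure_of ?A \<subseteq> \<Union>\<F>"
    by (intro compactinD[OF K]) auto
  then obtain \<F> where F: "finite \<F>" "\<F> \<subseteq> range U" "?W closure_of ?A \<subseteq> \<Union>\<F>" by blast
  then obtain I where I: "finite I" "\<F> = U ` I"
    using finite_subset_image[of \<F> U UNIV] by blast
  define n where "n = Suc (Max (insert 0 I))"
  (* Initial segments of the constant sequence 1 have norm at most 2. *)
  let ?z = "(1/2) *\<^sub>R head n (\<lambda>_. 1)"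
  have z: "?z \<in> vecs James"
    using subspace_scale[OF normed_space_subspace[OF normed_space_James] James_head_const(1)] .
  have "vnorm James ?z \<le> 1"
    using James_head_const(2)[of n] vnorm_scale[OF normed_space_James James_head_const(1), of "1/2" n] by simp
  then have "interleave ?z 0 \<in> {x \<in> vecs James_c0. vnorm James_c0 x \<le> 1}"
    using z by (simp add: vecs_direct_sum vnorm_direct_sum)
  then have "?z \<in> ?A" by (rule rev_image_eqI) simp
  moreover have "?A \<subseteq> topspace ?W"
    unfolding topspace_weak_topology_c0 using James_subset_c0 by (auto simp: vecs_direct_sum)
  ultimately have "?z \<in> ?W closure_of ?A" using closure_of_subset[of ?A ?W] by (meson subsetD)
  then obtain i where i: "i \<in> I" "?z \<in> U i" using F(3) I(2) by blast
  have "i < n" using i(1) I(1) by (simp add: n_def less_Suc_eq_le)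
  then have "?z i = 1/2" by (simp add: head_def)
  moreover have "?z i < 1/2" using i(2) James_subset_c0[OF z] unfolding U_def coord_def by simp
  ultimately show False by simp
qed

subsection \<open>Functionals on the second summand\<close>

definition c0_coeff :: "((nat \<Rightarrow> real) \<Rightarrow> real) \<Rightarrow> nat \<Rightarrow> real" where
  "c0_coeff f n = f (interleave 0 (unit_seq n))"

lemma interleave_0_in: "z \<in> vecs c0 \<Longrightarrow> interleave 0 z \<in> vecs James_c0"
  and interleave_in_0: "y \<in> vecs James \<Longrightarrow> interleave y 0 \<in> vecs James_c0"
  and vnorm_interleave_0: "vnorm James_c0 (interleave 0 z) = vnorm c0 z"
  and vnorm_interleave_in_0: "vnorm James_c0 (interleave y 0) = vnorm James y"
  by (simp_all add: vecs_direct_sum vnorm_direct_sum)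

lemma c0_part:
  assumes f: "f \<in> vecs (dual James_c0)"
  shows "linear_functional_on (vecs c0) (\<lambda>z. f (interleave 0 z))"
    and "\<And>z. z \<in> vecs c0 \<Longrightarrow> \<bar>f (interleave 0 z)\<bar> \<le> vnorm (dual James_c0) f * vnorm c0 z"
proof -
  show "linear_functional_on (vecs c0) (\<lambda>z. f (interleave 0 z))"
    using linear_functional_on_add[OF dual_linear[OF f] interleave_0_in interleave_0_in]
      linear_functional_on_scale[OF dual_linear[OF f] interleave_0_in]
    by (simp add: linear_functional_on_def interleave_add interleave_scale)
  show "\<bar>f (interleave 0 z)\<bar> \<le> vnorm (dual James_c0) f * vnorm c0 z" if "z \<in> vecs c0" for z
    using dual_apply_le[OF normed_space_James_c0 f interleave_0_in[OF that]]
    by (simp add: vnorm_interleave_0)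
qed

lemma c0_coeff_summable:
  assumes "f \<in> vecs (dual James_c0)"
  shows "summable (\<lambda>n. \<bar>c0_coeff f n\<bar>)"
  unfolding c0_coeff_def
  by (rule c0_functional_summable[OF c0_part[OF assms] vnorm_dual_nonneg[OF normed_space_James_c0 assms]])

lemma c0_coeff_sum_le:
  assumes "f \<in> vecs (dual James_c0)"
  shows "(\<Sum>n. \<bar>c0_coeff f n\<bar>) \<le> vnorm (dual James_c0) f"
proof (rule suminf_le_const[OF c0_coeff_summable[OF assms]])
  show "(\<Sum>n<K. \<bar>c0_coeff f n\<bar>) \<le> vnorm (dual James_c0) f" for K
    unfolding c0_coeff_def
    by (rule c0_functional_coeff_sum_le[OF c0_part[OF assms] vnorm_dual_nonneg[OF normed_space_James_c0 assms]])
qed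

lemma c0_coeff_sums:
  assumes "f \<in> vecs (dual James_c0)" "z \<in> vecs c0"
  shows "(\<lambda>n. z n * c0_coeff f n) sums f (interleave 0 z)"
  unfolding c0_coeff_def
  by (rule c0_functional_sums[OF c0_part[OF assms(1)] vnorm_dual_nonneg[OF normed_space_James_c0 assms(1)] assms(2)])

lemma summable_bounded_mult:
  fixes a b :: "nat \<Rightarrow> real"
  assumes "summable (\<lambda>n. \<bar>a n\<bar>)" "\<And>n. \<bar>b n\<bar> \<le> s"
  shows "summable (\<lambda>n. b n * a n)" "\<bar>\<Sum>n. b n * a n\<bar> \<le> s * (\<Sum>n. \<bar>a n\<bar>)"
proof -
  have le: "\<bar>b n * a n\<bar> \<le> s * \<bar>a n\<bar>" for n using assms(2)[of n] by (simp add: abs_mult mult_right_mono)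
  have s: "summable (\<lambda>n. s * \<bar>a n\<bar>)" using assms(1) by (rule summable_mult)
  have abs: "summable (\<lambda>n. \<bar>b n * a n\<bar>)"
    by (rule summable_comparison_test[OF _ s]) (use le in auto)
  then show "summable (\<lambda>n. b n * a n)" by (rule summable_rabs_cancel)
  have "\<bar>\<Sum>n. b n * a n\<bar> \<le> (\<Sum>n. \<bar>b n * a n\<bar>)" using abs by (rule summable_rabs)
  also have "\<dots> \<le> (\<Sum>n. s * \<bar>a n\<bar>)" by (rule suminf_le[OF le abs s])
  also have "\<dots> = s * (\<Sum>n. \<bar>a n\<bar>)" using assms(1) by (rule suminf_mult)
  finally show "\<bar>\<Sum>n. b n * a n\<bar> \<le> s * (\<Sum>n. \<bar>a n\<bar>)" .
qed

lemma c0_part_abs_le: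
  assumes f: "f \<in> vecs (dual James_c0)" and z: "z \<in> vecs c0"
  shows "\<bar>f (interleave 0 z)\<bar> \<le> vnorm c0 z * (\<Sum>n. \<bar>c0_coeff f n\<bar>)"
  using summable_bounded_mult(2)[OF c0_coeff_summable[OF f], of z "vnorm c0 z"] c0_coord_le[OF z]
    sums_unique[OF c0_coeff_sums[OF f z]] by simp

lemma c0_coeff_linear:
  "c0_coeff (f + g) n = c0_coeff f n + c0_coeff g n" "c0_coeff (c *\<^sub>R f) n = c * c0_coeff f n"
  by (simp_all add: c0_coeff_def)

subsection \<open>The direct sum is not quasireflexive\<close>

text \<open>
  The bidual of the null sequences consists of the bounded sequences; this is the copy of the latter
  in the bidual of the direct sum.
\<close>

definition bounded_seq_bidual :: "(nat \<Rightarrow> real) \<Rightarrow> ((nat \<Rightarrow> real) \<Rightarrow> real) \<Rightarrow> real" where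
  "bounded_seq_bidual b f = (if f \<in> vecs (dual James_c0) then \<Sum>n. b n * c0_coeff f n else 0)"

lemma bounded_seq_bidual_in:
  assumes b: "\<And>n. \<bar>b n\<bar> \<le> 1"
  shows "bounded_seq_bidual b \<in> vecs (dual (dual James_c0))"
  unfolding dual_iff[of _ "dual James_c0"]
proof (intro conjI allI impI)
  note sub = subspace_dual[OF normed_space_James_c0]
  note summ = summable_bounded_mult(1)[of _ b 1, OF c0_coeff_summable b]
  show "linear_functional_on (vecs (dual James_c0)) (bounded_seq_bidual b)"
    unfolding linear_functional_on_def
  proof (intro conjI ballI allI)
    fix f g assume f: "f \<in> vecs (dual James_c0)" and g: "g \<in> vecs (dual James_c0)"
    show "bounded_seq_bidual b (f + g) = bounded_seq_bidual b f + bounded_seq_bidual b g"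
      using f g subspace_add[OF sub f g] suminf_add[OF summ[OF f] summ[OF g]]
      by (simp add: bounded_seq_bidual_def c0_coeff_linear distrib_left)
  next
    fix f c assume f: "f \<in> vecs (dual James_c0)"
    show "bounded_seq_bidual b (c *\<^sub>R f) = c * bounded_seq_bidual b f"
      using f subspace_scale[OF sub f] suminf_mult[OF summ[OF f], of c]
      by (simp add: bounded_seq_bidual_def c0_coeff_linear mult.left_commute)
  qed
  show "\<exists>C. \<forall>f\<in>vecs (dual James_c0). \<bar>bounded_seq_bidual b f\<bar> \<le> C * vnorm (dual James_c0) f"
  proof (intro exI[of _ 1] ballI)
    fix f assume f: "f \<in> vecs (dual James_c0)"
    show "\<bar>bounded_seq_bidual b f\<bar> \<le> 1 * vnorm (dual James_c0) f"
      using f summable_bounded_mult(2)[of _ b 1, OF c0_coeff_summable[OF f] b] c0_coeff_sum_le[OF f]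
      by (simp add: bounded_seq_bidual_def)
  qed
qed (simp add: bounded_seq_bidual_def)

lemma bounded_seq_bidual_coord:
  "bounded_seq_bidual b (coord James_c0 (2 * n + 1)) = b n"
proof -
  have "c0_coeff (coord James_c0 (2 * n + 1)) m = (if m = n then 1 else 0)" for m
    using interleave_0_in[OF unit_seq_c0, of m]
    by (auto simp: c0_coeff_def coord_def interleave_def unit_seq_def)
  then have "(\<lambda>m. b m * c0_coeff (coord James_c0 (2 * n + 1)) m) = (\<lambda>m. if m = n then b m else 0)"
    by auto
  then show ?thesis
    using sums_unique[OF sums_single[of n b]] coord_James_c0 by (simp add: bounded_seq_bidual_def)
qed

text \<open>
  Indicators of infinitely many disjoint infinite sets are linearly independent modulo the null
  sequences, whereas the canonical image only contributes null sequences.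
\<close>

lemma not_quasireflexive_James_c0: "\<not> quasireflexive James_c0"
proof
  assume "quasireflexive James_c0"
  then obtain F where F: "finite F"
    "vecs (dual (dual James_c0)) = span (canonical_image James_c0 \<union> F)"
    by (auto simp: quasireflexive_def)
  let ?o = "\<lambda>\<Phi> n. (\<Phi> :: ((nat \<Rightarrow> real) \<Rightarrow> real) \<Rightarrow> real) (coord James_c0 (2 * n + 1))"
  have null: "?o \<Phi> \<longlonglongrightarrow> 0" if \<Phi>: "\<Phi> \<in> span (canonical_image James_c0)" for \<Phi>
  proof -
    have "subspace {\<Phi>. ?o \<Phi> \<longlonglongrightarrow> 0}"
      unfolding subspace_def
    proof (intro conjI ballI allI)
      show "x + y \<in> {\<Phi>. ?o \<Phi> \<longlonglongrightarrow> 0}" if "x \<in> {\<Phi>. ?o \<Phi> \<longlonglongrightarrow> 0}" "y \<in> {\<Phi>. ?o \<Phi> \<longlonglongrightarrow> 0}" for x y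
        using that tendsto_add[of "?o x" 0 sequentially "?o y" 0] by simp
      show "c *\<^sub>R x \<in> {\<Phi>. ?o \<Phi> \<longlonglongrightarrow> 0}" if "x \<in> {\<Phi>. ?o \<Phi> \<longlonglongrightarrow> 0}" for c x
        using that tendsto_mult_left[of "?o x" 0 sequentially c] by simp
    qed simp
    moreover have "canonical_image James_c0 \<subseteq> {\<Phi>. ?o \<Phi> \<longlonglongrightarrow> 0}"
    proof
      fix \<Phi> assume "\<Phi> \<in> canonical_image James_c0"
      then obtain x where x: "x \<in> vecs James_c0" "\<Phi> = (\<lambda>f. if f \<in> vecs (dual James_c0) then f x else 0)"
        by (auto simp: canonical_image_def)
      have "?o \<Phi> = odds x" using x coord_James_c0 by (auto simp: coord_def odds_def)
      then show "\<Phi> \<in> {\<Phi>. ?o \<Phi> \<longlonglongrightarrow> 0}" using x(1) by (simp add: vecs_direct_sum vecs_c0)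
    qed
    ultimately show ?thesis using span_minimal \<Phi> by blast
  qed
  define b :: "nat \<Rightarrow> nat \<Rightarrow> real" where "b k n = (if fst (prod_decode n) = k then 1 else 0)" for k n
  have "bounded_seq_bidual (b k) \<in> span (canonical_image James_c0 \<union> F)" for k
    using bounded_seq_bidual_in[of "b k"] F(2) by (simp add: b_def)
  then have "\<exists>c g. c \<in> span (canonical_image James_c0) \<and> g \<in> span F \<and> bounded_seq_bidual (b k) = c + g" for k
    unfolding span_Un by blast
  then obtain c g where cg: "\<And>k. c k \<in> span (canonical_image James_c0)" "\<And>k. g k \<in> span F"
    "\<And>k. bounded_seq_bidual (b k) = c k + g k" by metis
  obtain n t where t: "\<exists>k<n. t k \<noteq> 0" "(\<Sum>k<n. t k *\<^sub>R g k) = 0"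
    by (rule nontrivial_relation_in_span[OF F(1), of g, OF cg(2)])
  then obtain j where j: "j < n" "t j \<noteq> 0" by blast
  define \<Phi> where "\<Phi> = (\<Sum>k<n. t k *\<^sub>R c k)"
  have "\<Phi> \<in> span (canonical_image James_c0)"
    unfolding \<Phi>_def using cg(1) by (intro span_sum span_scale)
  moreover have "\<Phi> = (\<Sum>k<n. t k *\<^sub>R bounded_seq_bidual (b k))"
    using t(2) by (simp add: \<Phi>_def cg(3) scaleR_add_right sum.distrib)
  then have val: "?o \<Phi> m = (\<Sum>k<n. t k * b k m)" for m
    using bounded_seq_bidual_coord[of _ m] by (simp add: sum_fun_apply)
  ultimately have lim: "?o \<Phi> \<longlonglongrightarrow> 0" using null by blast
  obtain N where N: "\<And>m. m \<ge> N \<Longrightarrow> \<bar>?o \<Phi> m\<bar> < \<bar>t j\<bar>"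
    using LIMSEQ_D[OF lim, of "\<bar>t j\<bar>"] j(2) by auto
  have "?o \<Phi> (prod_encode (j, N)) = (\<Sum>k<n. if k = j then t k else 0)"
    unfolding val by (rule sum.cong) (auto simp: b_def)
  also have "\<dots> = t j" using j(1) by simp
  finally show False using N[of "prod_encode (j, N)"] le_prod_encode_2[of N j] by simp
qed

subsection \<open>Total subspaces of the dual\<close>

text \<open>
  The first alternative: \<open>M\<close> contains functionals that keep half of their norm on the second
  summand while any finite number of coefficients is prescribed to vanish. They have large
  coefficients on successive blocks, and \<open>M\<close> is norming over the multiples of the sign vectors of
  these blocks. Since each functional vanishes on the earlier blocks, only the tails have to be
  controlled.
\<close>

lemma norming_over_sign_blocks:
  assumes M: "subspace M" "M \<subseteq> vecs (dual James_c0)"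
    and large: "\<And>k. \<exists>f\<in>M. (\<forall>n<k. c0_coeff f n = 0) \<and>
      vnorm (dual James_c0) f / 2 < (\<Sum>n. \<bar>c0_coeff f n\<bar>)"
  shows "\<exists>L. closed_subspace James_c0 L \<and> infinite_dimensional L \<and> norming_over James_c0 M L"
proof -
  let ?nm = "vnorm (dual James_c0)"
  (* More than 1/2 of the norm sits in the coefficients; leaving at most 1/8 to the tail keeps 3/8
     in the block, and the difference 1/4 of these is the norming constant. *)
  define P where "P k f K \<longleftrightarrow> f \<in> M \<and> (\<forall>n<k. c0_coeff f n = 0) \<and> ?nm f = 1 \<and> k < K \<and>
      3/8 \<le> (\<Sum>n<K. \<bar>c0_coeff f n\<bar>) \<and> (\<Sum>n. \<bar>c0_coeff f (n + K)\<bar>) \<le> 1/8" for k f K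
  have "\<exists>f K. P k f K" for k
  proof -
    obtain h where h: "h \<in> M" "\<forall>n<k. c0_coeff h n = 0" "?nm h / 2 < (\<Sum>n. \<bar>c0_coeff h n\<bar>)"
      using large[of k] by blast
    have hd: "h \<in> vecs (dual James_c0)" using h(1) M(2) by blast
    have "?nm h \<noteq> 0"
      using h(3) c0_coeff_sum_le[OF hd] by auto
    then have pos: "?nm h > 0" using vnorm_dual_nonneg[OF normed_space_James_c0 hd] by simp
    define f where "f = (1 / ?nm h) *\<^sub>R h"
    have f: "f \<in> M" unfolding f_def using M(1) h(1) by (rule subspace_scale)
    have fd: "f \<in> vecs (dual James_c0)" using f M(2) by blast
    have f1: "?nm f = 1"
      unfolding f_def using vnorm_dual_scale[OF normed_space_James_c0 hd, of "1 / ?nm h"] pos by simp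
    have coeff: "c0_coeff f n = (1 / ?nm h) * c0_coeff h n" for n
      unfolding f_def by (rule c0_coeff_linear)
    have "(\<Sum>n. \<bar>c0_coeff f n\<bar>) = (1 / ?nm h) * (\<Sum>n. \<bar>c0_coeff h n\<bar>)"
      using suminf_mult[OF c0_coeff_summable[OF hd], of "1 / ?nm h"] pos
      unfolding coeff by (simp add: abs_mult)
    then have "?nm h * (1/2) < ?nm h * (\<Sum>n. \<bar>c0_coeff f n\<bar>)" using h(3) pos by simp
    then have half: "1/2 < (\<Sum>n. \<bar>c0_coeff f n\<bar>)" using pos by (simp only: mult_less_cancel_left_pos)
    have s: "summable (\<lambda>n. \<bar>c0_coeff f n\<bar>)" by (rule c0_coeff_summable[OF fd])
    obtain K0 where K0: "\<And>K. K \<ge> K0 \<Longrightarrow> \<bar>\<Sum>n. \<bar>c0_coeff f (n + K)\<bar>\<bar> < 1/8"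
      using suminf_exist_split[OF _ s, of "1/8"] by auto
    define K where "K = max K0 (Suc k)"
    have tail: "(\<Sum>n. \<bar>c0_coeff f (n + K)\<bar>) \<le> 1/8" using K0[of K] by (simp add: K_def)
    have "(\<Sum>n. \<bar>c0_coeff f n\<bar>) = (\<Sum>n. \<bar>c0_coeff f (n + K)\<bar>) + (\<Sum>n<K. \<bar>c0_coeff f n\<bar>)"
      by (rule suminf_split_initial_segment[OF s])
    then have "3/8 \<le> (\<Sum>n<K. \<bar>c0_coeff f n\<bar>)" using tail half by simp
    moreover have "k < K" by (simp add: K_def)
    moreover have "\<forall>n<k. c0_coeff f n = 0" using h(2) by (simp add: coeff)
    ultimately have "P k f K" using f f1 tail by (simp add: P_def)
    then show ?thesis by blast
  qed
  then obtain f K where fK: "\<And>k. P k (f k) (K k)" by metis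
  then have f: "\<And>k. f k \<in> M" "\<And>k n. n < k \<Longrightarrow> c0_coeff (f k) n = 0" "\<And>k. ?nm (f k) = 1"
    and K: "\<And>k. k < K k" "\<And>k. 3/8 \<le> (\<Sum>n<K k. \<bar>c0_coeff (f k) n\<bar>)"
      "\<And>k. (\<Sum>n. \<bar>c0_coeff (f k) (n + K k)\<bar>) \<le> 1/8"
    unfolding P_def by simp_all
  (* The block with index j is the interval from N j to N (Suc j), and blk n is the index of the
     block that contains n. *)
  define N where "N j = (K ^^ j) 0" for j
  have N0: "N 0 = 0" and N_Suc: "N (Suc j) = K (N j)" for j by (simp_all add: N_def)
  have N_mono: "strict_mono N" using K(1) by (simp add: strict_mono_Suc_iff N_Suc)
  have N_ge: "j \<le> N j" for j using strict_mono_imp_increasing[OF N_mono] .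
  define blk where "blk n = (LEAST j. n < N (Suc j))" for n
  have blk_less: "n < N (Suc (blk n))" for n
    unfolding blk_def by (rule LeastI[of _ n]) (use N_ge[of "Suc n"] in simp)
  have blk_ge: "N (blk n) \<le> n" for n
  proof (cases "blk n")
    case 0 then show ?thesis by (simp add: N0)
  next
    case (Suc j)
    then have "\<not> n < N (Suc j)" unfolding blk_def by (metis lessI not_less_Least)
    then show ?thesis using Suc by simp
  qed
  have blk_eq: "blk n = j" if "N j \<le> n" "n < N (Suc j)" for n j
    unfolding blk_def
  proof (rule Least_equality)
    fix i assume "n < N (Suc i)"
    then have "N j < N (Suc i)" using that(1) by simp
    then show "j \<le> i" using strict_mono_less[OF N_mono] by simp
  qed (rule that)
  define \<sigma> where "\<sigma> n = (if 0 \<le> c0_coeff (f (N (blk n))) n then 1 else -1 :: real)" for n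
  have \<sigma>_sq: "\<sigma> n * \<sigma> n = 1" and \<sigma>_abs: "\<bar>\<sigma> n\<bar> = 1" for n by (simp_all add: \<sigma>_def)
  let ?c = "\<lambda>n. coord James_c0 (2 * n + 1)"
  (* L is given by linear equations between coordinates, which makes it closed. *)
  define \<Phi> where "\<Phi> = range (\<lambda>n. coord James_c0 (2 * n)) \<union>
    {\<sigma> m *\<^sub>R ?c m - \<sigma> n *\<^sub>R ?c n |m n. blk m = blk n}"
  define L where "L = {x \<in> vecs James_c0. \<forall>\<phi>\<in>\<Phi>. \<phi> x = 0}"
  note dsub = subspace_dual[OF normed_space_James_c0]
  have "\<Phi> \<subseteq> vecs (dual James_c0)"
    using coord_James_c0 dsub by (auto simp: \<Phi>_def intro!: subspace_diff subspace_scale)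
  then have closed: "closed_subspace James_c0 L"
    unfolding L_def by (rule closed_subspace_common_kernel[OF normed_space_James_c0])
  have L_iff: "x \<in> L \<longleftrightarrow> x \<in> vecs James_c0 \<and> evens x = 0 \<and>
      (\<forall>m n. blk m = blk n \<longrightarrow> \<sigma> m * odds x m = \<sigma> n * odds x n)" for x
  proof (cases "x \<in> vecs James_c0")
    case True
    have "(\<forall>\<phi>\<in>\<Phi>. \<phi> x = 0) \<longleftrightarrow> (\<forall>n. coord James_c0 (2 * n) x = 0) \<and>
        (\<forall>m n. blk m = blk n \<longrightarrow> (\<sigma> m *\<^sub>R ?c m - \<sigma> n *\<^sub>R ?c n) x = 0)"
      unfolding \<Phi>_def by blast
    then show ?thesis using True by (auto simp: L_def coord_def evens_def odds_def fun_eq_iff)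
  qed (simp add: L_def)
  have "infinite_dimensional L"
  proof (rule infinite_dimensionalI)
    define u where "u j = interleave 0 (\<lambda>n. if blk n = j then \<sigma> n else 0)" for j
    show "u j \<in> L" for j
    proof -
      have "(\<lambda>n. if blk n = j then \<sigma> n else 0) \<in> vecs c0"
        by (rule finite_support_c0[of "N (Suc j)"]) (metis blk_less leD)
      then show ?thesis
        unfolding L_iff u_def using interleave_0_in \<sigma>_sq by simp
    qed
    fix n t k assume rel: "(\<Sum>j<n. t j *\<^sub>R u j) = 0" and k: "k < n"
    have "blk (N k) = k" by (rule blk_eq) (use strict_mono_less[OF N_mono] in simp_all)
    then have "u j (2 * N k + 1) = (if j = k then \<sigma> (N k) else 0)" for j
      by (simp add: u_def interleave_def)
    then have "(\<Sum>j<n. t j *\<^sub>R u j) (2 * N k + 1) = (\<Sum>j<n. if j = k then t j * \<sigma> (N k) else 0)"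
      unfolding sum_fun_apply by (intro sum.cong) auto
    also have "\<dots> = t k * \<sigma> (N k)" using k by simp
    finally show "t k = 0" using rel \<sigma>_abs[of "N k"] by auto
  qed
  moreover have "norming_over James_c0 M L"
    unfolding norming_over_def
  proof (intro exI[of _ "1/4 :: real"] conjI ballI)
    fix x assume "x \<in> L"
    then have x: "x \<in> vecs James_c0" "evens x = 0"
      and sign: "\<And>m n. blk m = blk n \<Longrightarrow> \<sigma> m * odds x m = \<sigma> n * odds x n"
      unfolding L_iff by blast+
    let ?z = "odds x"
    have z: "?z \<in> vecs c0" using x(1) by (simp add: vecs_direct_sum)
    define s where "s = vnorm James_c0 x"
    have s: "s = vnorm c0 ?z" using x(2) by (simp add: s_def vnorm_direct_sum)
    obtain n where n: "s = \<bar>?z n\<bar>" using vnorm_c0_attained[OF z] s by auto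
    define j where "j = blk n"
    define t where "t = \<sigma> n * ?z n"
    let ?f = "f (N j)" and ?K = "K (N j)"
    let ?a = "c0_coeff ?f"
    have fd: "?f \<in> vecs (dual James_c0)" using f(1) M(2) by blast
    have t: "\<bar>t\<bar> = s" by (simp add: t_def abs_mult \<sigma>_abs n)
    have block: "?z m * ?a m = t * \<bar>?a m\<bar>" if m: "m < ?K" for m
    proof (cases "m < N j")
      case True
      then show ?thesis using f(2) by simp
    next
      case False
      then have b: "blk m = j" using m by (intro blk_eq) (simp_all add: N_Suc)
      have "\<sigma> m * (\<sigma> m * ?z m) = \<sigma> m * t" using sign[of m n] b by (simp add: t_def j_def)
      then have "?z m = \<sigma> m * t" using \<sigma>_sq[of m] by (simp flip: mult.assoc)
      moreover have "\<sigma> m * ?a m = \<bar>?a m\<bar>" using b by (simp add: \<sigma>_def)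
      ultimately show ?thesis by (metis mult.assoc mult.commute)
    qed
    note sums = c0_coeff_sums[OF fd z]
    have "x = interleave 0 ?z" using interleave_evens_odds[of x] x(2) by simp
    then have "?f x = (\<Sum>m. ?z m * ?a m)" using sums_unique[OF sums] by simp
    also have "\<dots> = (\<Sum>m. ?z (m + ?K) * ?a (m + ?K)) + (\<Sum>m<?K. ?z m * ?a m)"
      by (rule suminf_split_initial_segment[OF sums_summable[OF sums]])
    also have "(\<Sum>m<?K. ?z m * ?a m) = t * (\<Sum>m<?K. \<bar>?a m\<bar>)"
      unfolding sum_distrib_left by (rule sum.cong) (simp_all add: block)
    finally have fx: "?f x = (\<Sum>m. ?z (m + ?K) * ?a (m + ?K)) + t * (\<Sum>m<?K. \<bar>?a m\<bar>)" .
    have "\<bar>\<Sum>m. ?z (m + ?K) * ?a (m + ?K)\<bar> \<le> s * (\<Sum>m. \<bar>?a (m + ?K)\<bar>)"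
      by (rule summable_bounded_mult(2))
        (use c0_coeff_summable[OF fd] c0_coord_le[OF z] s in \<open>auto simp: summable_iff_shift[of "\<lambda>m. \<bar>?a m\<bar>"]\<close>)
    also have "\<dots> \<le> s * (1/8)" using K(3) s vnorm_nonneg[OF normed_space_c0 z] by (intro mult_left_mono) auto
    finally have small: "\<bar>\<Sum>m. ?z (m + ?K) * ?a (m + ?K)\<bar> \<le> s / 8" by simp
    have "s * (3/8) \<le> \<bar>t\<bar> * (\<Sum>m<?K. \<bar>?a m\<bar>)"
      unfolding t using K(2) s vnorm_nonneg[OF normed_space_c0 z] by (intro mult_left_mono) auto
    also have "\<dots> = \<bar>t * (\<Sum>m<?K. \<bar>?a m\<bar>)\<bar>" by (simp add: abs_mult sum_nonneg)
    finally have "1/4 * s \<le> \<bar>?f x\<bar>" using small unfolding fx by linarith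
    then have "ennreal (1/4 * vnorm James_c0 x) \<le> ennreal \<bar>?f x\<bar>" by (simp add: s_def ennreal_leI)
    also have "\<dots> \<le> (SUP g\<in>{g \<in> M. ?nm g = 1}. ennreal \<bar>g x\<bar>)"
      by (rule SUP_upper) (use f(1,3) in simp)
    finally show "ennreal (1/4 * vnorm James_c0 x) \<le> (SUP g\<in>{g \<in> M. ?nm g = 1}. ennreal \<bar>g x\<bar>)" .
  qed simp
  ultimately show ?thesis using closed by blast
qed

definition James_part :: "((nat \<Rightarrow> real) \<Rightarrow> real) \<Rightarrow> (nat \<Rightarrow> real) \<Rightarrow> real" where
  "James_part f = (\<lambda>y. if y \<in> vecs James then f (interleave y 0) else 0)"

lemma James_part_in:
  assumes f: "f \<in> vecs (dual James_c0)"
  shows "James_part f \<in> vecs (dual James)"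
proof -
  note sub = normed_space_subspace[OF normed_space_James]
  have "linear_functional_on (vecs James) (James_part f)"
    using linear_functional_on_add[OF dual_linear[OF f] interleave_in_0 interleave_in_0]
      linear_functional_on_scale[OF dual_linear[OF f] interleave_in_0] sub
    by (simp add: linear_functional_on_def James_part_def interleave_add interleave_scale
        subspace_add subspace_scale)
  moreover have "\<bar>James_part f y\<bar> \<le> vnorm (dual James_c0) f * vnorm James y" if "y \<in> vecs James" for y
    using dual_apply_le[OF normed_space_James_c0 f interleave_in_0[OF that]] that
    by (simp add: James_part_def vnorm_interleave_in_0)
  ultimately show ?thesis by (auto simp: dual_iff James_part_def)
qed

lemma James_part_linear:
  "James_part (f + g) = James_part f + James_part g" "James_part (c *\<^sub>R f) = c *\<^sub>R James_part f"
  by (auto simp: James_part_def)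

lemma dual_decompose:
  assumes f: "f \<in> vecs (dual James_c0)" and x: "x \<in> vecs James_c0"
  shows "f x = James_part f (evens x) + f (interleave 0 (odds x))"
proof -
  have e: "evens x \<in> vecs James" and o: "odds x \<in> vecs c0" using x by (simp_all add: vecs_direct_sum)
  have "x = interleave (evens x) 0 + interleave 0 (odds x)" by (simp add: interleave_add)
  then show ?thesis
    using linear_functional_on_add[OF dual_linear[OF f] interleave_in_0[OF e] interleave_0_in[OF o]] e
    by (simp add: James_part_def)
qed

lemma vnorm_dual_le_James_part:
  assumes f: "f \<in> vecs (dual James_c0)"
  shows "vnorm (dual James_c0) f \<le> vnorm (dual James) (James_part f) + (\<Sum>n. \<bar>c0_coeff f n\<bar>)"
proof (rule vnorm_dual_le[OF normed_space_James_c0])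
  let ?p = "vnorm (dual James) (James_part f)" and ?s = "\<Sum>n. \<bar>c0_coeff f n\<bar>"
  have p: "0 \<le> ?p" using vnorm_dual_nonneg[OF normed_space_James James_part_in[OF f]] .
  have s: "0 \<le> ?s" by (rule suminf_nonneg[OF c0_coeff_summable[OF f]]) simp
  show "0 \<le> ?p + ?s" using p s by simp
  fix x assume x: "x \<in> vecs James_c0"
  then have e: "evens x \<in> vecs James" and o: "odds x \<in> vecs c0" by (simp_all add: vecs_direct_sum)
  have n: "0 \<le> vnorm James (evens x)" "0 \<le> vnorm c0 (odds x)"
    using e o vnorm_nonneg normed_space_James normed_space_c0 by blast+
  have "\<bar>f x\<bar> \<le> \<bar>James_part f (evens x)\<bar> + \<bar>f (interleave 0 (odds x))\<bar>"
    unfolding dual_decompose[OF f x] by (rule abs_triangle_ineq)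
  also have "\<dots> \<le> ?p * vnorm James (evens x) + ?s * vnorm c0 (odds x)"
    using dual_apply_le[OF normed_space_James James_part_in[OF f] e] c0_part_abs_le[OF f o]
    by (simp add: mult.commute)
  also have "\<dots> \<le> (?p + ?s) * vnorm James_c0 x"
    using p s n by (simp add: vnorm_direct_sum algebra_simps)
  finally show "\<bar>f x\<bar> \<le> (?p + ?s) * vnorm James_c0 x" .
qed

text \<open>
  The second alternative. If the coefficients carry at most half of the norm, then each coefficient
  is dominated by the norm of the restriction to the first summand. By the Hahn--Banach theorem it
  comes from the bidual of the James space, hence from a sequence on which the form stays at most 1.
  This sequence need not be null, but two of them have a nontrivial combination which is; it lies in
  the James space and has the same effect on \<open>S\<close> as a combination of two unit vectors of the second
  summand.
\<close>

lemma annihilated_vector: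
  assumes S: "subspace S" "S \<subseteq> vecs (dual James_c0)"
    and small: "\<And>f. f \<in> S \<Longrightarrow> (\<Sum>n. \<bar>c0_coeff f n\<bar>) \<le> vnorm (dual James_c0) f / 2"
  shows "\<exists>w\<in>vecs James_c0. (\<forall>f\<in>S. f w = 0) \<and>
    (\<exists>\<alpha> \<beta>. (\<alpha> \<noteq> 0 \<or> \<beta> \<noteq> 0) \<and> odds w = \<alpha> *\<^sub>R unit_seq i + \<beta> *\<^sub>R unit_seq j)"
proof -
  let ?p = "vnorm (dual James)"
  note Jsub = normed_space_subspace[OF normed_space_James]
  note JX = normed_space_James
  have coeff: "\<exists>x. james_bounded x 1 \<and>
      (\<forall>f\<in>S. (\<lambda>m. x m * James_part f (unit_seq m)) sums c0_coeff f n)" for n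
  proof -
    have le: "\<bar>c0_coeff f n\<bar> \<le> ?p (James_part f)" if f: "f \<in> S" for f
    proof -
      have fd: "f \<in> vecs (dual James_c0)" using f S(2) by blast
      have "(\<Sum>m\<in>{n}. \<bar>c0_coeff f m\<bar>) \<le> (\<Sum>m. \<bar>c0_coeff f m\<bar>)"
        by (rule sum_le_suminf[OF c0_coeff_summable[OF fd]]) auto
      then show ?thesis using small[OF f] vnorm_dual_le_James_part[OF fd] by simp
    qed
    obtain \<psi> where \<psi>: "linear_functional_on (vecs (dual James)) \<psi>"
      "\<And>f. f \<in> S \<Longrightarrow> \<psi> (James_part f) = c0_coeff f n"
      "\<And>h. h \<in> vecs (dual James) \<Longrightarrow> \<bar>\<psi> h\<bar> \<le> ?p h"
    proof (rule Hahn_Banach_through_map[of "vecs (dual James)" S James_part ?p "\<lambda>f. c0_coeff f n"])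
      show "linear_functional_on S (\<lambda>f. c0_coeff f n)"
        by (simp add: linear_functional_on_def c0_coeff_linear)
      show "James_part f \<in> vecs (dual James)" if "f \<in> S" for f
        using that S(2) James_part_in by blast
    qed (use S(1) le in \<open>simp_all add: James_part_linear subspace_dual[OF JX] vnorm_dual_triangle[OF JX] vnorm_dual_scale[OF JX]\<close>)
    have "(\<lambda>m. \<psi> (coord James m) * James_part f (unit_seq m)) sums c0_coeff f n" if f: "f \<in> S" for f
    proof -
      have "James_part f \<in> vecs (dual James)" using f S(2) James_part_in by blast
      from James_bidual(2)[OF \<psi>(1,3) this] show ?thesis using \<psi>(2)[OF f] by simp
    qed
    then show ?thesis
      using James_bidual(1)[OF \<psi>(1,3)] by (intro exI[of _ "\<lambda>m. \<psi> (coord James m)"]) simp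
  qed
  obtain x where x: "james_bounded x 1" "\<And>f. f \<in> S \<Longrightarrow> (\<lambda>m. x m * James_part f (unit_seq m)) sums c0_coeff f i"
    using coeff[of i] by blast
  obtain y where y: "james_bounded y 1" "\<And>f. f \<in> S \<Longrightarrow> (\<lambda>m. y m * James_part f (unit_seq m)) sums c0_coeff f j"
    using coeff[of j] by blast
  obtain c where c: "x \<longlonglongrightarrow> c" using james_bounded_convergent[OF x(1)] .
  obtain d where d: "y \<longlonglongrightarrow> d" using james_bounded_convergent[OF y(1)] .
  obtain \<alpha> \<beta> :: real where ab: "\<alpha> \<noteq> 0 \<or> \<beta> \<noteq> 0" "\<alpha> * c + \<beta> * d = 0"
  proof (cases "d = 0")
    case True
    then show ?thesis using that[of 0 1] by simp
  next
    case False
    then show ?thesis using that[of d "- c"] by simp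
  qed
  (* The limits cancel, so u is a null sequence and belongs to the James space. *)
  define u where "u = \<alpha> *\<^sub>R x + \<beta> *\<^sub>R y"
  have "james_bounded u (\<bar>\<alpha>\<bar> * 1 + \<bar>\<beta>\<bar> * 1)"
    unfolding u_def by (intro james_bounded_add james_bounded_scale x y)
  moreover have "u \<longlonglongrightarrow> 0"
  proof -
    have "(\<lambda>m. \<alpha> * x m + \<beta> * y m) \<longlonglongrightarrow> \<alpha> * c + \<beta> * d" by (intro tendsto_intros c d)
    moreover have "u = (\<lambda>m. \<alpha> * x m + \<beta> * y m)" by (auto simp: u_def)
    ultimately show ?thesis using ab(2) by simp
  qed
  ultimately have u: "u \<in> vecs James" by (auto simp: vecs_James)
  define z where "z = \<alpha> *\<^sub>R unit_seq i + \<beta> *\<^sub>R unit_seq j"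
  have z: "z \<in> vecs c0" unfolding z_def by (intro subspace_add subspace_scale subspace_c0 unit_seq_c0)
  have "f (interleave (- u) z) = 0" if f: "f \<in> S" for f
  proof -
    have fd: "f \<in> vecs (dual James_c0)" using f S(2) by blast
    have Jd: "James_part f \<in> vecs (dual James)" by (rule James_part_in[OF fd])
    have "(\<lambda>m. \<alpha> * (x m * James_part f (unit_seq m)) + \<beta> * (y m * James_part f (unit_seq m)))
        sums (\<alpha> * c0_coeff f i + \<beta> * c0_coeff f j)"
      by (intro sums_add sums_mult x(2)[OF f] y(2)[OF f])
    moreover have "(\<lambda>m. \<alpha> * (x m * James_part f (unit_seq m)) + \<beta> * (y m * James_part f (unit_seq m)))
        = (\<lambda>m. u m * James_part f (unit_seq m))"
      by (auto simp: u_def algebra_simps)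
    ultimately have "James_part f u = \<alpha> * c0_coeff f i + \<beta> * c0_coeff f j"
      using sums_unique2[OF James_functional_sums[OF Jd u]] by simp
    moreover have "f (interleave 0 z) = \<alpha> * c0_coeff f i + \<beta> * c0_coeff f j"
      using c0_part(1)[OF fd] linear_functional_on_add[OF c0_part(1)[OF fd], of "\<alpha> *\<^sub>R unit_seq i" "\<beta> *\<^sub>R unit_seq j"]
        linear_functional_on_scale[OF c0_part(1)[OF fd] unit_seq_c0]
        subspace_scale[OF subspace_c0 unit_seq_c0]
      by (simp add: z_def c0_coeff_def)
    moreover have "James_part f (- u) = - James_part f u"
      using linear_functional_on_scale[OF dual_linear[OF Jd] u, of "-1"] by simp
    ultimately show ?thesis
      using dual_decompose[OF fd, of "interleave (- u) z"] u z subspace_neg[OF Jsub u]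
      by (simp add: vecs_direct_sum)
  qed
  moreover have "interleave (- u) z \<in> vecs James_c0"
    using z subspace_neg[OF Jsub u] by (simp add: vecs_direct_sum)
  moreover have "odds (interleave (- u) z) = z" by simp
  ultimately show ?thesis using ab(1) unfolding z_def by blast
qed

text \<open>The vectors, not the functionals, that are annihilated.\<close>

definition preannihilator :: "((nat \<Rightarrow> real) \<Rightarrow> real) set \<Rightarrow> (nat \<Rightarrow> real) set" where
  "preannihilator S = {w \<in> vecs James_c0. \<forall>f\<in>S. f w = 0}"

text \<open>Disjoint pairs of unit vectors give linearly independent annihilated vectors.\<close>

lemma infinite_dimensional_preannihilator:
  assumes S: "subspace S" "S \<subseteq> vecs (dual James_c0)"
    and small: "\<And>f. f \<in> S \<Longrightarrow> (\<Sum>n. \<bar>c0_coeff f n\<bar>) \<le> vnorm (dual James_c0) f / 2"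
  shows "infinite_dimensional (preannihilator S)"
proof -
  have "\<exists>w \<alpha> \<beta>. w \<in> vecs James_c0 \<and> (\<forall>f\<in>S. f w = 0) \<and> (\<alpha> \<noteq> 0 \<or> \<beta> \<noteq> 0) \<and>
      odds w = \<alpha> *\<^sub>R unit_seq (2 * i) + \<beta> *\<^sub>R unit_seq (2 * i + 1)" for i
    using annihilated_vector[OF S small, of "2 * i" "2 * i + 1"] by blast
  then obtain w \<alpha> \<beta> where w: "\<And>i. w i \<in> vecs James_c0" "\<And>i. \<forall>f\<in>S. f (w i) = 0"
    "\<And>i. \<alpha> i \<noteq> 0 \<or> \<beta> i \<noteq> 0"
    "\<And>i. odds (w i) = \<alpha> i *\<^sub>R unit_seq (2 * i) + \<beta> i *\<^sub>R unit_seq (2 * i + 1)" by metis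
  show ?thesis
  proof (rule infinite_dimensionalI[of w])
    show "w i \<in> preannihilator S" for i using w by (simp add: preannihilator_def)
    fix n t k assume rel: "(\<Sum>i<n. t i *\<^sub>R w i) = 0" and k: "k < n"
    have o: "odds (\<Sum>i<n. t i *\<^sub>R w i) m = (\<Sum>i<n. t i * odds (w i) m)" for m
      by (simp add: odds_def sum_fun_apply)
    have "odds (w i) (2 * k) = (if i = k then \<alpha> k else 0)"
      "odds (w i) (2 * k + 1) = (if i = k then \<beta> k else 0)" for i
      by (auto simp: w(4) unit_seq_def)
    moreover have "(\<Sum>i<n. t i * (if i = k then r else 0)) = t k * r" for r
    proof -
      have "(\<Sum>i<n. t i * (if i = k then r else 0)) = (\<Sum>i<n. if i = k then t i * r else 0)"
        by (rule sum.cong) auto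
      then show ?thesis using k by simp
    qed
    ultimately have "t k * \<alpha> k = 0" "t k * \<beta> k = 0"
      using o[of "2 * k"] o[of "2 * k + 1"] unfolding rel by simp_all
    then show "t k = 0" using w(3)[of k] by auto
  qed
qed

text \<open>
  Dropping one linear condition on the functionals adds at most one dimension to them, so the
  annihilated vectors lose at most one.
\<close>

lemma preannihilator_relax_one_coeff:
  assumes S: "subspace S" "S \<subseteq> vecs (dual James_c0)"
    and inf: "infinite_dimensional (preannihilator {f \<in> S. c0_coeff f k = 0})"
  shows "infinite_dimensional (preannihilator S)"
proof (cases "\<exists>g\<in>S. c0_coeff g k \<noteq> 0")
  case False
  then have "{f \<in> S. c0_coeff f k = 0} = S" by blast
  then show ?thesis using inf by simp
next
  case True
  then obtain g where g: "g \<in> S" "c0_coeff g k \<noteq> 0" by blast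
  let ?S0 = "{f \<in> S. c0_coeff f k = 0}"
  have gd: "g \<in> vecs (dual James_c0)" using g S(2) by blast
  have "?S0 \<subseteq> vecs (dual James_c0)" using S(2) by blast
  then have sub: "subspace (preannihilator ?S0)"
    using closed_subspace_common_kernel[OF normed_space_James_c0, of ?S0]
    by (simp add: closed_subspace_def preannihilator_def)
  have "linear_functional_on (preannihilator ?S0) g"
    by (rule linear_functional_on_subset[OF dual_linear[OF gd]]) (auto simp: preannihilator_def)
  then have "infinite_dimensional {w \<in> preannihilator ?S0. g w = 0}"
    by (rule infinite_dimensional_kernel(2)[OF sub inf])
  moreover have "{w \<in> preannihilator ?S0. g w = 0} \<subseteq> preannihilator S"
  proof
    fix w assume w: "w \<in> {w \<in> preannihilator ?S0. g w = 0}"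
    have "f w = 0" if f: "f \<in> S" for f
    proof -
      define t where "t = c0_coeff f k / c0_coeff g k"
      have "f + (- t) *\<^sub>R g \<in> S" using S(1) f g(1) by (intro subspace_add subspace_scale)
      moreover have "c0_coeff (f + (- t) *\<^sub>R g) k = 0"
        unfolding c0_coeff_linear using g(2) by (simp add: t_def)
      ultimately have "(f + (- t) *\<^sub>R g) w = 0" using w unfolding preannihilator_def by blast
      then show ?thesis using w by simp
    qed
    then show "w \<in> preannihilator S" using w by (simp add: preannihilator_def)
  qed
  ultimately show ?thesis by (rule infinite_dimensional_mono)
qed

text \<open>
  If \<open>M\<close> is nowhere norming, the second alternative holds, for some \<open>k\<close>, for the functionals in \<open>M\<close>
  whose first \<open>k\<close> coefficients vanish. These conditions are removed one at a time, and what remains is a nonzero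
  vector on which all of \<open>M\<close> vanishes.
\<close>

lemma not_TNNS_James_c0: "\<not> TNNS James_c0"
proof
  assume "TNNS James_c0"
  then obtain M where M: "closed_subspace (dual James_c0) M" and total: "total_for James_c0 M"
    and nn: "nowhere_norming James_c0 M" by (auto simp: TNNS_def)
  have sub: "subspace M" using M by (simp add: closed_subspace_def)
  have Md: "M \<subseteq> vecs (dual James_c0)"
    by (rule closed_subspace_subset[OF normed_space_dual[OF normed_space_James_c0] M])
  define S where "S k = {f \<in> M. \<forall>n<k. c0_coeff f n = 0}" for k
  have S_sub: "subspace (S k)" for k
    using sub
    by (auto simp: S_def subspace_def c0_coeff_linear c0_coeff_def[of 0])
  have S_d: "S k \<subseteq> vecs (dual James_c0)" for k using Md by (auto simp: S_def)
  have "\<exists>k. \<forall>f\<in>S k. (\<Sum>n. \<bar>c0_coeff f n\<bar>) \<le> vnorm (dual James_c0) f / 2"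
  proof (rule ccontr)
    assume neg: "\<not> ?thesis"
    have "\<exists>f\<in>M. (\<forall>n<k. c0_coeff f n = 0) \<and> vnorm (dual James_c0) f / 2 < (\<Sum>n. \<bar>c0_coeff f n\<bar>)" for k
    proof -
      obtain f where "f \<in> S k" "\<not> (\<Sum>n. \<bar>c0_coeff f n\<bar>) \<le> vnorm (dual James_c0) f / 2" using neg by blast
      then show ?thesis unfolding S_def by (intro bexI[of _ f]) simp_all
    qed
    from norming_over_sign_blocks[OF sub Md this] show False using nn by (simp add: nowhere_norming_def)
  qed
  then obtain k where k: "\<And>f. f \<in> S k \<Longrightarrow> (\<Sum>n. \<bar>c0_coeff f n\<bar>) \<le> vnorm (dual James_c0) f / 2" by blast
  have "infinite_dimensional (preannihilator (S (k - i)))" for i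
  proof (induction i)
    case 0
    show ?case using infinite_dimensional_preannihilator[OF S_sub S_d k] by simp
  next
    case (Suc i)
    show ?case
    proof (cases "i < k")
      case True
      then have "S (k - i) = {f \<in> S (k - Suc i). c0_coeff f (k - Suc i) = 0}"
        unfolding S_def by (auto simp: less_Suc_eq simp flip: Suc_diff_Suc)
      then show ?thesis using preannihilator_relax_one_coeff[OF S_sub S_d, of "k - Suc i" "k - Suc i"] Suc by simp
    qed (use Suc in simp)
  qed
  from this[of k] have "infinite_dimensional (preannihilator M)" by (simp add: S_def)
  then obtain w where "w \<in> preannihilator M" "w \<noteq> 0" by (rule infinite_dimensional_nonzero)
  then show False using total by (auto simp: total_for_def preannihilator_def)
qed

section \<open>A nonquasireflexive space without total nowhere norming subspaces\<close>

theorem theorem5p1: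
  shows "\<exists>X :: (nat \<Rightarrow> real) nspace. banach_space X \<and> \<not> quasireflexive X \<and> \<not> TNNS X \<and>
    (\<exists>T. bounded_operator X c0 T \<and> strictly_singular X c0 T \<and> \<not> weakly_compact X c0 T)"
  using banach_space_James_c0 not_quasireflexive_James_c0 not_TNNS_James_c0
    bounded_operator_evens strictly_singular_evens not_weakly_compact_evens by blast

end
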